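(* Let $C\subset\mathbb{P}^3$ be a smooth irreducible non-degenerate complex projective curve of degree $d$. Let $p\in C\setminus\Gamma$ and let $\xi=(p,H)\in E$. Then every element $u\in R^{\xi}_{d-1}(p)$ satisfies $\nu_p(u)\geq d-2$.
   Context: The ground field is $\mathbb{C}$. For $q\in\mathbb{P}^3$, $\pi_q\colon C\to\mathbb{P}^2$ is the restriction to $C$ of the linear projection from $q$ (extended to a morphism if $q\in C$). $S\subset\mathbb{P}^3$ is the (finite) set of points $q$ such that $\pi_q$ is not birational onto its image; $C'=C\setminus S$ and $U=\mathbb{P}^3\setminus(C\cup S)$. Put $V_k=H^0(\mathbb{P}^3,\mathcal{O}_{\mathbb{P}^3}(k))$, $S_k=H^0(C,\mathcal{O}_C(k))$, with restriction map $\phi_k\colon V_k\to S_k$. For $q\in\mathbb{P}^3$, $W(q)\subset V_1$ is the space of linear forms vanishing at $q$, $W(q)_k=\mathrm{Sym}^kW(q)\subset V_k$, and $R_k(q)=\phi_k(W(q)_k)\subset S_k$. For $q\in U$, $\dim R_{d-1}(q)=n_{d-1}=\binom{d+1}{2}$, and $\rho_{d-1}\colon U\to G(n_{d-1},S_{d-1})$, $q\mapsto R_{d-1}(q)$, is the cone map to the Grassmannian of $n_{d-1}$-dimensional subspaces. Let $\nu\colon\widetilde{\mathbb{P}}^3\to\mathbb{P}^3$ be the blow-up along $C$, with exceptional divisor $E=\mathbb{P}(N_{C|\mathbb{P}^3})$; a point of $E$ over $p\in C$ is written $\xi=(p,H)$ with $H$ a plane containing the projective tangent line $t_p$ to $C$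 at $p$. Identifying $U$ with $\nu^{-1}(U)$, $\rho_{d-1}$ defines a rational map $\widetilde\rho_{d-1}\colon\widetilde{\mathbb{P}}^3\dashrightarrow G(n_{d-1},S_{d-1})$ with maximal domain of regularity $\mathcal{V}_{d-1}$, and for $\xi=(p,H)\in\mathcal{V}_{d-1}\cap E$ one sets $R^{\xi}_{d-1}(p)=\widetilde\rho_{d-1}(\xi)\subset S_{d-1}$. $\Gamma\subset C$ is the finite set of points $p\in C$ for which at least one of the following fails: (1) $p\in C'$; (2) $t_p\cap C=2p$ scheme-theoretically. All points of $E$ over $C\setminus\Gamma$ lie in $\mathcal{V}_{d-1}$, so $R^{\xi}_{d-1}(p)$ is defined there. For $u\in S_k$, $\nu_p(u)$ (the "evaluation" of $u$ at $p$) is the order of vanishing of $u$ at $p$ (with $\nu_p(0)=\infty$).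
   Formalization: It is additionally assumed that ξ lies in the domain of regularity V_{d-1}, where R^ξ_{d-1}(p) is defined; this is not automatic over C∖Γ: for the twisted cubic it fails when H is the osculating plane at p. *)

theory Defs
  imports
    "HOL-Analysis.Analysis"
    "HOL-Library.Function_Algebras"
    "HOL-Library.Extended_Nat"
begin

text \<open>
  Points, lines and planes of \<open>P^3\<close> are the linear subspaces of \<open>\<complex>^4\<close> of dimension
  1, 2 and 3; incidence is inclusion. Forms and sections of \<open>O(k)\<close> are functions on \<open>\<complex>^4\<close>
  (a polynomial over \<open>\<complex>\<close> is determined by its values), with pointwise linear structure.
\<close>

type_synonym vec4 = "complex ^ 4"
type_synonym psub = "vec4 set"
type_synonym cfun = "vec4 \<Rightarrow> complex"

interpretation cfun: vector_space "\<lambda>(a::complex) (f::cfun) x. a * f x"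
  by unfold_locales (auto simp: fun_eq_iff algebra_simps)

definition P3 :: "psub set" where
  "P3 = {q. vec.subspace q \<and> vec.dim q = 1}"

definition planes :: "psub set" where
  "planes = {H. vec.subspace H \<and> vec.dim H = 3}"

definition cone :: "psub set \<Rightarrow> vec4 set" where
  "cone Z = \<Union>Z - {0}"

definition forms :: "nat \<Rightarrow> cfun set" where
  "forms k = cfun.span {\<lambda>x. \<Prod>i\<in>UNIV. (x $ i) ^ e i |e :: 4 \<Rightarrow> nat. (\<Sum>i\<in>UNIV. e i) = k}"

definition vanishes_at :: "cfun \<Rightarrow> psub \<Rightarrow> bool" where
  "vanishes_at F q \<longleftrightarrow> (\<forall>x\<in>q. F x = 0)"


section \<open>Projective varieties\<close>

definition zclosed :: "psub set \<Rightarrow> bool" where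
  "zclosed Z \<longleftrightarrow> (\<exists>T \<subseteq> (\<Union>m. forms m). Z = {q \<in> P3. \<forall>F\<in>T. vanishes_at F q})"

definition irreducible_closed :: "psub set \<Rightarrow> bool" where
  "irreducible_closed Z \<longleftrightarrow> zclosed Z \<and> Z \<noteq> {} \<and>
     (\<forall>A B. zclosed A \<longrightarrow> zclosed B \<longrightarrow> Z \<subseteq> A \<union> B \<longrightarrow> Z \<subseteq> A \<or> Z \<subseteq> B)"

text \<open>Krull dimension.\<close>

definition proj_dim :: "psub set \<Rightarrow> enat" where
  "proj_dim Z = Sup {enat n |n. \<exists>A :: nat \<Rightarrow> psub set.
     (\<forall>i\<le>n. irreducible_closed (A i) \<and> A i \<subseteq> Z) \<and> (\<forall>i<n. A i \<subset> A (Suc i))}"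

definition ideal_of :: "psub set \<Rightarrow> nat \<Rightarrow> cfun set" where
  "ideal_of Z m = {F \<in> forms m. \<forall>q\<in>Z. vanishes_at F q}"

text \<open>
  The degree \<open>m\<close> part of the \<open>k\<close>-th power of the homogeneous ideal of \<open>Z\<close>.
\<close>

definition ideal_pow :: "psub set \<Rightarrow> nat \<Rightarrow> nat \<Rightarrow> cfun set" where
  "ideal_pow Z k m = cfun.span {\<lambda>x. (\<Prod>i<k. f i x) * h x |f h e j.
     (\<forall>i<k. f i \<in> ideal_of Z (e i)) \<and> h \<in> forms j \<and> (\<Sum>i<k. e i) + j = m}"

text \<open>
  The projective tangent space of \<open>Z\<close> at \<open>p\<close>, as the common kernel of the differentials
  of all forms vanishing on \<open>Z\<close>. For a smooth curve this is the line \<open>t_p\<close>.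
\<close>

definition tangent_space :: "psub set \<Rightarrow> psub \<Rightarrow> psub" where
  "tangent_space Z p = {v. \<forall>m. \<forall>F \<in> ideal_of Z m. \<forall>x \<in> p - {0}.
     deriv (\<lambda>t. F (x + t *s v)) 0 = 0}"

text \<open>
  The linear tangent space in \<open>\<complex>^4\<close> has dimension one more than the Zariski tangent space.
\<close>

definition smooth_irreducible_curve :: "psub set \<Rightarrow> bool" where
  "smooth_irreducible_curve C \<longleftrightarrow> irreducible_closed C \<and> proj_dim C = 1 \<and>
     (\<forall>p\<in>C. enat (vec.dim (tangent_space C p)) = proj_dim C + 1)"

definition nondegenerate :: "psub set \<Rightarrow> bool" where
  "nondegenerate C \<longleftrightarrow> (\<forall>H\<in>planes. \<not> (\<forall>q\<in>C. q \<subseteq> H))"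

text \<open>
  The degree is the number of points in a general plane section: the planes with
  equation \<open>a\<close> form the dual space, and \<open>\<Phi> \<noteq> 0\<close> is a nonempty open condition there.
\<close>

definition has_degree :: "psub set \<Rightarrow> nat \<Rightarrow> bool" where
  "has_degree C d \<longleftrightarrow> (\<exists>m. \<exists>\<Phi> \<in> forms m. (\<exists>a. a \<noteq> 0 \<and> \<Phi> a \<noteq> 0) \<and>
     (\<forall>a. a \<noteq> 0 \<longrightarrow> \<Phi> a \<noteq> 0 \<longrightarrow>
        finite {q\<in>C. \<forall>x\<in>q. (\<Sum>i\<in>UNIV. a $ i * x $ i) = 0} \<and>
        card {q\<in>C. \<forall>x\<in>q. (\<Sum>i\<in>UNIV. a $ i * x $ i) = 0} = d))"


section \<open>Sections of \<open>O(k)\<close> on the curve and order of vanishing\<close>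

text \<open>
  A section of \<open>O_C(k)\<close> is a function on the punctured affine cone over \<open>C\<close> (extended by
  zero) that is near each point a quotient of forms whose degrees differ by \<open>k\<close>. The
  neighbourhood may be taken to be the nonvanishing locus of the denominator, after
  multiplying numerator and denominator by a further form.
\<close>

definition sections :: "psub set \<Rightarrow> nat \<Rightarrow> cfun set" where
  "sections C k = {s. (\<forall>x. x \<notin> cone C \<longrightarrow> s x = 0) \<and>
     (\<forall>p\<in>C. \<exists>m. \<exists>F \<in> forms (m + k). \<exists>G \<in> forms m. \<not> vanishes_at G p \<and>
        (\<forall>x \<in> cone C. G x \<noteq> 0 \<longrightarrow> s x = F x / G x))}"

definition restr :: "psub set \<Rightarrow> cfun \<Rightarrow> cfun" where
  "restr C F = (\<lambda>x. if x \<in> cone C then F x else 0)"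

text \<open>
  \<open>vanishes_to_order C k p n u\<close>: the germ of \<open>u \<in> H^0(C, O_C(k))\<close> at \<open>p\<close> lies in
  \<open>\<mm>_p^n O_C(k)_p\<close>, where \<open>\<mm>_p\<close> is the maximal ideal of the local ring of \<open>C\<close> at \<open>p\<close>. It is
  the image of the homogeneous ideal of the point \<open>p\<close> in \<open>P^3\<close>.
\<close>

definition vanishes_to_order :: "psub set \<Rightarrow> nat \<Rightarrow> psub \<Rightarrow> nat \<Rightarrow> cfun \<Rightarrow> bool" where
  "vanishes_to_order C k p n u \<longleftrightarrow>
     (\<exists>m. \<exists>F \<in> ideal_pow {p} n (m + k). \<exists>G \<in> forms m. \<not> vanishes_at G p \<and>
        (\<forall>x \<in> cone C. G x \<noteq> 0 \<longrightarrow> u x = F x / G x))"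

definition ord_at :: "psub set \<Rightarrow> nat \<Rightarrow> psub \<Rightarrow> cfun \<Rightarrow> enat" where
  "ord_at C k p u = Sup {enat n |n. vanishes_to_order C k p n u}"


section \<open>Cones and projections\<close>

definition W :: "psub \<Rightarrow> cfun set" where
  "W q = {l \<in> forms 1. vanishes_at l q}"

definition Wk :: "psub \<Rightarrow> nat \<Rightarrow> cfun set" where
  "Wk q k = cfun.span {\<lambda>x. \<Prod>i<k. l i x |l. \<forall>i<k. l i \<in> W q}"

definition R :: "psub set \<Rightarrow> nat \<Rightarrow> psub \<Rightarrow> cfun set" where
  "R C k q = restr C ` Wk q k"

text \<open>
  The target plane of the projection from \<open>q\<close> is the set of lines through \<open>q\<close>; if
  \<open>q \<in> C\<close>, the extension to a morphism sends \<open>q\<close> to the tangent line.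
\<close>

definition proj_from :: "psub set \<Rightarrow> psub \<Rightarrow> psub \<Rightarrow> psub" where
  "proj_from C q x = (if x = q then tangent_space C q else vec.span (q \<union> x))"

text \<open>
  \<open>\<pi>_q\<close> is birational onto its image iff it has a rational inverse, that is, a rational map
  from the image to \<open>C\<close>, given by four forms of one degree on the target plane, whose
  composition with \<open>\<pi>_q\<close> is the identity on a nonempty open subset of \<open>C\<close>. (The
  other composition is then the identity as well, since \<open>\<pi>_q\<close> is dominant onto its image.)
  Forms of degree \<open>m\<close> on the plane \<open>P(\<complex>^4/q)\<close> are the elements of \<open>Wk q m\<close>; their value
  at a line \<open>y\<close> through \<open>q\<close> is that at any vector of \<open>y\<close> spanning it modulo \<open>q\<close>.
\<close>

definition proj_birational :: "psub set \<Rightarrow> psub \<Rightarrow> bool" where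
  "proj_birational C q \<longleftrightarrow>
     (\<exists>m. \<exists>G :: 4 \<Rightarrow> cfun. (\<forall>i. G i \<in> Wk q m) \<and>
       (\<exists>j. \<exists>B \<in> forms j. (\<exists>x\<in>C. \<not> vanishes_at B x) \<and>
         (\<forall>x\<in>C. \<not> vanishes_at B x \<longrightarrow>
            (\<forall>z \<in> proj_from C q x - q. (\<chi> i. G i z) \<in> x - {0}))))"

definition S :: "psub set \<Rightarrow> psub set" where
  "S C = {q \<in> P3. \<not> proj_birational C q}"

definition C' :: "psub set \<Rightarrow> psub set" where
  "C' C = C - S C"

definition U :: "psub set \<Rightarrow> psub set" where
  "U C = P3 - (C \<union> S C)"

text \<open>
  The multiplicity at \<open>x\<close> of the scheme-theoretic intersection of \<open>C\<close> with a linear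
  subspace \<open>L\<close>: the local ring of \<open>C\<close> at \<open>x\<close> is a discrete valuation ring, and the ideal of
  the intersection is generated by the linear forms vanishing on \<open>L\<close>.
\<close>

definition intersection_mult :: "psub set \<Rightarrow> psub \<Rightarrow> psub \<Rightarrow> enat" where
  "intersection_mult C L x = (INF l \<in> {l \<in> forms 1. vanishes_at l L}. ord_at C 1 x (restr C l))"

definition \<Gamma> :: "psub set \<Rightarrow> psub set" where
  "\<Gamma> C = {p \<in> C. \<not> (p \<in> C' C \<and>
     (\<forall>x\<in>C. intersection_mult C (tangent_space C p) x = (if x = p then 2 else 0)))}"


section \<open>The blow-up of \<open>P^3\<close> along \<open>C\<close>\<close>

text \<open>
  The points of the blow-up are the points of \<open>P^3 - C\<close> and the pairs \<open>(p, H)\<close>, with \<open>H\<close> a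
  plane containing \<open>t_p\<close>. The structure of a variety is that of \<open>Proj (\<Oplus> I^k)\<close>, with \<open>I\<close>
  the ideal of \<open>C\<close>: an element of \<open>(I^k)_m\<close> is a section of the line bundle
  \<open>O(m)(-kE)\<close>.
\<close>

datatype blpt = Off psub | Exc psub psub

definition exceptional :: "psub set \<Rightarrow> blpt set" where
  "exceptional C = {Exc p H |p H. p \<in> C \<and> H \<in> planes \<and> tangent_space C p \<subseteq> H}"

definition blowup :: "psub set \<Rightarrow> blpt set" where
  "blowup C = Off ` (P3 - C) \<union> exceptional C"

text \<open>
  Value at a point of the blow-up of \<open>a \<in> (I^k)_m\<close>, as a section of \<open>O(m)(-kE)\<close>. At
  \<open>(p, H)\<close>, with \<open>p = [x]\<close>, this is the class of \<open>a\<close> in \<open>Sym^k\<close> of the conormal space,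
  evaluated at the normal direction \<open>v \<in> H - t_p\<close>, that is the coefficient of \<open>t^k\<close> in
  \<open>a(x + t v)\<close>. Other choices of \<open>x\<close> and \<open>v\<close> multiply the values of all \<open>a \<in> (I^k)_m\<close> by a
  common nonzero factor, so that neither nonvanishing nor the quotient of two
  elements of the same \<open>(I^k)_m\<close> depends on them.
\<close>

fun bl_eval :: "psub set \<Rightarrow> nat \<Rightarrow> cfun \<Rightarrow> blpt \<Rightarrow> complex" where
  "bl_eval C k a (Off q) = a (SOME x. x \<in> q - {0})"
| "bl_eval C k a (Exc p H) =
     (let x = (SOME x. x \<in> p - {0}); v = (SOME v. v \<in> H - tangent_space C p)
      in Lim (at 0) (\<lambda>t. a (x + t *s v) / t ^ k))"

definition bl_open :: "psub set \<Rightarrow> blpt set \<Rightarrow> bool" where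
  "bl_open C N \<longleftrightarrow> N \<subseteq> blowup C \<and>
     (\<forall>\<zeta>\<in>N. \<exists>k m. \<exists>b \<in> ideal_pow C k m. bl_eval C k b \<zeta> \<noteq> 0 \<and>
        (\<forall>\<eta>\<in>blowup C. bl_eval C k b \<eta> \<noteq> 0 \<longrightarrow> \<eta> \<in> N))"

text \<open>As for sections, the neighbourhood is the nonvanishing locus of the denominator.\<close>

definition bl_regular :: "psub set \<Rightarrow> blpt set \<Rightarrow> (blpt \<Rightarrow> complex) \<Rightarrow> bool" where
  "bl_regular C N c \<longleftrightarrow>
     (\<forall>\<zeta>\<in>N. \<exists>k m. \<exists>a \<in> ideal_pow C k m. \<exists>b \<in> ideal_pow C k m. bl_eval C k b \<zeta> \<noteq> 0 \<and>
        (\<forall>\<eta>\<in>N. bl_eval C k b \<eta> \<noteq> 0 \<longrightarrow> c \<eta> = bl_eval C k a \<eta> / bl_eval C k b \<eta>))"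

text \<open>Regular maps from an open subset \<open>N\<close> of the blow-up to a vector space \<open>V\<close> of functions.\<close>

definition bl_regular_vec ::
  "psub set \<Rightarrow> blpt set \<Rightarrow> cfun set \<Rightarrow> (blpt \<Rightarrow> cfun) \<Rightarrow> bool" where
  "bl_regular_vec C N V s \<longleftrightarrow>
     (\<exists>B c. finite B \<and> B \<subseteq> V \<and> (\<forall>e\<in>B. bl_regular C N (c e)) \<and>
        (\<forall>\<zeta>\<in>N. s \<zeta> = (\<lambda>x. \<Sum>e\<in>B. c e \<zeta> * e x)))"

definition grassmannian :: "nat \<Rightarrow> cfun set \<Rightarrow> cfun set set" where
  "grassmannian n V = {T. cfun.subspace T \<and> T \<subseteq> V \<and> cfun.dim T = n}"

text \<open>
  Morphisms to the Grassmannian: the tautological subbundle is locally trivial, so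
  locally the map is spanned by a regular frame.
\<close>

definition grass_morphism ::
  "psub set \<Rightarrow> blpt set \<Rightarrow> nat \<Rightarrow> cfun set \<Rightarrow> (blpt \<Rightarrow> cfun set) \<Rightarrow> bool" where
  "grass_morphism C N n V g \<longleftrightarrow> (\<forall>\<zeta>\<in>N. g \<zeta> \<in> grassmannian n V) \<and>
     (\<forall>\<zeta>\<in>N. \<exists>M s. bl_open C M \<and> \<zeta> \<in> M \<and> M \<subseteq> N \<and>
        (\<forall>i<n. bl_regular_vec C M V (s i)) \<and>
        (\<forall>\<eta>\<in>M. g \<eta> = cfun.span ((\<lambda>i. s i \<eta>) ` {..<n})))"


section \<open>The extended cone map\<close>

text \<open>
  \<open>(N, g)\<close> represents the rational map from the blow-up to \<open>G(n_{d-1}, S_{d-1})\<close> defined by the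
  cone map \<open>q \<mapsto> R_{d-1}(q)\<close> on \<open>U\<close>: the two agree on a nonempty open set.
\<close>

definition represents_cone_map ::
  "psub set \<Rightarrow> nat \<Rightarrow> blpt set \<Rightarrow> (blpt \<Rightarrow> cfun set) \<Rightarrow> bool" where
  "represents_cone_map C d N g \<longleftrightarrow> bl_open C N \<and>
     grass_morphism C N ((d + 1) choose 2) (sections C (d - 1)) g \<and>
     (\<exists>M. bl_open C M \<and> M \<noteq> {} \<and> M \<subseteq> N \<inter> Off ` U C \<and>
        (\<forall>q. Off q \<in> M \<longrightarrow> g (Off q) = R C (d - 1) q))"

text \<open>The maximal domain of regularity, i.e. the union of the domains of all representatives.\<close>

definition regularity_domain :: "psub set \<Rightarrow> nat \<Rightarrow> blpt set" where
  "regularity_domain C d = {\<xi>. \<exists>N g. represents_cone_map C d N g \<and> \<xi> \<in> N}"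

text \<open>
  The value of the rational map at \<open>\<xi>\<close> in its domain of regularity. It does not depend on the
  representative, the blow-up being irreducible and the Grassmannian separated.
\<close>

definition R_ext :: "psub set \<Rightarrow> nat \<Rightarrow> blpt \<Rightarrow> cfun set" where
  "R_ext C d \<xi> = (SOME T. \<exists>N g. represents_cone_map C d N g \<and> \<xi> \<in> N \<and> T = g \<xi>)"

end

theory Submission
  imports Defs "HOL-Computational_Algebra.Fundamental_Theorem_Algebra"
begin

text \<open>
  Let \<open>x0, y1, y2, y3\<close> be linear coordinates with \<open>p = [e0]\<close> and \<open>t_p = {y2 = y3 = 0}\<close>, and let \<open>q_t\<close> move
  to \<open>p\<close> in the direction \<open>v\<close>. Elements of \<open>R(q_t)\<close> are restrictions of \<open>f(z - x0(z) (q_t - p))\<close> with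
  \<open>f\<close> a form of degree \<open>d - 1\<close> in \<open>y1, y2, y3\<close>, so their limits are spanned by such \<open>f\<close> and by the
  derivatives \<open>x0 \<partial>\<^sub>v f\<close> of those \<open>f\<close> that vanish on \<open>C\<close>; both vanish to order \<open>d - 2\<close> at \<open>p\<close>. This requires
  that \<open>x0 \<partial>\<^sub>v f\<close> is not itself a form in \<open>y1, y2, y3\<close> on \<open>C\<close>. Comparing orders at \<open>p\<close>, for \<open>v\<close> outside
  the osculating plane it could only be one if the plane curve \<open>f = 0\<close>, which contains the
  projection of \<open>C\<close> from \<open>p\<close>, were singular at the image of \<open>t_p\<close>. Then the lines through this
  image would meet the projection in at most \<open>d - 3\<close> further points, whereas the planes through
  \<open>t_p\<close>, having intersection multiplicity 2 with \<open>C\<close> at \<open>p\<close>, cut \<open>C\<close> in \<open>d - 2\<close> further points. The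
  exceptional direction of the osculating plane follows by closedness along the fibre of \<open>E\<close>.
\<close>


text \<open>The two counts of points are never made on the curve. They become dimensions of graded
  pieces of the coordinate ring, and the degree enters through \<open>d\<close> distinct points of
  one plane section. The ring being a domain, the quotients by any two nonzero linear forms have
  equal dimension in each degree; so the quotient by a plane through \<open>t_p\<close> has
  dimension at least \<open>d\<close> in large degree. An equation of degree at most
  \<open>d - 3\<close> in \<open>y1\<close> bounds it by \<open>2 + (d - 3)\<close>, where 2 is the
  length of the intersection of \<open>t_p\<close> and \<open>C\<close>. This reduction needs
  \<open>x0\<close> eliminated, and here birationality of the projection from \<open>p\<close>
  enters: \<open>x0\<close> is a quotient of forms in \<open>y1, y2, y3\<close>, and its denominator
  can be made a form in \<open>y2, y3\<close> alone, which on a plane through \<open>t_p\<close> is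
  a constant times a power of \<open>y2\<close>. The point \<open>q_t\<close> moves on an arc
  \<open>x + s v + s^2 w\<close>. A line in direction \<open>v\<close> need not meet the open set
  where the rational map is known to be given by cones; the quadratic term steers the arc into it
  and leaves the tangent direction unchanged.\<close>

section \<open>Spans of functions: pointwise operations, finite bases, linear relations\<close>

lemma cfun_span_add: "f \<in> cfun.span A \<Longrightarrow> g \<in> cfun.span A \<Longrightarrow> (\<lambda>x. f x + g x) \<in> cfun.span A"
  using cfun.span_add[of f A g] by (simp add: plus_fun_def)

lemma cfun_span_zero: "(\<lambda>_. 0) \<in> cfun.span A"
  using cfun.span_zero[of A] by (simp add: zero_fun_def)

lemma cfun_span_scale: "f \<in> cfun.span A \<Longrightarrow> (\<lambda>x. c * f x) \<in> cfun.span A"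
  using cfun.span_scale[of f A c] by simp

lemma cfun_span_induct [consumes 1, case_names base zero add scale]:
  assumes "f \<in> cfun.span A"
    and base: "\<And>f. f \<in> A \<Longrightarrow> P f"
    and zero: "P (\<lambda>_. 0)"
    and add: "\<And>f g. P f \<Longrightarrow> P g \<Longrightarrow> P (\<lambda>x. f x + g x)"
    and scale: "\<And>c f. P f \<Longrightarrow> P (\<lambda>x. c * f x)"
  shows "P f"
proof -
  have "cfun.subspace {f. P f}"
    unfolding cfun.subspace_def using zero add scale
    by (auto simp: zero_fun_def plus_fun_def)
  then show ?thesis
    using cfun.span_induct[OF assms(1), of P] base by blast
qed

lemma sum_fun_apply: "(\<Sum>i\<in>I. f i) x = (\<Sum>i\<in>I. f i x)" for f :: "'a \<Rightarrow> cfun"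
  by (induction I rule: infinite_finite_induct) (auto simp: zero_fun_def plus_fun_def)

lemma cfun_span_sum:
  "(\<And>i. i \<in> I \<Longrightarrow> f i \<in> cfun.span A) \<Longrightarrow> (\<lambda>x. \<Sum>i\<in>I. f i x) \<in> cfun.span A"
  by (induction I rule: infinite_finite_induct) (auto intro: cfun_span_zero cfun_span_add)

text \<open>The coefficients are indexed by \<open>I\<close> and not by the functions, because a
  family such as a local frame need not be presented as an injective one.\<close>

lemma cfun_span_family:
  assumes "finite I" "u \<in> cfun.span (s ` I)"
  shows "\<exists>a. u = (\<lambda>x. \<Sum>i\<in>I. a i * s i x)"
  using assms(2)
proof (induction rule: cfun_span_induct)
  case (base f)
  then obtain i where i: "i \<in> I" "f = s i" by blast
  have "f = (\<lambda>x. \<Sum>j\<in>I. (if j = i then 1 else 0) * s j x)"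
    using i assms(1) by (simp add: if_distrib[of "\<lambda>u. u * _"] sum.delta cong: if_cong)
  then show ?case by (rule exI[where x="\<lambda>j. if j = i then 1 else 0"])
next
  case zero
  show ?case by (rule exI[of _ "\<lambda>_. 0"]) simp
next
  case (add f g)
  then obtain a b where "f = (\<lambda>x. \<Sum>i\<in>I. a i * s i x)" "g = (\<lambda>x. \<Sum>i\<in>I. b i * s i x)" by blast
  then show ?case
    by (intro exI[of _ "\<lambda>i. a i + b i"]) (simp add: sum.distrib algebra_simps)
next
  case (scale c f)
  then obtain a where "f = (\<lambda>x. \<Sum>i\<in>I. a i * s i x)" by blast
  then show ?case
    by (intro exI[of _ "\<lambda>i. c * a i"]) (simp add: sum_distrib_left algebra_simps)
qed

text \<open>Two equal members give the relation with coefficients 1 and -1; an injective family has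
  more values than the spanning set has elements, so its values are dependent.\<close>

lemma cfun_pigeonhole:
  assumes "finite I" "finite Y" "card Y < card I" "\<And>i. i \<in> I \<Longrightarrow> \<phi> i \<in> cfun.span Y"
  shows "\<exists>c. (\<exists>i\<in>I. c i \<noteq> 0) \<and> (\<forall>x. (\<Sum>i\<in>I. c i * \<phi> i x) = 0)"
proof (cases "inj_on \<phi> I")
  case True
  have "cfun.dependent (\<phi> ` I)"
  proof (rule ccontr)
    assume "cfun.independent (\<phi> ` I)"
    then have "card (\<phi> ` I) \<le> card Y"
      using cfun.independent_span_bound[OF assms(2)] assms(4) by blast
    then show False using card_image[OF True] assms(3) by simp
  qed
  then obtain u where u: "\<exists>v\<in>\<phi> ` I. u v \<noteq> 0" "(\<Sum>v\<in>\<phi> ` I. (\<lambda>x. u v * v x)) = 0"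
    using cfun.dependent_finite[of "\<phi> ` I"] assms(1) by auto
  have "(\<Sum>i\<in>I. u (\<phi> i) * \<phi> i x) = 0" for x
  proof -
    have "(\<Sum>v\<in>\<phi> ` I. (\<lambda>x. u v * v x)) x = 0" using u(2) by simp
    then show ?thesis unfolding sum_fun_apply by (simp add: sum.reindex[OF True])
  qed
  then show ?thesis using u(1) by (intro exI[of _ "\<lambda>i. u (\<phi> i)"]) auto
next
  case False
  then obtain i j where ij: "i \<in> I" "j \<in> I" "i \<noteq> j" "\<phi> i = \<phi> j" unfolding inj_on_def by blast
  define c :: "'a \<Rightarrow> complex" where "c k = (if k = i then 1 else if k = j then -1 else 0)" for k
  have "(\<Sum>k\<in>I. c k * \<phi> k x) = 0" for x
  proof -
    have "(\<Sum>k\<in>I. c k * \<phi> k x) = (\<Sum>k\<in>{i,j}. c k * \<phi> k x)"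
      by (rule sum.mono_neutral_right) (use assms(1) ij in \<open>auto simp: c_def\<close>)
    then show ?thesis using ij by (simp add: c_def)
  qed
  then show ?thesis using ij by (intro exI[of _ c]) (auto simp: c_def)
qed

text \<open>The basis is taken from \<open>V\<close> itself, so that properties of the elements of
  \<open>V\<close> pass to its members.\<close>

lemma cfun_basis:
  assumes "V \<subseteq> cfun.span Y" "finite Y"
  obtains B where "B \<subseteq> V" "finite B" "cfun.independent B" "V \<subseteq> cfun.span B"
proof -
  obtain B where B: "B \<subseteq> V" "cfun.independent B" "V \<subseteq> cfun.span B"
    using cfun.maximal_independent_subset[of V] by blast
  then show ?thesis using that cfun.independent_span_bound[OF assms(2) B(2)] assms(1) by blast
qed

lemma cfun_independentD:
  assumes "cfun.independent B" "finite B" "\<And>x. (\<Sum>b\<in>B. c b * b x) = 0" "b \<in> B"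
  shows "c b = 0"
proof -
  have "(\<Sum>b\<in>B. (\<lambda>x. c b * b x)) = (0::cfun)"
    by (rule ext) (simp only: sum_fun_apply assms(3) zero_fun_def)
  then show ?thesis using assms cfun.dependent_finite[of B] by auto
qed

section \<open>Homogeneous polynomials in a set of functions\<close>

text \<open>One notion covers the forms (\<open>X\<close> the coordinates), the cone forms
  (\<open>X = W q\<close>) and the polynomials in some of the coordinates of a frame. Multiplication
  is by one generator at a time, which makes the degree available to induction. The zero function
  has every degree.\<close>

inductive pol :: "cfun set \<Rightarrow> nat \<Rightarrow> cfun \<Rightarrow> bool" for X where
  pol_const: "pol X 0 (\<lambda>_. c)"
| pol_zero: "pol X k (\<lambda>_. 0)"
| pol_times: "l \<in> X \<Longrightarrow> pol X k f \<Longrightarrow> pol X (Suc k) (\<lambda>x. l x * f x)"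
| pol_plus: "pol X k f \<Longrightarrow> pol X k g \<Longrightarrow> pol X k (\<lambda>x. f x + g x)"

lemma pol_scale: "pol X k f \<Longrightarrow> pol X k (\<lambda>x. c * f x)"
proof (induction rule: pol.induct)
  case (pol_const a)
  then show ?case using pol.pol_const[of X "c * a"] by simp
next
  case (pol_zero k)
  then show ?case using pol.pol_zero[of X k] by simp
next
  case (pol_times l k f)
  from pol.pol_times[OF pol_times(1,3)] show ?case by (simp add: algebra_simps)
next
  case (pol_plus k f g)
  from pol.pol_plus[OF pol_plus(3,4)] show ?case by (simp add: algebra_simps)
qed

lemma pol_uminus: "pol X k f \<Longrightarrow> pol X k (\<lambda>x. - f x)"
  using pol_scale[of X k f "-1"] by simp

lemma pol_diff: "pol X k f \<Longrightarrow> pol X k g \<Longrightarrow> pol X k (\<lambda>x. f x - g x)"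
  using pol_plus[OF _ pol_uminus, of X k f g] by simp

lemma pol_mult: "pol X j f \<Longrightarrow> pol X k g \<Longrightarrow> pol X (j + k) (\<lambda>x. f x * g x)"
proof (induction rule: pol.induct)
  case (pol_const a)
  then show ?case using pol_scale[of X k g a] by simp
next
  case (pol_zero j)
  then show ?case using pol.pol_zero[of X "j + k"] by simp
next
  case (pol_times l k f)
  from pol.pol_times[OF pol_times(1) pol_times(3)] pol_times(4)
  show ?case by (simp add: mult.assoc)
next
  case (pol_plus k f g)
  from pol.pol_plus[OF pol_plus(3,4)] pol_plus(5) show ?case by (simp add: algebra_simps)
qed

lemma pol_mult': "pol X j f \<Longrightarrow> pol X k g \<Longrightarrow> n = j + k \<Longrightarrow> pol X n (\<lambda>x. f x * g x)"
  using pol_mult by blast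

lemma pol_sum: "(\<And>i. i \<in> I \<Longrightarrow> pol X k (f i)) \<Longrightarrow> pol X k (\<lambda>x. \<Sum>i\<in>I. f i x)"
  by (induction I rule: infinite_finite_induct) (auto intro: pol_zero pol_plus)

lemma pol_one: "pol X 0 (\<lambda>_. 1)"
  by (rule pol_const)

lemma pol_prod:
  "(\<And>i. i \<in> I \<Longrightarrow> pol X (e i) (f i)) \<Longrightarrow> pol X (\<Sum>i\<in>I. e i) (\<lambda>x. \<Prod>i\<in>I. f i x)"
  by (induction I rule: infinite_finite_induct) (auto intro: pol_one pol_mult)

lemma pol_var: "l \<in> X \<Longrightarrow> pol X 1 l"
  using pol_times[of l X 0 "\<lambda>_. 1"] pol_one by simp

lemma pol_power: "pol X k f \<Longrightarrow> pol X (n * k) (\<lambda>x. f x ^ n)"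
  by (induction n) (auto intro: pol_one pol_mult)

lemma pol_power_var: "l \<in> X \<Longrightarrow> pol X n (\<lambda>x. l x ^ n)"
  using pol_power[OF pol_var, of l X n] by simp

lemma pol_trans: "pol X k f \<Longrightarrow> (\<And>l. l \<in> X \<Longrightarrow> pol Y 1 l) \<Longrightarrow> pol Y k f"
proof (induction rule: pol.induct)
  case (pol_times l k f)
  then show ?case using pol_mult[of Y 1 l k f] by simp
qed (auto intro: pol.intros)

lemma pol_0D: "pol X 0 f \<Longrightarrow> \<exists>c. f = (\<lambda>_. c)"
proof (induction "0::nat" f rule: pol.induct)
  case (pol_plus f g)
  then obtain c d where "f = (\<lambda>_. c)" "g = (\<lambda>_. d)" by blast
  then show ?case by (intro exI[of _ "c + d"]) simp
qed auto

lemma pol_mono: "pol X k f \<Longrightarrow> X \<subseteq> Y \<Longrightarrow> pol Y k f"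
  by (erule pol_trans) (metis pol_var subsetD)

definition crd :: "cfun set" where
  "crd = range (\<lambda>i x. x $ i)"

lemma forms_iff: "F \<in> forms k \<longleftrightarrow> pol crd k F"
proof
  assume "F \<in> forms k"
  then show "pol crd k F"
    unfolding forms_def
  proof (induction rule: cfun_span_induct)
    case (base f)
    then obtain e :: "4 \<Rightarrow> nat" where e: "f = (\<lambda>x. \<Prod>i\<in>UNIV. (x $ i) ^ e i)" "(\<Sum>i\<in>UNIV. e i) = k"
      by blast
    have "pol crd (\<Sum>i\<in>UNIV. e i) (\<lambda>x. \<Prod>i\<in>UNIV. (x $ i) ^ e i)"
      by (rule pol_prod) (auto simp: crd_def intro!: pol_power_var[of "\<lambda>x. x $ _"])
    with e show ?case by simp
  qed (auto intro: pol_zero pol_plus pol_scale)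
next
  assume "pol crd k F"
  then show "F \<in> forms k"
  proof (induction rule: pol.induct)
    case (pol_const c)
    have "(\<lambda>x::vec4. \<Prod>i\<in>(UNIV::4 set). (x $ i) ^ (\<lambda>_. 0::nat) i) \<in> forms 0"
      unfolding forms_def
      by (rule cfun.span_base, rule CollectI, rule exI[of _ "\<lambda>_. 0"]) (simp only: sum.neutral_const refl simp_thms)
    then have "(\<lambda>x::vec4. c * (\<Prod>i\<in>(UNIV::4 set). (x $ i) ^ (\<lambda>_. 0::nat) i)) \<in> forms 0"
      unfolding forms_def by (rule cfun_span_scale)
    then show ?case by simp
  next
    case (pol_zero k)
    then show ?case unfolding forms_def by (rule cfun_span_zero)
  next
    case (pol_times l k f)
    from pol_times(1) obtain i where l: "l = (\<lambda>x. x $ i)" unfolding crd_def by blast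
    from pol_times(3) have "(\<lambda>x. x $ i * f x) \<in> forms (Suc k)"
      unfolding forms_def
    proof (induction rule: cfun_span_induct)
      case (base f)
      then obtain e :: "4 \<Rightarrow> nat" where e: "f = (\<lambda>x. \<Prod>i\<in>UNIV. (x $ i) ^ e i)" "(\<Sum>i\<in>UNIV. e i) = k"
        by blast
      define e' where "e' = e(i := Suc (e i))"
      have "(\<Sum>j\<in>UNIV. e' j) = Suc k"
      proof -
        have "(\<Sum>j\<in>UNIV. e' j) = e' i + (\<Sum>j\<in>UNIV - {i}. e' j)" by (rule sum.remove) auto
        also have "(\<Sum>j\<in>UNIV - {i}. e' j) = (\<Sum>j\<in>UNIV - {i}. e j)"
          by (rule sum.cong) (auto simp: e'_def)
        also have "e' i + \<dots> = Suc (e i + (\<Sum>j\<in>UNIV - {i}. e j))" by (simp add: e'_def)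
        also have "e i + (\<Sum>j\<in>UNIV - {i}. e j) = (\<Sum>j\<in>UNIV. e j)"
          by (rule sum.remove[symmetric]) auto
        finally show ?thesis using e by simp
      qed
      moreover have "x $ i * f x = (\<Prod>j\<in>UNIV. (x $ j) ^ e' j)" for x
      proof -
        have "(\<Prod>j\<in>UNIV. (x $ j) ^ e' j) = (x $ i) ^ e' i * (\<Prod>j\<in>UNIV - {i}. (x $ j) ^ e' j)"
          by (rule prod.remove) auto
        also have "(\<Prod>j\<in>UNIV - {i}. (x $ j) ^ e' j) = (\<Prod>j\<in>UNIV - {i}. (x $ j) ^ e j)"
          by (rule prod.cong) (auto simp: e'_def)
        also have "(x $ i) ^ e' i * \<dots> = x $ i * ((x $ i) ^ e i * (\<Prod>j\<in>UNIV - {i}. (x $ j) ^ e j))"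
          by (simp add: e'_def)
        also have "(x $ i) ^ e i * (\<Prod>j\<in>UNIV - {i}. (x $ j) ^ e j) = (\<Prod>j\<in>UNIV. (x $ j) ^ e j)"
          by (rule prod.remove[symmetric]) auto
        finally show ?thesis using e by simp
      qed
      ultimately show ?case by (intro cfun.span_base) blast
    next
      case zero
      then show ?case using cfun_span_zero by simp
    next
      case (add f g)
      from cfun_span_add[OF this] show ?case by (simp add: algebra_simps)
    next
      case (scale c f)
      from cfun_span_scale[OF this, of c] show ?case by (simp add: algebra_simps)
    qed
    then show ?case using l by simp
  next
    case (pol_plus k f g)
    then show ?case unfolding forms_def by (blast intro: cfun_span_add)
  qed
qed

lemma Wk_iff: "F \<in> Wk q k \<longleftrightarrow> pol (W q) k F"
proof
  assume "F \<in> Wk q k"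
  then show "pol (W q) k F"
    unfolding Wk_def
  proof (induction rule: cfun_span_induct)
    case (base f)
    then obtain l where l: "f = (\<lambda>x. \<Prod>i<k. l i x)" "\<forall>i<k. l i \<in> W q" by blast
    have "pol (W q) (\<Sum>i\<in>{..<k}. 1) (\<lambda>x. \<Prod>i\<in>{..<k}. l i x)"
      by (rule pol_prod) (use l in \<open>auto intro: pol_var[simplified]\<close>)
    then show ?case using l by simp
  qed (auto intro: pol_zero pol_plus pol_scale)
next
  assume "pol (W q) k F"
  then show "F \<in> Wk q k"
  proof (induction rule: pol.induct)
    case (pol_const c)
    have "(\<lambda>x. 1) \<in> Wk q 0" unfolding Wk_def by (rule cfun.span_base) auto
    then show ?case unfolding Wk_def using cfun_span_scale[of "\<lambda>x. 1" _ c] by simp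
  next
    case (pol_zero k)
    then show ?case unfolding Wk_def by (rule cfun_span_zero)
  next
    case (pol_times l k f)
    from pol_times(3) show ?case unfolding Wk_def
    proof (induction rule: cfun_span_induct)
      case (base f)
      then obtain m where m: "f = (\<lambda>x. \<Prod>i<k. m i x)" "\<forall>i<k. m i \<in> W q" by blast
      have "(\<lambda>x. l x * f x) = (\<lambda>x. \<Prod>i<Suc k. (m(k := l)) i x)"
        using m(1) by (simp add: mult.commute)
      then show ?case using m(2) pol_times(1)
        by (intro cfun.span_base CollectI exI[of _ "m(k := l)"]) (auto simp: less_Suc_eq)
    next
      case zero
      then show ?case using cfun_span_zero by simp
    next
      case (add f g)
      from cfun_span_add[OF this] show ?case by (simp add: algebra_simps)
    next
      case (scale c f)
      from cfun_span_scale[OF this, of c] show ?case by (simp add: algebra_simps)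
    qed
  next
    case (pol_plus k f g)
    then show ?case unfolding Wk_def by (blast intro: cfun_span_add)
  qed
qed

lemmas forms_const = pol_const[of crd, folded forms_iff]
  and forms_zero = pol_zero[of crd, folded forms_iff]
  and forms_add = pol_plus[of crd, folded forms_iff]
  and forms_scale = pol_scale[of crd, folded forms_iff]
  and forms_uminus = pol_uminus[of crd, folded forms_iff]
  and forms_diff = pol_diff[of crd, folded forms_iff]
  and forms_mult = pol_mult[of crd, folded forms_iff]
  and forms_mult' = pol_mult'[of crd, folded forms_iff]
  and forms_sum = pol_sum[of _ crd, folded forms_iff]
  and forms_power = pol_power[of crd, folded forms_iff]

lemma forms_power1: "l \<in> forms 1 \<Longrightarrow> (\<lambda>x. l x ^ n) \<in> forms n"
  using forms_power[where k = 1 and f = l and n = n] by simp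

lemma forms_finite_span: "\<exists>Y. finite Y \<and> forms k = cfun.span Y"
proof -
  let ?Y = "{\<lambda>x::vec4. \<Prod>i\<in>UNIV. (x $ i) ^ e i |e :: 4 \<Rightarrow> nat. (\<Sum>i\<in>UNIV. e i) = k}"
  have "?Y \<subseteq> (\<lambda>e x. \<Prod>i\<in>UNIV. (x $ i) ^ e i) ` (PiE UNIV (\<lambda>_::4. {..k}))"
  proof
    fix f assume "f \<in> ?Y"
    then obtain e :: "4 \<Rightarrow> nat" where e: "f = (\<lambda>x. \<Prod>i\<in>UNIV. (x $ i) ^ e i)" "(\<Sum>i\<in>UNIV. e i) = k"
      by blast
    have "e i \<le> k" for i
      using member_le_sum[of i UNIV e] e(2) by simp
    then have "e \<in> PiE UNIV (\<lambda>_::4. {..k})" by (simp add: PiE_UNIV_domain)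
    then show "f \<in> (\<lambda>e x. \<Prod>i\<in>UNIV. (x $ i) ^ e i) ` (PiE UNIV (\<lambda>_::4. {..k}))"
      unfolding e(1) by (rule imageI)
  qed
  moreover have "finite (PiE UNIV (\<lambda>_::4. {..k}))" by (rule finite_PiE) auto
  ultimately have "finite ?Y" by (meson finite_imageI finite_subset)
  then show ?thesis unfolding forms_def by blast
qed

lemma pol_homog: "pol X k F \<Longrightarrow> (\<And>l x. l \<in> X \<Longrightarrow> l (c *s x) = c * l x) \<Longrightarrow> F (c *s x) = c ^ k * F x"
  by (induction rule: pol.induct) (auto simp: algebra_simps)

lemma forms_homog: "F \<in> forms k \<Longrightarrow> F (c *s x) = c ^ k * F x"
  unfolding forms_iff by (erule pol_homog) (auto simp: crd_def)

lemma forms1_iff: "F \<in> forms 1 \<longleftrightarrow> (\<forall>x. F x = (\<Sum>i\<in>UNIV. F (axis i 1) * x $ i))"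
proof
  assume "F \<in> forms 1"
  then have "pol crd 1 F" by (simp add: forms_iff)
  moreover have "k = 1 \<Longrightarrow> \<forall>x. f x = (\<Sum>i\<in>UNIV. f (axis i 1) * x $ i)" if "pol crd k f" for k f
    using that
  proof (induction rule: pol.induct)
    case (pol_times l k f)
    then obtain c where c: "f = (\<lambda>_. c)" using pol_0D[of crd f] by auto
    from pol_times obtain i where l: "l = (\<lambda>x. x $ i)" unfolding crd_def by blast
    have "x $ i = (\<Sum>j\<in>UNIV. axis j 1 $ i * x $ j)" for x :: vec4
      using arg_cong[OF basis_expansion[of x], of "\<lambda>y. y $ i"] by (simp add: mult.commute)
    then have "x $ i * c = (\<Sum>j\<in>UNIV. axis j 1 $ i * x $ j) * c" for x :: vec4 by metis
    moreover have "(\<Sum>j\<in>UNIV. axis j 1 $ i * x $ j) * c = (\<Sum>j\<in>UNIV. axis j 1 $ i * c * x $ j)" for x :: vec4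
      by (simp only: sum_distrib_left mult_ac)
    ultimately have E: "x $ i * c = (\<Sum>j\<in>UNIV. axis j 1 $ i * c * x $ j)" for x :: vec4 by (rule trans)
    show ?case unfolding l c by (rule allI, rule E)
  next
    case (pol_plus k f g)
    show ?case
    proof
      fix x
      have "f x + g x = (\<Sum>i\<in>UNIV. f (axis i 1) * x $ i) + (\<Sum>i\<in>UNIV. g (axis i 1) * x $ i)"
        by (rule arg_cong2[where f="(+)"]; rule spec) (use pol_plus in blast)+
      then show "f x + g x = (\<Sum>i\<in>UNIV. (f (axis i 1) + g (axis i 1)) * x $ i)"
        by (simp only: sum.distrib distrib_right)
    qed
  qed auto
  ultimately show "\<forall>x. F x = (\<Sum>i\<in>UNIV. F (axis i 1) * x $ i)" by blast
next
  assume *: "\<forall>x. F x = (\<Sum>i\<in>UNIV. F (axis i 1) * x $ i)"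
  have "(\<lambda>x. \<Sum>i\<in>UNIV. F (axis i 1) * x $ i) \<in> forms 1"
    by (rule forms_sum, rule forms_scale) (auto simp: forms_iff crd_def intro: pol_var[simplified])
  moreover have "F = (\<lambda>x. \<Sum>i\<in>UNIV. F (axis i 1) * x $ i)"
    by (rule ext, rule spec[OF *])
  ultimately show "F \<in> forms 1" by (rule ssubst[where P = "\<lambda>G. G \<in> forms 1", rotated])
qed

lemma forms1_add: "F \<in> forms 1 \<Longrightarrow> F (x + y) = F x + F y"
proof -
  assume "F \<in> forms 1"
  then have F: "F x = (\<Sum>i\<in>UNIV. F (axis i 1) * x $ i)" for x unfolding forms1_iff by blast
  show ?thesis by (subst F, subst F[of x], subst F[of y]) (simp add: algebra_simps sum.distrib)
qed

lemma forms1_smult: "F \<in> forms 1 \<Longrightarrow> F (c *s x) = c * F x"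
  using forms_homog[of F 1] by simp

lemma forms1_diff: "F \<in> forms 1 \<Longrightarrow> F (x - y) = F x - F y"
  using forms1_add[of F x "(-1) *s y"] forms1_smult[of F "-1" y] by simp

lemma forms1_zero: "F \<in> forms 1 \<Longrightarrow> F 0 = 0"
  using forms1_smult[of F 0 0] by simp

lemma forms1I:
  assumes "\<And>x y. F (x + y) = F x + F y" "\<And>c x. F (c *s x) = c * F x"
  shows "F \<in> forms 1"
proof -
  have z: "F 0 = 0" using assms(2)[of 0 0] by simp
  have s: "F (\<Sum>i\<in>I. f i) = (\<Sum>i\<in>I. F (f i))" for I and f :: "'a \<Rightarrow> vec4"
    by (induction I rule: infinite_finite_induct) (auto simp: assms z)
  have "F x = (\<Sum>i\<in>UNIV. F (axis i 1) * x $ i)" for x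
  proof -
    have "x = (\<Sum>i\<in>UNIV. (x $ i) *s axis i 1)"
      by (rule basis_expansion[symmetric])
    then have "F x = F (\<Sum>i\<in>UNIV. (x $ i) *s axis i 1)" by (rule arg_cong)
    also have "\<dots> = (\<Sum>i\<in>UNIV. F (axis i 1) * x $ i)" by (simp add: s assms(2) mult.commute)
    finally show ?thesis .
  qed
  then show ?thesis unfolding forms1_iff by blast
qed

lemma forms_continuous: "F \<in> forms k \<Longrightarrow> continuous_on A F"
  unfolding forms_iff
  by (induction rule: pol.induct) (auto simp: crd_def intro!: continuous_intros)

lemma W_iff: "l \<in> W q \<longleftrightarrow> l \<in> forms 1 \<and> (\<forall>x\<in>q. l x = 0)"
  by (auto simp: W_def vanishes_at_def)

section \<open>Expansions\<close>

text \<open>Modulo \<open>y1, y2, y3\<close> only the pure power of \<open>b\<close> survives.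
  Degree 0 is a separate case, since there the cofactors would have negative degree.\<close>

lemma pol_expand3:
  assumes "pol {b, y1, y2, y3} k F"
  shows "\<exists>c. case k of 0 \<Rightarrow> F = (\<lambda>_. c) | Suc j \<Rightarrow>
     \<exists>F1 F2 F3. pol {b,y1,y2,y3} j F1 \<and> pol {b,y1,y2,y3} j F2 \<and> pol {b,y1,y2,y3} j F3 \<and>
       (\<forall>x. F x = c * b x ^ k + y1 x * F1 x + y2 x * F2 x + y3 x * F3 x)"
  using assms
proof (induction rule: pol.induct)
  case (pol_const c)
  then show ?case by auto
next
  case (pol_zero k)
  show ?case
  proof (rule exI[of _ 0], cases k)
    case (Suc j)
    show "case k of 0 \<Rightarrow> (\<lambda>_. 0) = (\<lambda>_. 0) | Suc j \<Rightarrow>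
     \<exists>F1 F2 F3. pol {b,y1,y2,y3} j F1 \<and> pol {b,y1,y2,y3} j F2 \<and> pol {b,y1,y2,y3} j F3 \<and>
       (\<forall>x. 0 = 0 * b x ^ k + y1 x * F1 x + y2 x * F2 x + y3 x * F3 x)"
      unfolding Suc by (auto intro!: exI[of _ "\<lambda>_. 0"] pol.pol_zero)
  qed auto
next
  case (pol_times l k f)
  from pol_times(1) consider "l = b" | "l = y1" | "l = y2" | "l = y3" by blast
  then show ?case
  proof cases
    case 1
    show ?thesis
    proof (cases k)
      case 0
      with pol_times obtain c where "f = (\<lambda>_. c)" by auto
      then show ?thesis using 0 1
        by (auto intro!: exI[of _ c] exI[of _ "\<lambda>_. 0"] pol.pol_zero)
    next
      case (Suc j)
      with pol_times obtain c F1 F2 F3 where F: "pol {b,y1,y2,y3} j F1" "pol {b,y1,y2,y3} j F2"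
        "pol {b,y1,y2,y3} j F3" "\<And>x. f x = c * b x ^ k + y1 x * F1 x + y2 x * F2 x + y3 x * F3 x"
        by auto
      have "pol {b,y1,y2,y3} k (\<lambda>x. b x * F1 x)" "pol {b,y1,y2,y3} k (\<lambda>x. b x * F2 x)"
        "pol {b,y1,y2,y3} k (\<lambda>x. b x * F3 x)"
        unfolding Suc by (auto intro: pol.pol_times F)
      moreover have "l x * f x = c * b x ^ Suc k + y1 x * (b x * F1 x) + y2 x * (b x * F2 x) + y3 x * (b x * F3 x)" for x
        by (simp add: 1 F(4) algebra_simps)
      ultimately show ?thesis by fastforce
    qed
  next
    case 2
    have "\<forall>x. l x * f x = 0 * b x ^ Suc k + y1 x * f x + y2 x * 0 + y3 x * 0" by (simp add: 2)
    then show ?thesis using pol_times(2) pol.pol_zero unfolding nat.case by fast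
  next
    case 3
    have "\<forall>x. l x * f x = 0 * b x ^ Suc k + y1 x * 0 + y2 x * f x + y3 x * 0" by (simp add: 3)
    then show ?thesis using pol_times(2) pol.pol_zero unfolding nat.case by fast
  next
    case 4
    have "\<forall>x. l x * f x = 0 * b x ^ Suc k + y1 x * 0 + y2 x * 0 + y3 x * f x" by (simp add: 4)
    then show ?thesis using pol_times(2) pol.pol_zero unfolding nat.case by fast
  qed
next
  case (pol_plus k f g)
  show ?case
  proof (cases k)
    case 0
    with pol_plus show ?thesis by auto
  next
    case (Suc j)
    with pol_plus(3) obtain c F1 F2 F3 where F: "pol {b,y1,y2,y3} j F1" "pol {b,y1,y2,y3} j F2"
        "pol {b,y1,y2,y3} j F3" "\<And>x. f x = c * b x ^ k + y1 x * F1 x + y2 x * F2 x + y3 x * F3 x"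
      by auto
    from Suc pol_plus(4) obtain d G1 G2 G3 where G: "pol {b,y1,y2,y3} j G1" "pol {b,y1,y2,y3} j G2"
        "pol {b,y1,y2,y3} j G3" "\<And>x. g x = d * b x ^ k + y1 x * G1 x + y2 x * G2 x + y3 x * G3 x"
      by auto
    have "f x + g x = (c + d) * b x ^ k + y1 x * (F1 x + G1 x) + y2 x * (F2 x + G2 x) + y3 x * (F3 x + G3 x)" for x
      by (simp add: F(4) G(4) algebra_simps)
    then show ?thesis
      using pol.pol_plus[OF F(1) G(1)] pol.pol_plus[OF F(2) G(2)] pol.pol_plus[OF F(3) G(3)]
      unfolding Suc nat.case by blast
  qed
qed

lemma pol_expand_Suc:
  assumes "pol {b, y1, y2, y3} (Suc j) F"
  obtains c F1 F2 F3 where "pol {b,y1,y2,y3} j F1" "pol {b,y1,y2,y3} j F2" "pol {b,y1,y2,y3} j F3"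
    "\<And>x. F x = c * b x ^ Suc j + y1 x * F1 x + y2 x * F2 x + y3 x * F3 x"
  using pol_expand3[OF assms] by auto

text \<open>Only existence of the coefficients is claimed: \<open>b\<close> and the members of
  \<open>X\<close> need not be independent. With \<open>b = y1\<close> it presents a cone form as a
  polynomial in \<open>y1\<close> over the forms in \<open>y2, y3\<close>.\<close>

lemma pol_expand_power:
  assumes "pol (insert b X) k F"
  shows "\<exists>f. (\<forall>a\<le>k. pol X (k - a) (f a)) \<and> (\<forall>x. F x = (\<Sum>a\<le>k. b x ^ a * f a x))"
  using assms
proof (induction rule: pol.induct)
  case (pol_const c)
  show ?case by (rule exI[of _ "\<lambda>_ _. c"]) (auto intro: pol.pol_const)
next
  case (pol_zero k)
  show ?case by (rule exI[of _ "\<lambda>_ _. 0"]) (auto intro: pol.pol_zero)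
next
  case (pol_times l k F)
  then obtain f where f: "\<And>a. a \<le> k \<Longrightarrow> pol X (k - a) (f a)" "\<And>x. F x = (\<Sum>a\<le>k. b x ^ a * f a x)"
    by blast
  show ?case
  proof (cases "l = b")
    case True
    define g where "g a = (if a = 0 then (\<lambda>_. 0) else f (a - 1))" for a
    have "l x * F x = (\<Sum>a\<le>Suc k. b x ^ a * g a x)" for x
      unfolding True f(2) sum.atMost_Suc_shift by (simp add: g_def sum_distrib_left mult.assoc)
    moreover have "pol X (Suc k - a) (g a)" if "a \<le> Suc k" for a
      using that f(1)[of "a - 1"] by (cases a) (auto simp: g_def intro: pol.pol_zero)
    ultimately show ?thesis by blast
  next
    case False
    with pol_times(1) have l: "l \<in> X" by blast
    define g where "g a = (if a \<le> k then (\<lambda>x. l x * f a x) else (\<lambda>_. 0))" for a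
    have "l x * F x = (\<Sum>a\<le>Suc k. b x ^ a * g a x)" for x
      unfolding f(2) by (simp add: g_def sum_distrib_left algebra_simps)
    moreover have "pol X (Suc k - a) (g a)" if "a \<le> Suc k" for a
      using that pol.pol_times[OF l f(1)[of a]]
      by (auto simp: g_def intro: pol.pol_zero simp: Suc_diff_le)
    ultimately show ?thesis by blast
  qed
next
  case (pol_plus k F G)
  from pol_plus(3) obtain f where
    f: "\<And>a. a \<le> k \<Longrightarrow> pol X (k - a) (f a)" "\<And>x. F x = (\<Sum>a\<le>k. b x ^ a * f a x)"
    by blast
  from pol_plus(4) obtain g where
    g: "\<And>a. a \<le> k \<Longrightarrow> pol X (k - a) (g a)" "\<And>x. G x = (\<Sum>a\<le>k. b x ^ a * g a x)"
    by blast
  have "F x + G x = (\<Sum>a\<le>k. b x ^ a * (f a x + g a x))" for x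
    unfolding f(2) g(2) by (simp add: distrib_left sum.distrib)
  moreover have "pol X (k - a) (\<lambda>x. f a x + g a x)" if "a \<le> k" for a
    by (rule pol.pol_plus[OF f(1)[OF that] g(1)[OF that]])
  ultimately show ?case by (intro exI[of _ "\<lambda>a x. f a x + g a x"]) blast
qed

lemma pol_single:
  assumes "pol {b} k F"
  shows "\<exists>c. \<forall>x. F x = c * b x ^ k"
  using assms
proof (induction rule: pol.induct)
  case (pol_const c)
  show ?case by (rule exI[of _ c]) simp
next
  case (pol_zero k)
  show ?case by (rule exI[of _ 0]) simp
next
  case (pol_times l k f)
  then obtain c where "\<And>x. f x = c * b x ^ k" by blast
  then show ?case using pol_times(1) by (intro exI[of _ c]) simp
next
  case (pol_plus k f g)
  then obtain c d where "\<And>x. f x = c * b x ^ k" "\<And>x. g x = d * b x ^ k" by blast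
  then show ?case by (intro exI[of _ "c + d"]) (simp add: distrib_right)
qed

lemma pol_binary:
  assumes "pol {a, b} k F"
  shows "\<exists>c. \<forall>x. F x = (\<Sum>i\<le>k. c i * a x ^ i * b x ^ (k - i))"
proof -
  obtain f where f: "\<And>i. i \<le> k \<Longrightarrow> pol {b} (k - i) (f i)" "\<And>x. F x = (\<Sum>i\<le>k. a x ^ i * f i x)"
    using pol_expand_power[OF assms] by blast
  have "\<forall>i. \<exists>c. i \<le> k \<longrightarrow> (\<forall>x. f i x = c * b x ^ (k - i))"
    using pol_single f(1) by metis
  then obtain c where "\<And>i x. i \<le> k \<Longrightarrow> f i x = c i * b x ^ (k - i)" by metis
  then show ?thesis by (intro exI[of _ c]) (simp add: f(2) algebra_simps)
qed

text \<open>The fundamental theorem of algebra, homogenised. The condition on \<open>c n\<close>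
  excludes \<open>b\<close> as a factor, so all zeros have the form
  \<open>(\<rho>, 1)\<close>.\<close>

lemma binary_factor:
  fixes c :: "nat \<Rightarrow> complex"
  assumes "c n \<noteq> 0"
  shows "\<exists>\<rho>s. length \<rho>s = n \<and> (\<forall>a b. (\<Sum>i\<le>n. c i * a ^ i * b ^ (n - i)) = c n * (\<Prod>\<rho>\<leftarrow>\<rho>s. a - \<rho> * b))"
  using assms
proof (induction n arbitrary: c)
  case 0
  then show ?case by auto
next
  case (Suc n)
  define P where "P = (\<Sum>i\<le>Suc n. monom (c i) i)"
  have coeffP: "poly.coeff P i = (if i \<le> Suc n then c i else 0)" for i
    unfolding P_def coeff_sum by (simp add: sum.delta)
  have degP: "degree P = Suc n"
    by (rule antisym) (auto intro!: degree_le le_degree simp: coeffP Suc.prems simp del: )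
  have "\<not> constant (poly P)" using degP by (simp add: constant_degree)
  then obtain \<rho> where \<rho>: "poly P \<rho> = 0" using fundamental_theorem_of_algebra by blast
  then obtain Q where Q: "P = [:-\<rho>, 1:] * Q" by (meson poly_eq_0_iff_dvd dvdE)
  have P0: "P \<noteq> 0" using degP by auto
  then have Q0: "Q \<noteq> 0" using Q by auto
  have degQ: "degree Q = n"
    using degP Q0 unfolding Q by (subst (asm) degree_mult_eq) auto
  have cQ: "poly.coeff P (Suc i) = poly.coeff Q i - \<rho> * poly.coeff Q (Suc i)"
    "poly.coeff P 0 = - \<rho> * poly.coeff Q 0" for i
    unfolding Q by (simp_all add: mult_pCons_left)
  have top: "poly.coeff Q (Suc n) = 0" using degQ by (simp add: coeff_eq_0)
  have lead: "poly.coeff Q n = c (Suc n)" using cQ(1)[of n] top by (simp add: coeffP)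
  from Suc.IH[of "poly.coeff Q"] lead Suc.prems obtain \<rho>s where \<rho>s: "length \<rho>s = n"
    "\<And>a b. (\<Sum>i\<le>n. poly.coeff Q i * a ^ i * b ^ (n - i)) = c (Suc n) * (\<Prod>\<rho>\<leftarrow>\<rho>s. a - \<rho> * b)"
    by auto
  have "(\<Sum>i\<le>Suc n. c i * a ^ i * b ^ (Suc n - i)) = c (Suc n) * (\<Prod>\<rho>\<leftarrow>\<rho> # \<rho>s. a - \<rho> * b)" for a b
  proof -
    have 1: "(\<Sum>i\<le>Suc n. poly.coeff Q i * a ^ i * b ^ (Suc n - i)) =
        (\<Sum>i\<le>n. poly.coeff Q i * a ^ i * b ^ (n - i)) * b"
      by (simp add: top sum_distrib_right Suc_diff_le mult.assoc mult.commute[of b])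
    have "(\<Sum>i\<le>Suc n. c i * a ^ i * b ^ (Suc n - i)) = (\<Sum>i\<le>Suc n. poly.coeff P i * a ^ i * b ^ (Suc n - i))"
      by (simp add: coeffP)
    also have "\<dots> = (\<Sum>i\<le>n. poly.coeff Q i * a ^ Suc i * b ^ (n - i)) -
        \<rho> * (\<Sum>i\<le>Suc n. poly.coeff Q i * a ^ i * b ^ (Suc n - i))"
      unfolding sum.atMost_Suc_shift cQ by (simp add: algebra_simps sum.distrib sum_subtractf sum_distrib_left)
    also have "(\<Sum>i\<le>n. poly.coeff Q i * a ^ Suc i * b ^ (n - i)) = a * (\<Sum>i\<le>n. poly.coeff Q i * a ^ i * b ^ (n - i))"
      by (simp add: sum_distrib_left algebra_simps)
    finally show ?thesis unfolding 1 \<rho>s(2) by (simp add: algebra_simps)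
  qed
  then show ?case using \<rho>s(1) by (intro exI[of _ "\<rho> # \<rho>s"]) simp
qed

lemma finite_poly_zeros:
  fixes c :: "nat \<Rightarrow> complex"
  assumes "i \<le> n" "c i \<noteq> 0"
  shows "finite {z. (\<Sum>i\<le>n. c i * z ^ i) = 0}"
  using polyfun_finite_roots[of c n] assms by auto

section \<open>A curve in a frame adapted to a point\<close>

text \<open>\<open>lin_expand\<close> says that the vectors form a basis, in the form in which this
  is used: a linear form is determined by its values on them.\<close>

locale adapted_frame =
  fixes e0 e1 e2 e3 :: vec4 and x0 y1 y2 y3 :: cfun
  assumes lin: "x0 \<in> forms 1" "y1 \<in> forms 1" "y2 \<in> forms 1" "y3 \<in> forms 1"
    and dual: "x0 e0 = 1" "x0 e1 = 0" "x0 e2 = 0" "x0 e3 = 0"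
      "y1 e0 = 0" "y1 e1 = 1" "y1 e2 = 0" "y1 e3 = 0"
      "y2 e0 = 0" "y2 e1 = 0" "y2 e2 = 1" "y2 e3 = 0"
      "y3 e0 = 0" "y3 e1 = 0" "y3 e2 = 0" "y3 e3 = 1"
    and lin_expand: "\<And>F z. F \<in> forms 1 \<Longrightarrow> F z = F e0 * x0 z + F e1 * y1 z + F e2 * y2 z + F e3 * y3 z"
begin

lemma forms_pol_iff: "F \<in> forms k \<longleftrightarrow> pol {x0, y1, y2, y3} k F"
proof
  assume "F \<in> forms k"
  then have "pol crd k F" by (simp add: forms_iff)
  then show "pol {x0, y1, y2, y3} k F"
  proof (rule pol_trans)
    fix l assume "l \<in> crd"
    then have l: "l \<in> forms 1" using pol_var forms_iff by blast
    have "pol {x0, y1, y2, y3} 1 (\<lambda>z. l e0 * x0 z + l e1 * y1 z + l e2 * y2 z + l e3 * y3 z)"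
      by (intro pol_plus pol_scale pol_var) auto
    moreover have "(\<lambda>z. l e0 * x0 z + l e1 * y1 z + l e2 * y2 z + l e3 * y3 z) = l"
      by (rule ext, rule lin_expand[OF l, symmetric])
    ultimately show "pol {x0, y1, y2, y3} 1 l" by simp
  qed
next
  assume "pol {x0, y1, y2, y3} k F"
  then have "pol crd k F"
    by (rule pol_trans) (use lin in \<open>auto simp: forms_iff\<close>)
  then show "F \<in> forms k" by (simp add: forms_iff)
qed

lemma pol_forms: "pol X k F \<Longrightarrow> X \<subseteq> {x0, y1, y2, y3} \<Longrightarrow> F \<in> forms k"
  using pol_mono forms_pol_iff by blast

text \<open>The vector \<open>u\<close> spans the point where, among the coordinates
  \<open>b, c, y2, y3\<close>, only \<open>b\<close> is nonzero; the ideal of this point is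
  generated by the other three. The cases used are \<open>e0\<close> and the other points of the
  tangent line.\<close>

lemma expand_gen:
  assumes F: "F \<in> forms (Suc j)" and b: "b \<in> forms 1" "c \<in> forms 1"
    and sp: "pol {b, c, y2, y3} 1 x0" "pol {b, c, y2, y3} 1 y1"
    and u: "b u = 1" "c u = 0" "y2 u = 0" "y3 u = 0"
  obtains F1 F2 F3 where "F1 \<in> forms j" "F2 \<in> forms j" "F3 \<in> forms j"
    "\<And>z. F z = F u * b z ^ Suc j + c z * F1 z + y2 z * F2 z + y3 z * F3 z"
proof -
  have "pol {b, c, y2, y3} (Suc j) F"
    by (rule pol_trans[of "{x0, y1, y2, y3}"])
      (use F sp in \<open>auto simp: forms_pol_iff intro: pol_var[simplified]\<close>)
  then obtain a F1 F2 F3 where P: "pol {b, c, y2, y3} j F1" "pol {b, c, y2, y3} j F2" "pol {b, c, y2, y3} j F3"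
    and E: "\<And>z. F z = a * b z ^ Suc j + c z * F1 z + y2 z * F2 z + y3 z * F3 z"
    by (rule pol_expand_Suc) blast
  have "H \<in> forms j" if "pol {b, c, y2, y3} j H" for H
    unfolding forms_iff using that by (rule pol_trans) (use b lin in \<open>auto simp: forms_iff\<close>)
  moreover have "F u = a" using E[of u] u by simp
  ultimately show ?thesis using that P E by blast
qed

lemma expand0:
  assumes "F \<in> forms (Suc j)"
  obtains F1 F2 F3 where "F1 \<in> forms j" "F2 \<in> forms j" "F3 \<in> forms j"
    "\<And>z. F z = F e0 * x0 z ^ Suc j + y1 z * F1 z + y2 z * F2 z + y3 z * F3 z"
proof -
  have "pol {x0, y1, y2, y3} 1 x0" "pol {x0, y1, y2, y3} 1 y1" by (auto intro: pol_var[simplified])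
  from expand_gen[OF assms lin(1,2) this, of e0] dual that show ?thesis by blast
qed

text \<open>The points of the tangent line other than \<open>e0\<close> are spanned by the vectors
  \<open>\<rho> *s e0 + e1\<close>.\<close>

lemma expand_line:
  assumes "F \<in> forms (Suc j)" "F (\<rho> *s e0 + e1) = 0"
  obtains F1 F2 F3 where "F1 \<in> forms j" "F2 \<in> forms j" "F3 \<in> forms j"
    "\<And>z. F z = (x0 z - \<rho> * y1 z) * F1 z + y2 z * F2 z + y3 z * F3 z"
proof -
  let ?c = "\<lambda>z. x0 z - \<rho> * y1 z"
  have c: "?c \<in> forms 1" by (intro forms_diff forms_scale lin)
  have y: "pol {y1, ?c, y2, y3} 1 y1" by (auto intro: pol_var[simplified])
  have "pol {y1, ?c, y2, y3} 1 (\<lambda>z. ?c z + \<rho> * y1 z)"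
    by (rule pol_plus) (auto intro: pol_var[simplified] pol_scale)
  then have x: "pol {y1, ?c, y2, y3} 1 x0" by simp
  have v: "l (\<rho> *s e0 + e1) = \<rho> * l e0 + l e1" if "l \<in> forms 1" for l
    using that by (simp add: forms1_add forms1_smult)
  have u: "y1 (\<rho> *s e0 + e1) = 1" "x0 (\<rho> *s e0 + e1) - \<rho> * y1 (\<rho> *s e0 + e1) = 0"
    "y2 (\<rho> *s e0 + e1) = 0" "y3 (\<rho> *s e0 + e1) = 0"
    by (simp_all add: v[OF lin(1)] v[OF lin(2)] v[OF lin(3)] v[OF lin(4)] dual)
  obtain F1 F2 F3 where "F1 \<in> forms j" "F2 \<in> forms j" "F3 \<in> forms j"
    "\<And>z. F z = F (\<rho> *s e0 + e1) * y1 z ^ Suc j + (x0 z - \<rho> * y1 z) * F1 z + y2 z * F2 z + y3 z * F3 z"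
    by (rule expand_gen[OF assms(1) lin(2) c x y u]) blast
  then show ?thesis using that assms(2) by simp
qed

text \<open>
  The forms \<open>A\<close> and \<open>B\<close> have degree \<open>k - 1\<close>, meaning zero if \<open>k = 0\<close>; the condition on their
  products covers both cases.
\<close>

lemma expand_binary:
  assumes "F \<in> forms k"
  shows "\<exists>c A B. (\<forall>j l. l \<in> forms (Suc j) \<longrightarrow> (\<lambda>z. l z * A z) \<in> forms (k + j)) \<and>
     (\<forall>j l. l \<in> forms (Suc j) \<longrightarrow> (\<lambda>z. l z * B z) \<in> forms (k + j)) \<and>
     (\<forall>z. F z = (\<Sum>i\<le>k. c i * x0 z ^ i * y1 z ^ (k - i)) + y2 z * A z + y3 z * B z)"
proof -
  \<comment> \<open>A linear factor raises the degree by one, in terms of the condition on products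
    that stands for membership in \<open>forms (k - 1)\<close>.\<close>
  have sh: "l \<in> forms 1 \<Longrightarrow> (\<forall>j h. h \<in> forms (Suc j) \<longrightarrow> (\<lambda>z. h z * A z) \<in> forms (k + j)) \<Longrightarrow>
    \<forall>j h. h \<in> forms (Suc j) \<longrightarrow> (\<lambda>z. h z * (l z * A z)) \<in> forms (Suc k + j)" for l A k
    using forms_mult[of l 1] by (fastforce simp: mult.left_commute)
  have "pol {x0, y1, y2, y3} k F" using assms by (simp add: forms_pol_iff)
  then show ?thesis
  proof (induction rule: pol.induct)
    case (pol_const c)
    show ?case by (intro exI[of _ "\<lambda>_. c"] exI[of _ "\<lambda>_. 0"]) (simp add: forms_zero)
  next
    case (pol_zero k)
    show ?case by (intro exI[of _ "\<lambda>_. 0"]) (simp add: forms_zero)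
  next
    case (pol_times l k f)
    from pol_times(3) obtain c A B where
      A: "\<forall>j l. l \<in> forms (Suc j) \<longrightarrow> (\<lambda>z. l z * A z) \<in> forms (k + j)"
      and B: "\<forall>j l. l \<in> forms (Suc j) \<longrightarrow> (\<lambda>z. l z * B z) \<in> forms (k + j)"
      and E: "\<And>z. f z = (\<Sum>i\<le>k. c i * x0 z ^ i * y1 z ^ (k - i)) + y2 z * A z + y3 z * B z" by blast
    have f: "f \<in> forms k" using pol_times(2) forms_pol_iff by blast
    have fd: "\<forall>j l. l \<in> forms (Suc j) \<longrightarrow> (\<lambda>z. l z * f z) \<in> forms (Suc k + j)"
      using forms_mult[OF _ f] by (fastforce simp: add.commute)
    have zd: "\<forall>j l. l \<in> forms (Suc j) \<longrightarrow> (\<lambda>z. l z * 0) \<in> forms (Suc k + j)"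
      by (simp add: forms_zero)
    from pol_times(1) consider "l = x0" | "l = y1" | "l = y2" | "l = y3" by blast
    then show ?case
    proof cases
      case 1
      define c' where "c' i = (if i = 0 then 0 else c (i - 1))" for i
      have eq: "l z * f z = (\<Sum>i\<le>Suc k. c' i * x0 z ^ i * y1 z ^ (Suc k - i)) + y2 z * (x0 z * A z) + y3 z * (x0 z * B z)" for z
        unfolding E 1 sum.atMost_Suc_shift by (simp add: c'_def sum_distrib_left algebra_simps)
      show ?thesis
        by (rule exI[of _ c'], rule exI[of _ "\<lambda>z. x0 z * A z"], rule exI[of _ "\<lambda>z. x0 z * B z"])
          (intro conjI sh[OF lin(1) A] sh[OF lin(1) B] allI eq)
    next
      case 2
      define c' where "c' i = (if i \<le> k then c i else 0)" for i
      have eq: "l z * f z = (\<Sum>i\<le>Suc k. c' i * x0 z ^ i * y1 z ^ (Suc k - i)) + y2 z * (y1 z * A z) + y3 z * (y1 z * B z)" for z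
        unfolding E 2 by (simp add: c'_def sum_distrib_left Suc_diff_le algebra_simps)
      show ?thesis
        by (rule exI[of _ c'], rule exI[of _ "\<lambda>z. y1 z * A z"], rule exI[of _ "\<lambda>z. y1 z * B z"])
          (intro conjI sh[OF lin(2) A] sh[OF lin(2) B] allI eq)
    next
      case 3
      have eq: "l z * f z = (\<Sum>i\<le>Suc k. (\<lambda>_. 0) i * x0 z ^ i * y1 z ^ (Suc k - i)) + y2 z * f z + y3 z * (\<lambda>_. 0) z" for z
        by (simp add: 3)
      show ?thesis
        by (rule exI[of _ "\<lambda>_. 0"], rule exI[of _ f], rule exI[of _ "\<lambda>_. 0"])
          (intro conjI fd zd allI eq)
    next
      case 4
      have eq: "l z * f z = (\<Sum>i\<le>Suc k. (\<lambda>_. 0) i * x0 z ^ i * y1 z ^ (Suc k - i)) + y2 z * (\<lambda>_. 0) z + y3 z * f z" for z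
        by (simp add: 4)
      show ?thesis
        by (rule exI[of _ "\<lambda>_. 0"], rule exI[of _ "\<lambda>_. 0"], rule exI[of _ f])
          (intro conjI fd zd allI eq)
    qed
  next
    case (pol_plus k f h)
    from pol_plus(3) obtain c A B where
      A: "\<forall>j l. l \<in> forms (Suc j) \<longrightarrow> (\<lambda>z. l z * A z) \<in> forms (k + j)"
      and B: "\<forall>j l. l \<in> forms (Suc j) \<longrightarrow> (\<lambda>z. l z * B z) \<in> forms (k + j)"
      and E: "\<And>z. f z = (\<Sum>i\<le>k. c i * x0 z ^ i * y1 z ^ (k - i)) + y2 z * A z + y3 z * B z" by blast
    from pol_plus(4) obtain c' A' B' where
      A': "\<forall>j l. l \<in> forms (Suc j) \<longrightarrow> (\<lambda>z. l z * A' z) \<in> forms (k + j)"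
      and B': "\<forall>j l. l \<in> forms (Suc j) \<longrightarrow> (\<lambda>z. l z * B' z) \<in> forms (k + j)"
      and E': "\<And>z. h z = (\<Sum>i\<le>k. c' i * x0 z ^ i * y1 z ^ (k - i)) + y2 z * A' z + y3 z * B' z" by blast
    have 1: "\<forall>j l. l \<in> forms (Suc j) \<longrightarrow> (\<lambda>z. l z * (A z + A' z)) \<in> forms (k + j)"
      unfolding distrib_left using A A' forms_add by blast
    have 2: "\<forall>j l. l \<in> forms (Suc j) \<longrightarrow> (\<lambda>z. l z * (B z + B' z)) \<in> forms (k + j)"
      unfolding distrib_left using B B' forms_add by blast
    have 3: "f z + h z = (\<Sum>i\<le>k. (c i + c' i) * x0 z ^ i * y1 z ^ (k - i)) + y2 z * (A z + A' z) + y3 z * (B z + B' z)" for z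
      unfolding E E' by (simp add: algebra_simps sum.distrib)
    show ?case
      by (rule exI[of _ "\<lambda>i. c i + c' i"], rule exI[of _ "\<lambda>z. A z + A' z"], rule exI[of _ "\<lambda>z. B z + B' z"])
        (intro conjI 1 2 3 allI)
  qed
qed

end

text \<open>
  \<open>Z\<close> is the affine cone over the curve, \<open>e0\<close> spans the point \<open>p\<close>, and \<open>y2 = y3 = 0\<close> is the tangent
  line. The forms \<open>G, E2, E3\<close> express that \<open>y1\<close> is a local parameter, that the tangent line meets
  the curve with multiplicity 2 at \<open>p\<close>, and that \<open>y3 = 0\<close> is the osculating plane.
\<close>

locale curve_frame = adapted_frame +
  fixes Z :: "vec4 set" and g :: nat and G E2 E3 :: cfun
  assumes irred: "\<And>F H a b. F \<in> forms a \<Longrightarrow> H \<in> forms b \<Longrightarrow> (\<And>z. z \<in> Z \<Longrightarrow> F z * H z = 0) \<Longrightarrow>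
      (\<forall>z\<in>Z. F z = 0) \<or> (\<forall>z\<in>Z. H z = 0)"
    and nondeg: "\<And>F u. F \<in> forms 1 \<Longrightarrow> F u \<noteq> 0 \<Longrightarrow> \<exists>z\<in>Z. F z \<noteq> 0"
    and e0_Z: "e0 \<in> Z"
    and cut: "\<And>z. z \<noteq> 0 \<Longrightarrow> z \<notin> Z \<Longrightarrow> \<exists>m. \<exists>h\<in>forms m. (\<forall>x\<in>Z. h x = 0) \<and> h z \<noteq> 0"
    and tangent_meets: "\<And>z. z \<in> Z \<Longrightarrow> y2 z = 0 \<Longrightarrow> y3 z = 0 \<Longrightarrow> y1 z = 0"
    and local: "G \<in> forms (Suc g)" "E2 \<in> forms g" "E3 \<in> forms g" "G e0 \<noteq> 0" "E2 e0 \<noteq> 0" "E3 e0 = 0"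
      "\<And>z. z \<in> Z \<Longrightarrow> G z * y2 z = y1 z ^ 2 * E2 z" "\<And>z. z \<in> Z \<Longrightarrow> G z * y3 z = y1 z ^ 2 * E3 z"
begin

text \<open>Nonzero in the coordinate ring of the curve, which is a domain by
  \<open>irred\<close>.\<close>

definition nz :: "cfun \<Rightarrow> bool" where "nz F \<longleftrightarrow> (\<exists>z\<in>Z. F z \<noteq> 0)"

lemma nz_mult: "F \<in> forms a \<Longrightarrow> H \<in> forms b \<Longrightarrow> nz F \<Longrightarrow> nz H \<Longrightarrow> nz (\<lambda>z. F z * H z)"
  using irred[of F a H b] unfolding nz_def by blast

lemma nz_power: "F \<in> forms a \<Longrightarrow> nz F \<Longrightarrow> nz (\<lambda>z. F z ^ n)"
proof (induction n)
  case 0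
  then show ?case using e0_Z by (auto simp: nz_def)
next
  case (Suc n)
  then show ?case using nz_mult[OF Suc(2) forms_power[OF Suc(2), of n] Suc(3)] by simp
qed

lemma cancel:
  assumes "F \<in> forms a" "H \<in> forms b" "nz F" "\<And>z. z \<in> Z \<Longrightarrow> F z * H z = 0" "z \<in> Z"
  shows "H z = 0"
  using irred[OF assms(1,2,4)] assms(3,5) unfolding nz_def by blast

lemma nz_y1: "nz y1"
  using nondeg[OF lin(2), of e1] dual by (simp add: nz_def)

lemma nz_y2: "nz y2"
  using nondeg[OF lin(3), of e2] dual by (simp add: nz_def)

subsection \<open>The ideal of the tangent line\<close>

text \<open>
  Here and in the definition of \<open>eqL\<close> below, \<open>n\<close> is the degree of the cofactors; the forms compared
  have degree \<open>n + 1\<close>.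
\<close>

definition inJ :: "nat \<Rightarrow> cfun \<Rightarrow> bool" where
  "inJ n F \<longleftrightarrow> (\<exists>A\<in>forms n. \<exists>B\<in>forms n. \<forall>z\<in>Z. F z = y2 z * A z + y3 z * B z)"

lemma inJ_add: "inJ n F \<Longrightarrow> inJ n H \<Longrightarrow> inJ n (\<lambda>z. F z + H z)"
proof -
  assume "inJ n F" "inJ n H"
  then obtain A B A' B' where
    "A \<in> forms n" "B \<in> forms n" "\<forall>z\<in>Z. F z = y2 z * A z + y3 z * B z"
    "A' \<in> forms n" "B' \<in> forms n" "\<forall>z\<in>Z. H z = y2 z * A' z + y3 z * B' z" unfolding inJ_def by blast
  then show ?thesis unfolding inJ_def
    by (intro bexI[of _ "\<lambda>z. A z + A' z"] bexI[of _ "\<lambda>z. B z + B' z"])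
      (auto simp: algebra_simps intro: forms_add)
qed

lemma inJ_mult: "inJ n F \<Longrightarrow> H \<in> forms j \<Longrightarrow> inJ (n + j) (\<lambda>z. F z * H z)"
proof -
  assume "inJ n F" and H: "H \<in> forms j"
  then obtain A B where
    "A \<in> forms n" "B \<in> forms n" "\<forall>z\<in>Z. F z = y2 z * A z + y3 z * B z" unfolding inJ_def by blast
  moreover from this have "\<forall>z\<in>Z. F z * H z = y2 z * (A z * H z) + y3 z * (B z * H z)"
    by (simp add: algebra_simps)
  ultimately show ?thesis unfolding inJ_def
    by (intro bexI[of _ "\<lambda>z. A z * H z" "forms (n + j)"] bexI[of _ "\<lambda>z. B z * H z" "forms (n + j)"]
        forms_mult H)
qed

lemma inJ_cong: "inJ n F \<Longrightarrow> (\<And>z. z \<in> Z \<Longrightarrow> H z = F z) \<Longrightarrow> inJ n H"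
  unfolding inJ_def by force

lemma inJ_gen: "A \<in> forms n \<Longrightarrow> B \<in> forms n \<Longrightarrow> inJ n (\<lambda>z. y2 z * A z + y3 z * B z)"
  unfolding inJ_def by blast

text \<open>A factor \<open>x0 - \<rho> y1\<close> can be cancelled at the price of a larger degree.
  Its zero on the tangent line is not on the curve, so some equation \<open>h\<close> of the curve
  is nonzero there. Subtracting a multiple of \<open>h\<close> from \<open>F\<close> changes nothing
  on \<open>Z\<close> and makes \<open>F\<close> vanish at that point, hence a combination of
  \<open>x0 - \<rho> y1\<close>, \<open>y2\<close> and \<open>y3\<close>.\<close>

lemma tangent_ideal_step:
  assumes "\<exists>j0. \<forall>j\<ge>j0. \<forall>F\<in>forms j. inJ (length \<rho>s + j + 1) (\<lambda>z. y1 z ^ 2 * (\<Prod>\<rho>\<leftarrow>\<rho>s. x0 z - \<rho> * y1 z) * F z)"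
  shows "\<exists>j0. \<forall>j\<ge>j0. \<forall>F\<in>forms j. inJ (j + 1) (\<lambda>z. y1 z ^ 2 * F z)"
  using assms
proof (induction \<rho>s)
  case Nil
  then show ?case by simp
next
  case (Cons \<rho> \<rho>s)
  let ?P = "\<lambda>z. \<Prod>\<rho>\<leftarrow>\<rho>s. x0 z - \<rho> * y1 z"
  have P: "?P \<in> forms (length \<rho>s)"
  proof (induction \<rho>s)
    case Nil
    then show ?case by (simp add: forms_const)
  next
    case (Cons a \<rho>s)
    have "(\<lambda>z. x0 z - a * y1 z) \<in> forms 1" by (intro forms_diff forms_scale lin)
    from forms_mult[OF this Cons] show ?case by simp
  qed
  from Cons.prems obtain j0 where j0: "\<And>j F. j \<ge> j0 \<Longrightarrow> F \<in> forms j \<Longrightarrow>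
      inJ (length (\<rho> # \<rho>s) + j + 1) (\<lambda>z. y1 z ^ 2 * (\<Prod>\<rho>\<leftarrow>\<rho> # \<rho>s. x0 z - \<rho> * y1 z) * F z)" by blast
  let ?u = "\<rho> *s e0 + e1"
  have v: "l ?u = \<rho> * l e0 + l e1" if "l \<in> forms 1" for l
    using that by (simp add: forms1_add forms1_smult)
  have "y1 ?u = 1" "y2 ?u = 0" "y3 ?u = 0" by (simp_all add: v[OF lin(1)] v[OF lin(2)] v[OF lin(3)] v[OF lin(4)] dual)
  then have "?u \<noteq> 0" "?u \<notin> Z" using tangent_meets[of ?u] forms1_zero[OF lin(2)] by auto
  then obtain m h where h: "h \<in> forms m" "\<forall>x\<in>Z. h x = 0" "h ?u \<noteq> 0" using cut by blast
  have "inJ (length \<rho>s + j + 1) (\<lambda>z. y1 z ^ 2 * ?P z * F z)" if j: "j \<ge> j0 + m + 1" and F: "F \<in> forms j" for j F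
  proof -
    obtain i where i: "j = Suc i" using j by (cases j) auto
    define F' where "F' z = F z - (F ?u / h ?u) * (h z * y1 z ^ (j - m))" for z
    have "(\<lambda>z. h z * y1 z ^ (j - m)) \<in> forms j"
      by (rule forms_mult'[OF h(1) forms_power1[OF lin(2)]]) (use j in simp)
    then have "F' \<in> forms j" unfolding F'_def by (intro forms_diff forms_scale F)
    moreover have "F' ?u = 0" unfolding F'_def using h(3) \<open>y1 ?u = 1\<close> by simp
    ultimately obtain F1 F2 F3 where F1: "F1 \<in> forms i" "F2 \<in> forms i" "F3 \<in> forms i"
      "\<And>z. F' z = (x0 z - \<rho> * y1 z) * F1 z + y2 z * F2 z + y3 z * F3 z"
      unfolding i using expand_line by blast
    let ?yP = "\<lambda>z. y1 z ^ 2 * ?P z"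
    have yP: "?yP \<in> forms (2 + length \<rho>s)" by (intro forms_mult forms_power1 lin P)
    have "inJ (length (\<rho> # \<rho>s) + i + 1) (\<lambda>z. y1 z ^ 2 * (\<Prod>\<rho>\<leftarrow>\<rho> # \<rho>s. x0 z - \<rho> * y1 z) * F1 z)"
      by (rule j0) (use i j F1 in auto)
    moreover have "inJ (i + (2 + length \<rho>s)) (\<lambda>z. (y2 z * F2 z + y3 z * F3 z) * ?yP z)"
      by (rule inJ_mult[OF inJ_gen[OF F1(2,3)] yP])
    ultimately have "inJ (length \<rho>s + j + 1) (\<lambda>z. y1 z ^ 2 * (\<Prod>\<rho>\<leftarrow>\<rho> # \<rho>s. x0 z - \<rho> * y1 z) * F1 z
       + (y2 z * F2 z + y3 z * F3 z) * ?yP z)"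
      by (intro inJ_add) (simp_all add: i add.commute add.left_commute)
    then show ?thesis
    proof (rule inJ_cong)
      fix z assume z: "z \<in> Z"
      have "F z = F' z" using z h(2) by (simp add: F'_def)
      then have "F z = (x0 z - \<rho> * y1 z) * F1 z + y2 z * F2 z + y3 z * F3 z" unfolding F1(4) .
      then show "y1 z ^ 2 * ?P z * F z = y1 z ^ 2 * (\<Prod>\<rho>\<leftarrow>\<rho> # \<rho>s. x0 z - \<rho> * y1 z) * F1 z
       + (y2 z * F2 z + y3 z * F3 z) * ?yP z"
        by (simp add: distrib_left distrib_right mult_ac)
    qed
  qed
  then show ?case by (intro Cons.IH) blast
qed

text \<open>On the tangent line \<open>E2\<close> is a binary form with nonzero coefficient at
  \<open>x0 ^ g\<close>, so it splits into factors \<open>x0 - \<rho> y1\<close>. The relation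
  \<open>G y2 = y1^2 E2\<close> puts \<open>y1^2\<close> times their product into the ideal of the
  tangent line, and the factors are then cancelled one by one.\<close>

lemma tangent_ideal:
  obtains j0 where "\<And>j F. j \<ge> j0 \<Longrightarrow> F \<in> forms j \<Longrightarrow> inJ (j + 1) (\<lambda>z. y1 z ^ 2 * F z)"
proof -
  obtain c A B where A: "\<forall>j l. l \<in> forms (Suc j) \<longrightarrow> (\<lambda>z. l z * A z) \<in> forms (g + j)"
    and B: "\<forall>j l. l \<in> forms (Suc j) \<longrightarrow> (\<lambda>z. l z * B z) \<in> forms (g + j)"
    and E: "\<And>z. E2 z = (\<Sum>i\<le>g. c i * x0 z ^ i * y1 z ^ (g - i)) + y2 z * A z + y3 z * B z"
    using expand_binary[OF local(2)] by blast
  have "(\<Sum>i\<le>g. c i * x0 e0 ^ i * y1 e0 ^ (g - i)) = (\<Sum>i\<in>{g}. c i)"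
    by (rule sum.mono_neutral_cong_right) (auto simp: dual)
  then have cg: "c g \<noteq> 0" using E[of e0] local(5) dual by simp
  then obtain \<rho>s where \<rho>s: "length \<rho>s = g"
    "\<And>a b. (\<Sum>i\<le>g. c i * a ^ i * b ^ (g - i)) = c g * (\<Prod>\<rho>\<leftarrow>\<rho>s. a - \<rho> * b)"
    using binary_factor by blast
  let ?P = "\<lambda>z. \<Prod>\<rho>\<leftarrow>\<rho>s. x0 z - \<rho> * y1 z"
  have y12: "(\<lambda>z. y1 z ^ 2) \<in> forms (Suc 1)" using forms_power1[OF lin(2), of 2] by (simp add: numeral_2_eq_2)
  have "inJ (g + 1) (\<lambda>z. y1 z ^ 2 * ?P z)"
  proof -
    \<comment> \<open>\<open>A\<close> and \<open>B\<close> have degree \<open>g - 1\<close> in the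
      sense of \<open>expand_binary\<close>; with the factor \<open>y1^2\<close> they give forms of
      degree \<open>g + 1\<close> even if \<open>g = 0\<close>.\<close>
    have A2: "(\<lambda>z. y1 z ^ 2 * A z) \<in> forms (g + 1)" and B2: "(\<lambda>z. y1 z ^ 2 * B z) \<in> forms (g + 1)"
      using A B y12 by blast+
    have "(\<lambda>z. inverse (c g) * (G z - y1 z ^ 2 * A z)) \<in> forms (g + 1)"
      by (intro forms_scale forms_diff A2) (use local in simp)
    moreover have "(\<lambda>z. inverse (c g) * (- (y1 z ^ 2 * B z))) \<in> forms (g + 1)"
      by (intro forms_scale forms_uminus B2)
    ultimately have "inJ (g + 1) (\<lambda>z. y2 z * (inverse (c g) * (G z - y1 z ^ 2 * A z)) + y3 z * (inverse (c g) * (- (y1 z ^ 2 * B z))))"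
      by (rule inJ_gen)
    then show ?thesis
    proof (rule inJ_cong)
      fix z assume "z \<in> Z"
      then have "G z * y2 z = y1 z ^ 2 * (c g * ?P z + y2 z * A z + y3 z * B z)"
        using local(7) unfolding E \<rho>s(2) by blast
      then have "c g * (y1 z ^ 2 * ?P z) = y2 z * (G z - y1 z ^ 2 * A z) + y3 z * (- (y1 z ^ 2 * B z))"
        by (simp add: algebra_simps)
      then have "inverse (c g) * (c g * (y1 z ^ 2 * ?P z)) = inverse (c g) * (y2 z * (G z - y1 z ^ 2 * A z) + y3 z * (- (y1 z ^ 2 * B z)))"
        by simp
      then show "y1 z ^ 2 * ?P z = y2 z * (inverse (c g) * (G z - y1 z ^ 2 * A z)) + y3 z * (inverse (c g) * (- (y1 z ^ 2 * B z)))"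
        unfolding mult.assoc[symmetric] left_inverse[OF cg] by (simp add: algebra_simps)
    qed
  qed
  from inJ_mult[OF this] have "\<exists>j0. \<forall>j\<ge>j0. \<forall>F\<in>forms j. inJ (length \<rho>s + j + 1) (\<lambda>z. y1 z ^ 2 * ?P z * F z)"
    unfolding \<rho>s(1) by (auto simp: add.commute add.left_commute)
  from tangent_ideal_step[OF this] that show ?thesis by blast
qed

text \<open>The tangent line meets the curve in a scheme of length 2 supported at \<open>e0\<close>,
  so in large degree two elements span the forms modulo its ideal. They may be taken divisible by
  any \<open>H\<close> that is nonzero at \<open>e0\<close>.\<close>

lemma tangent_decomposition:
  assumes H: "H \<in> forms \<gamma>" "H e0 \<noteq> 0"
  obtains k0 where "\<And>i F. i \<ge> k0 \<Longrightarrow> F \<in> forms (i + \<gamma> + 2) \<Longrightarrow>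
    \<exists>\<alpha> \<beta>. inJ (i + \<gamma> + 1) (\<lambda>z. F z - H z * (\<alpha> * x0 z ^ (i + 2) + \<beta> * (x0 z ^ (i + 1) * y1 z)))"
proof -
  obtain j0 where j0: "\<And>j F. j \<ge> j0 \<Longrightarrow> F \<in> forms j \<Longrightarrow> inJ (j + 1) (\<lambda>z. y1 z ^ 2 * F z)"
    using tangent_ideal by blast
  have "\<exists>\<alpha> \<beta>. inJ (i + \<gamma> + 1) (\<lambda>z. F z - H z * (\<alpha> * x0 z ^ (i + 2) + \<beta> * (x0 z ^ (i + 1) * y1 z)))"
    if i: "i \<ge> j0" and F: "F \<in> forms (i + \<gamma> + 2)" for i F
  proof -
    \<comment> \<open>\<open>\<alpha>\<close> makes the difference vanish at \<open>e0\<close>, and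
      \<open>\<beta>\<close> below does the same for the cofactor of \<open>y1\<close>. What is left
      outside the ideal is \<open>y1^2\<close> times a form, which \<open>tangent_ideal\<close>
      absorbs.\<close>
    define \<alpha> where "\<alpha> = F e0 / H e0"
    define F' where "F' z = F z - \<alpha> * (H z * x0 z ^ (i + 2))" for z
    have "(\<lambda>z. H z * x0 z ^ (i + 2)) \<in> forms (i + \<gamma> + 2)"
      by (rule forms_mult'[OF H(1) forms_power1[OF lin(1)]]) simp
    then have "F' \<in> forms (i + \<gamma> + 2)" unfolding F'_def by (intro forms_diff forms_scale F)
    then have "F' \<in> forms (Suc (i + \<gamma> + 1))" by simp
    moreover have "F' e0 = 0" using H(2) by (simp add: F'_def \<alpha>_def dual)
    ultimately obtain F1 F2 F3 where F1: "F1 \<in> forms (i + \<gamma> + 1)" "F2 \<in> forms (i + \<gamma> + 1)" "F3 \<in> forms (i + \<gamma> + 1)"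
      "\<And>z. F' z = y1 z * F1 z + y2 z * F2 z + y3 z * F3 z"
      using expand0[of F'] by (metis add_0 mult_zero_left)
    define \<beta> where "\<beta> = F1 e0 / H e0"
    define F1' where "F1' z = F1 z - \<beta> * (H z * x0 z ^ (i + 1))" for z
    have "(\<lambda>z. H z * x0 z ^ (i + 1)) \<in> forms (i + \<gamma> + 1)"
      by (rule forms_mult'[OF H(1) forms_power1[OF lin(1)]]) simp
    then have "F1' \<in> forms (i + \<gamma> + 1)" unfolding F1'_def by (intro forms_diff forms_scale F1)
    then have "F1' \<in> forms (Suc (i + \<gamma>))" by simp
    moreover have "F1' e0 = 0" using H(2) by (simp add: F1'_def \<beta>_def dual)
    ultimately obtain F4 F5 F6 where F4: "F4 \<in> forms (i + \<gamma>)" "F5 \<in> forms (i + \<gamma>)" "F6 \<in> forms (i + \<gamma>)"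
      "\<And>z. F1' z = y1 z * F4 z + y2 z * F5 z + y3 z * F6 z"
      using expand0[of F1'] by (metis add_0 mult_zero_left)
    have "inJ (i + \<gamma> + 1) (\<lambda>z. y1 z ^ 2 * F4 z)" by (rule j0) (use i F4 in auto)
    moreover have "inJ (i + \<gamma> + 1) (\<lambda>z. (y2 z * F5 z + y3 z * F6 z) * y1 z)"
      by (intro inJ_mult inJ_gen F4 lin)
    moreover have "inJ (i + \<gamma> + 1) (\<lambda>z. y2 z * F2 z + y3 z * F3 z)" by (rule inJ_gen[OF F1(2,3)])
    ultimately have "inJ (i + \<gamma> + 1) (\<lambda>z. y1 z ^ 2 * F4 z + ((y2 z * F5 z + y3 z * F6 z) * y1 z + (y2 z * F2 z + y3 z * F3 z)))"
      by (rule inJ_add[OF _ inJ_add])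
    then have "inJ (i + \<gamma> + 1) (\<lambda>z. F z - H z * (\<alpha> * x0 z ^ (i + 2) + \<beta> * (x0 z ^ (i + 1) * y1 z)))"
    proof (rule inJ_cong)
      fix z
      have "F z = F' z + \<alpha> * (H z * x0 z ^ (i + 2))" by (simp add: F'_def)
      moreover have "F1 z = F1' z + \<beta> * (H z * x0 z ^ (i + 1))" by (simp add: F1'_def)
      ultimately show "F z - H z * (\<alpha> * x0 z ^ (i + 2) + \<beta> * (x0 z ^ (i + 1) * y1 z)) =
         y1 z ^ 2 * F4 z + ((y2 z * F5 z + y3 z * F6 z) * y1 z + (y2 z * F2 z + y3 z * F3 z))"
        unfolding F1(4) F4(4) by (simp add: algebra_simps power2_eq_square)
    qed
    then show ?thesis by blast
  qed
  then show ?thesis using that by blast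
qed

subsection \<open>Plane sections through the tangent line\<close>

text \<open>Congruence in the coordinate ring modulo the plane of slope \<open>\<mu>\<close> through
  the tangent line.\<close>

definition eqL :: "complex \<Rightarrow> nat \<Rightarrow> cfun \<Rightarrow> cfun \<Rightarrow> bool" where
  "eqL \<mu> n F H \<longleftrightarrow> (\<exists>A\<in>forms n. \<forall>z\<in>Z. F z = H z + (y3 z - \<mu> * y2 z) * A z)"

lemma eqLI: "A \<in> forms n \<Longrightarrow> (\<And>z. z \<in> Z \<Longrightarrow> F z = H z + (y3 z - \<mu> * y2 z) * A z) \<Longrightarrow> eqL \<mu> n F H"
  unfolding eqL_def by blast

lemma eqL_refl: "(\<And>z. z \<in> Z \<Longrightarrow> F z = H z) \<Longrightarrow> eqL \<mu> n F H"
  by (rule eqLI[of "\<lambda>_. 0"]) (auto intro: forms_zero)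

lemma eqL_trans:
  assumes "eqL \<mu> n F H" "eqL \<mu> n H K"
  shows "eqL \<mu> n F K"
proof -
  obtain A B where A: "A \<in> forms n" "\<And>z. z \<in> Z \<Longrightarrow> F z = H z + (y3 z - \<mu> * y2 z) * A z"
    and B: "B \<in> forms n" "\<And>z. z \<in> Z \<Longrightarrow> H z = K z + (y3 z - \<mu> * y2 z) * B z"
    using assms unfolding eqL_def by blast
  show ?thesis
    by (rule eqLI[OF forms_add[OF B(1) A(1)]]) (simp add: A(2) B(2) algebra_simps)
qed

lemma eqL_sym:
  assumes "eqL \<mu> n F H"
  shows "eqL \<mu> n H F"
proof -
  obtain A where A: "A \<in> forms n" "\<And>z. z \<in> Z \<Longrightarrow> F z = H z + (y3 z - \<mu> * y2 z) * A z"
    using assms unfolding eqL_def by blast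
  show ?thesis by (rule eqLI[OF forms_uminus[OF A(1)]]) (simp add: A(2))
qed

lemma eqL_cong:
  assumes "eqL \<mu> n F H" "\<And>z. z \<in> Z \<Longrightarrow> F' z = F z" "\<And>z. z \<in> Z \<Longrightarrow> H' z = H z"
  shows "eqL \<mu> n F' H'"
  using assms unfolding eqL_def by force

lemma eqL_add:
  assumes "eqL \<mu> n F H" "eqL \<mu> n F' H'"
  shows "eqL \<mu> n (\<lambda>z. F z + F' z) (\<lambda>z. H z + H' z)"
proof -
  obtain A B where A: "A \<in> forms n" "\<And>z. z \<in> Z \<Longrightarrow> F z = H z + (y3 z - \<mu> * y2 z) * A z"
    and B: "B \<in> forms n" "\<And>z. z \<in> Z \<Longrightarrow> F' z = H' z + (y3 z - \<mu> * y2 z) * B z"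
    using assms unfolding eqL_def by blast
  show ?thesis
    by (rule eqLI[OF forms_add[OF A(1) B(1)]]) (simp add: A(2) B(2) algebra_simps)
qed

lemma eqL_scale:
  assumes "eqL \<mu> n F H"
  shows "eqL \<mu> n (\<lambda>z. c * F z) (\<lambda>z. c * H z)"
proof -
  obtain A where A: "A \<in> forms n" "\<And>z. z \<in> Z \<Longrightarrow> F z = H z + (y3 z - \<mu> * y2 z) * A z"
    using assms unfolding eqL_def by blast
  show ?thesis
    by (rule eqLI[OF forms_scale[OF A(1), of c]]) (simp add: A(2) algebra_simps)
qed

lemma eqL_mult:
  assumes "eqL \<mu> n F H" "K \<in> forms j"
  shows "eqL \<mu> (n + j) (\<lambda>z. F z * K z) (\<lambda>z. H z * K z)"
proof -
  obtain A where A: "A \<in> forms n" "\<And>z. z \<in> Z \<Longrightarrow> F z = H z + (y3 z - \<mu> * y2 z) * A z"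
    using assms unfolding eqL_def by blast
  show ?thesis
    by (rule eqLI[OF forms_mult[OF A(1) assms(2)]]) (simp add: A(2) algebra_simps)
qed

lemma eqL_sum:
  "(\<And>i. i \<in> I \<Longrightarrow> eqL \<mu> n (F i) (H i)) \<Longrightarrow> eqL \<mu> n (\<lambda>z. \<Sum>i\<in>I. F i z) (\<lambda>z. \<Sum>i\<in>I. H i z)"
  by (induction I rule: infinite_finite_induct) (auto intro: eqL_add eqL_refl)

text \<open>The exponent is a successor because the cofactor has one degree less than the forms
  compared.\<close>

lemma eqL_power:
  assumes "eqL \<mu> n F H" "F \<in> forms (Suc n)" "H \<in> forms (Suc n)"
  shows "eqL \<mu> (k * Suc n + n) (\<lambda>z. F z ^ Suc k) (\<lambda>z. H z ^ Suc k)"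
proof (induction k)
  case 0
  show ?case using assms by simp
next
  case (Suc k)
  have F: "(\<lambda>z. F z ^ Suc k) \<in> forms (Suc k * Suc n)" by (rule forms_power[OF assms(2)])
  have "eqL \<mu> (n + Suc k * Suc n) (\<lambda>z. F z * F z ^ Suc k) (\<lambda>z. H z * F z ^ Suc k)"
    by (rule eqL_mult[OF assms(1) F])
  moreover have "eqL \<mu> (k * Suc n + n + Suc n) (\<lambda>z. F z ^ Suc k * H z) (\<lambda>z. H z ^ Suc k * H z)"
    by (rule eqL_mult[OF Suc assms(3)])
  ultimately have "eqL \<mu> (Suc k * Suc n + n) (\<lambda>z. F z ^ Suc (Suc k)) (\<lambda>z. H z * F z ^ Suc k)"
    "eqL \<mu> (Suc k * Suc n + n) (\<lambda>z. H z * F z ^ Suc k) (\<lambda>z. H z ^ Suc (Suc k))"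
    by (simp_all add: algebra_simps)
  then show ?case by (rule eqL_trans)
qed

text \<open>Modulo the plane \<open>y3\<close> is \<open>\<mu> y2\<close>, so a form in
  \<open>y2, y3\<close> becomes its value at \<open>(1, \<mu>)\<close> times a power of
  \<open>y2\<close>. The extra factor \<open>y2\<close> prevents a cofactor of negative degree when
  \<open>f\<close> is constant.\<close>

lemma pol_Y2_scale:
  assumes "pol {y2, y3} k f"
  shows "eqL \<mu> k (\<lambda>z. y2 z * f z) (\<lambda>z. f (e2 + \<mu> *s e3) * y2 z ^ Suc k)"
  using assms
proof (induction rule: pol.induct)
  case (pol_const c)
  show ?case by (rule eqL_refl) simp
next
  case (pol_zero k)
  show ?case by (rule eqL_refl) simp
next
  case (pol_times l k f)
  have v: "l (e2 + \<mu> *s e3) = l e2 + \<mu> * l e3" if "l \<in> forms 1" for l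
    using that by (simp add: forms1_add forms1_smult)
  have f: "f \<in> forms k" using pol_forms[OF pol_times(2)] by simp
  from pol_times(1) consider "l = y2" | "l = y3" by blast
  then show ?case
  proof cases
    case 1
    have "y2 (e2 + \<mu> *s e3) = 1" by (simp add: v[OF lin(3)] dual)
    then show ?thesis using eqL_mult[OF pol_times(3) lin(3)] 1 by (simp add: mult_ac)
  next
    case 2
    have l: "y3 (e2 + \<mu> *s e3) = \<mu>" by (simp add: v[OF lin(4)] dual)
    have "eqL \<mu> (Suc k) (\<lambda>z. y2 z * (y3 z * f z)) (\<lambda>z. \<mu> * (y2 z * f z * y2 z))"
      by (rule eqLI[of "\<lambda>z. y2 z * f z"], rule forms_mult'[OF lin(3) f]) (simp_all add: algebra_simps)
    moreover have "eqL \<mu> (Suc k) (\<lambda>z. \<mu> * (y2 z * f z * y2 z)) (\<lambda>z. \<mu> * (f (e2 + \<mu> *s e3) * y2 z ^ Suc k * y2 z))"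
      using eqL_scale[OF eqL_mult[OF pol_times(3) lin(3)]] by simp
    ultimately have "eqL \<mu> (Suc k) (\<lambda>z. y2 z * (y3 z * f z)) (\<lambda>z. \<mu> * (f (e2 + \<mu> *s e3) * y2 z ^ Suc k * y2 z))"
      by (rule eqL_trans)
    then show ?thesis using 2 l by (simp add: mult_ac)
  qed
next
  case (pol_plus k f h)
  from eqL_add[OF pol_plus(3,4)] show ?case by (simp add: algebra_simps)
qed

text \<open>Serves to choose a plane through the tangent line on which given denominators do not
  vanish.\<close>

lemma finite_slopes:
  assumes "pol {y2, y3} k f" "f u \<noteq> 0"
  shows "finite {\<mu>. f (e2 + \<mu> *s e3) = 0}"
proof -
  have "pol {y3, y2} k f" using assms(1) by (simp add: insert_commute)
  then obtain c where c: "\<And>x. f x = (\<Sum>i\<le>k. c i * y3 x ^ i * y2 x ^ (k - i))"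
    using pol_binary by blast
  have v: "l (e2 + \<mu> *s e3) = l e2 + \<mu> * l e3" if "l \<in> forms 1" for l \<mu>
    using that by (simp add: forms1_add forms1_smult)
  have "f (e2 + \<mu> *s e3) = (\<Sum>i\<le>k. c i * \<mu> ^ i)" for \<mu>
    unfolding c by (simp add: v[OF lin(3)] v[OF lin(4)] dual)
  moreover obtain i where "i \<le> k" "c i \<noteq> 0"
    using assms(2) unfolding c by (metis (no_types, lifting) atMost_iff mult_zero_left sum.neutral)
  ultimately show ?thesis using finite_poly_zeros[of i k c] by simp
qed

text \<open>A binary form splits into equations of planes through the tangent line. None of these
  planes contains the nondegenerate curve, and the coordinate ring is a domain.\<close>

lemma nz_pol_Y2:
  assumes "pol {y2, y3} k f" "f u \<noteq> 0"
  shows "nz f"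
proof -
  obtain c where c: "\<And>x. f x = (\<Sum>i\<le>k. c i * y2 x ^ i * y3 x ^ (k - i))"
    using pol_binary[OF assms(1)] by blast
  have "\<exists>i\<le>k. c i \<noteq> 0"
    using assms(2) unfolding c by (metis (no_types, lifting) atMost_iff mult_zero_left sum.neutral)
  \<comment> \<open>The degree in \<open>y2\<close>; what the factorisation of degree
    \<open>n\<close> leaves over is \<open>y3 ^ (k - n)\<close>.\<close>
  define n where "n = Max {i. i \<le> k \<and> c i \<noteq> 0}"
  have "n \<in> {i. i \<le> k \<and> c i \<noteq> 0}" unfolding n_def by (rule Max_in) (use \<open>\<exists>i\<le>k. c i \<noteq> 0\<close> in auto)
  then have n: "n \<le> k" "c n \<noteq> 0" by auto
  have nmax: "i \<le> n" if "i \<le> k" "c i \<noteq> 0" for i unfolding n_def by (rule Max_ge) (use that in auto)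
  obtain \<rho>s where \<rho>s: "length \<rho>s = n"
    "\<And>a b. (\<Sum>i\<le>n. c i * a ^ i * b ^ (n - i)) = c n * (\<Prod>\<rho>\<leftarrow>\<rho>s. a - \<rho> * b)"
    using binary_factor[where c = c and n = n, OF n(2)] by blast
  have f: "f x = y3 x ^ (k - n) * (c n * (\<Prod>\<rho>\<leftarrow>\<rho>s. y2 x - \<rho> * y3 x))" for x
  proof -
    have "f x = (\<Sum>i\<le>n. c i * y2 x ^ i * y3 x ^ (k - i))"
      unfolding c by (rule sum.mono_neutral_right) (use n nmax in \<open>force+\<close>)
    also have "\<dots> = (\<Sum>i\<le>n. y3 x ^ (k - n) * (c i * y2 x ^ i * y3 x ^ (n - i)))"
    proof (rule sum.cong)
      fix i assume "i \<in> {..n}"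
      then have "k - i = (k - n) + (n - i)" using n by auto
      then show "c i * y2 x ^ i * y3 x ^ (k - i) = y3 x ^ (k - n) * (c i * y2 x ^ i * y3 x ^ (n - i))"
        by (simp add: power_add)
    qed simp
    also have "\<dots> = y3 x ^ (k - n) * (c n * (\<Prod>\<rho>\<leftarrow>\<rho>s. y2 x - \<rho> * y3 x))"
      by (simp only: sum_distrib_left[symmetric] \<rho>s(2))
    finally show ?thesis .
  qed
  have "(\<lambda>x. c n * (\<Prod>\<rho>\<leftarrow>\<rho>s. y2 x - \<rho> * y3 x)) \<in> forms (length \<rho>s) \<and> nz (\<lambda>x. c n * (\<Prod>\<rho>\<leftarrow>\<rho>s. y2 x - \<rho> * y3 x))"
  proof (induction \<rho>s)
    case Nil
    show ?case using e0_Z n(2) by (auto simp: nz_def forms_const)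
  next
    case (Cons \<rho> \<rho>s)
    have l: "(\<lambda>z. y2 z - \<rho> * y3 z) \<in> forms 1" by (intro forms_diff forms_scale lin)
    have "nz (\<lambda>z. y2 z - \<rho> * y3 z)"
      using nondeg[OF l, of e2] dual by (simp add: nz_def)
    with nz_mult[OF l conjunct1[OF Cons] this conjunct2[OF Cons]] forms_mult[OF l conjunct1[OF Cons]] Cons
    show ?case by (simp add: mult.left_commute)
  qed
  moreover have "nz (\<lambda>x. y3 x ^ (k - n))"
    using nz_power[OF lin(4), of "k - n"] nondeg[OF lin(4), of e3] dual by (simp add: nz_def)
  ultimately have "nz (\<lambda>x. y3 x ^ (k - n) * (c n * (\<Prod>\<rho>\<leftarrow>\<rho>s. y2 x - \<rho> * y3 x)))"
    using nz_mult[OF forms_power1[OF lin(4)]] by blast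
  then show ?thesis unfolding f[symmetric] .
qed

text \<open>For \<open>\<mu> \<noteq> 0\<close> the plane is not the osculating one, so it meets the
  curve at \<open>e0\<close> with multiplicity 2, as the tangent line does: \<open>El\<close> is
  nonzero there. Hence \<open>H = G El\<close>, a unit at \<open>e0\<close>, kills \<open>y2\<close>
  modulo the plane. If \<open>F\<close> is written by \<open>tangent_decomposition\<close> with this
  \<open>H\<close>, the multiple of \<open>H\<close> disappears after multiplication by
  \<open>y2\<close>, and the rest is divisible by \<open>y2\<close> modulo the plane.\<close>

lemma plane_step:
  assumes "\<mu> \<noteq> 0"
  obtains k1 where "\<And>j F. j \<ge> k1 \<Longrightarrow> F \<in> forms (Suc j) \<Longrightarrow>
     \<exists>B\<in>forms j. eqL \<mu> (Suc j) (\<lambda>z. y2 z * F z) (\<lambda>z. y2 z ^ 2 * B z)"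
proof -
  define El where "El z = E3 z - \<mu> * E2 z" for z
  define H where "H z = G z * El z" for z
  have El: "El \<in> forms g" unfolding El_def by (intro forms_diff forms_scale local)
  have H: "H \<in> forms (Suc g + g)" unfolding H_def by (rule forms_mult[OF local(1) El])
  have He0: "H e0 \<noteq> 0" using local assms by (simp add: H_def El_def)
  have Hy2: "H z * y2 z = (y3 z - \<mu> * y2 z) * (E2 z * G z)" if "z \<in> Z" for z
  proof -
    have "H z * y2 z = El z * (G z * y2 z)" by (simp add: H_def)
    also have "\<dots> = E2 z * (y1 z ^ 2 * E3 z - \<mu> * (y1 z ^ 2 * E2 z))"
      unfolding local(7)[OF that] by (simp add: El_def algebra_simps)
    also have "\<dots> = E2 z * (G z * y3 z - \<mu> * (G z * y2 z))"
      unfolding local(7,8)[OF that] ..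
    finally show ?thesis by (simp add: algebra_simps)
  qed
  obtain k0 where k0: "\<And>i F. i \<ge> k0 \<Longrightarrow> F \<in> forms (i + (Suc g + g) + 2) \<Longrightarrow>
    \<exists>\<alpha> \<beta>. inJ (i + (Suc g + g) + 1) (\<lambda>z. F z - H z * (\<alpha> * x0 z ^ (i + 2) + \<beta> * (x0 z ^ (i + 1) * y1 z)))"
    using tangent_decomposition[OF H He0] by blast
  have "\<exists>B\<in>forms j. eqL \<mu> (Suc j) (\<lambda>z. y2 z * F z) (\<lambda>z. y2 z ^ 2 * B z)"
    if j: "j \<ge> k0 + (Suc g + g) + 1" and F: "F \<in> forms (Suc j)" for j F
  proof -
    define i where "i = j - (Suc g + g) - 1"
    have ji: "j = i + (Suc g + g) + 1" and ik: "i \<ge> k0" unfolding i_def using j by linarith+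
    obtain \<alpha> \<beta> where "inJ (i + (Suc g + g) + 1) (\<lambda>z. F z - H z * (\<alpha> * x0 z ^ (i + 2) + \<beta> * (x0 z ^ (i + 1) * y1 z)))"
      using k0[OF ik, of F] F unfolding ji by auto
    then obtain A B where A: "A \<in> forms j" and B: "B \<in> forms j" and E: "\<And>z. z \<in> Z \<Longrightarrow>
        F z - H z * (\<alpha> * x0 z ^ (i + 2) + \<beta> * (x0 z ^ (i + 1) * y1 z)) = y2 z * A z + y3 z * B z"
      unfolding inJ_def ji by blast
    let ?T = "\<lambda>z. \<alpha> * x0 z ^ (i + 2) + \<beta> * (x0 z ^ (i + 1) * y1 z)"
    have T: "?T \<in> forms (i + 2)"
      by (intro forms_add forms_scale forms_power1 lin forms_mult'[OF forms_power1[OF lin(1)] lin(2)]) simp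
    have M: "(\<lambda>z. E2 z * G z * ?T z + y2 z * B z) \<in> forms (Suc j)"
    proof (rule forms_add)
      show "(\<lambda>z. E2 z * G z * ?T z) \<in> forms (Suc j)"
        by (rule forms_mult'[OF forms_mult[OF local(2,1)] T]) (simp add: ji)
      show "(\<lambda>z. y2 z * B z) \<in> forms (Suc j)" by (rule forms_mult'[OF lin(3) B]) simp
    qed
    have "(\<lambda>z. A z + \<mu> * B z) \<in> forms j" by (intro forms_add forms_scale A B)
    moreover have "eqL \<mu> (Suc j) (\<lambda>z. y2 z * F z) (\<lambda>z. y2 z ^ 2 * (A z + \<mu> * B z))"
    proof (rule eqLI[OF M])
      fix z assume z: "z \<in> Z"
      have "y2 z * F z = (H z * y2 z) * ?T z + y2 z * (y2 z * A z + y3 z * B z)"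
        unfolding E[OF z, symmetric] by (simp add: algebra_simps)
      then show "y2 z * F z = y2 z ^ 2 * (A z + \<mu> * B z) + (y3 z - \<mu> * y2 z) * (E2 z * G z * ?T z + y2 z * B z)"
        unfolding Hy2[OF z] by (simp add: algebra_simps power2_eq_square)
    qed
    ultimately show ?thesis by (intro bexI[of _ "\<lambda>z. A z + \<mu> * B z"])
  qed
  then show ?thesis using that by blast
qed

text \<open>Trades surplus degree of \<open>F\<close> for powers of \<open>y2\<close>: the degree of
  \<open>B\<close> does not depend on \<open>N\<close>. The powers serve later to clear denominators
  that are forms in \<open>y2, y3\<close>.\<close>

lemma plane_iterate:
  assumes step: "\<And>j F. j \<ge> k1 \<Longrightarrow> F \<in> forms (Suc j) \<Longrightarrow>
     \<exists>B\<in>forms j. eqL \<mu> (Suc j) (\<lambda>z. y2 z * F z) (\<lambda>z. y2 z ^ 2 * B z)"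
    and "j \<ge> k1" "F \<in> forms (j + N)"
  shows "\<exists>B\<in>forms j. eqL \<mu> (j + N) (\<lambda>z. y2 z * F z) (\<lambda>z. y2 z ^ Suc N * B z)"
  using assms(3)
proof (induction N arbitrary: F)
  case 0
  then show ?case by (intro bexI[of _ F]) (auto intro: eqL_refl)
next
  case (Suc N)
  then obtain B1 where B1: "B1 \<in> forms (j + N)"
    "eqL \<mu> (Suc (j + N)) (\<lambda>z. y2 z * F z) (\<lambda>z. y2 z ^ 2 * B1 z)"
    using step[of "j + N" F] assms(2) by auto
  obtain B where B: "B \<in> forms j" "eqL \<mu> (j + N) (\<lambda>z. y2 z * B1 z) (\<lambda>z. y2 z ^ Suc N * B z)"
    using Suc.IH[OF B1(1)] by blast
  from eqL_mult[OF B(2) lin(3)]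
  have "eqL \<mu> (Suc (j + N)) (\<lambda>z. y2 z ^ 2 * B1 z) (\<lambda>z. y2 z ^ Suc (Suc N) * B z)"
    by (simp add: power2_eq_square mult_ac)
  from eqL_trans[OF B1(2) this] B(1) show ?case by auto
qed

subsection \<open>Reduction by a plane equation of the projected curve\<close>

text \<open>The offset \<open>r\<close> keeps the truncated subtraction in the degree of \<open>h a\<close> exact.\<close>

definition low :: "nat \<Rightarrow> nat \<Rightarrow> cfun \<Rightarrow> bool" where
  "low r n F \<longleftrightarrow> (\<exists>h. (\<forall>a<r. pol {y2, y3} (n + r - a) (h a)) \<and> (\<forall>z\<in>Z. F z = (\<Sum>a<r. y1 z ^ a * h a z)))"

text \<open>Pseudo-division by the relation, read as a polynomial of degree \<open>r\<close> in
  \<open>y1\<close> with leading coefficient \<open>fs r\<close>: each variable of \<open>N\<close>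
  costs one factor \<open>fs r\<close>. The factor \<open>y2 ^ r\<close> supplies the offset
  \<open>r\<close> in the degrees of the coefficients.\<close>

lemma low_step:
  assumes r: "r > 0"
    and fs: "\<And>a. a \<le> r \<Longrightarrow> pol {y2, y3} (r + s - a) (fs a)"
    and rel: "\<And>z. z \<in> Z \<Longrightarrow> (\<Sum>a\<le>r. y1 z ^ a * fs a z) = 0"
    and N: "pol {y1, y2, y3} k N"
  shows "low r (k * Suc s) (\<lambda>z. y2 z ^ r * fs r z ^ k * N z)"
  using N
proof (induction rule: pol.induct)
  case (pol_const c)
  have "pol {y2, y3} r (\<lambda>z. c * y2 z ^ r)" by (intro pol_scale pol_power_var) simp
  moreover have "(\<Sum>a<r. y1 z ^ a * (if a = 0 then \<lambda>z. c * y2 z ^ r else (\<lambda>_. 0)) z) = c * y2 z ^ r" for z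
  proof -
    obtain q where "r = Suc q" using r by (cases r) auto
    then show ?thesis by (simp only: sum.lessThan_Suc_shift) simp
  qed
  ultimately show ?case unfolding low_def
    by (intro exI[of _ "\<lambda>a. if a = 0 then \<lambda>z. c * y2 z ^ r else (\<lambda>_. 0)"])
      (auto simp: mult.commute intro: pol.pol_zero)
next
  case (pol_zero k)
  show ?case unfolding low_def by (intro exI[of _ "\<lambda>_ _. 0"]) (auto intro: pol.pol_zero)
next
  case (pol_times l k N)
  from pol_times(3) obtain h where h: "\<And>a. a < r \<Longrightarrow> pol {y2, y3} (k * Suc s + r - a) (h a)"
    "\<And>z. z \<in> Z \<Longrightarrow> y2 z ^ r * fs r z ^ k * N z = (\<Sum>a<r. y1 z ^ a * h a z)"
    unfolding low_def by blast
  have fr: "pol {y2, y3} s (fs r)" using fs[of r] by simp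
  have split: "y2 z ^ r * fs r z ^ Suc k * (l z * N z) = l z * fs r z * (\<Sum>a<r. y1 z ^ a * h a z)" if "z \<in> Z" for z
    unfolding h(2)[OF that, symmetric] by simp
  show ?case
  proof (cases "l = y1")
    case False
    then have l: "l \<in> {y2, y3}" using pol_times(1) by blast
    have "pol {y2, y3} (Suc k * Suc s + r - a) (\<lambda>z. l z * (fs r z * h a z))" if "a < r" for a
    proof -
      have "pol {y2, y3} (Suc (s + (k * Suc s + r - a))) (\<lambda>z. l z * (fs r z * h a z))"
        by (intro pol.pol_times l pol_mult fr h that)
      moreover have "Suc (s + (k * Suc s + r - a)) = Suc k * Suc s + r - a" using that by simp
      ultimately show ?thesis by metis
    qed
    moreover have "y2 z ^ r * fs r z ^ Suc k * (l z * N z) = (\<Sum>a<r. y1 z ^ a * (l z * (fs r z * h a z)))" if "z \<in> Z" for z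
      unfolding split[OF that] by (simp add: sum_distrib_left mult_ac)
    ultimately show ?thesis unfolding low_def
      by (intro exI[of _ "\<lambda>a z. l z * (fs r z * h a z)"]) simp
  next
    case True
    obtain q where q: "r = Suc q" using r by (cases r) auto
    \<comment> \<open>Multiplication by \<open>y1\<close> shifts the coefficients; the one that
      arrives at \<open>y1 ^ r\<close> is rewritten by the relation.\<close>
    define h' where "h' a = (\<lambda>z. (if a = 0 then 0 else fs r z * h (a - 1) z) - fs a z * h q z)" for a
    have "pol {y2, y3} (Suc k * Suc s + r - a) (h' a)" if "a < r" for a
      unfolding h'_def
    proof (rule pol_diff)
      show "pol {y2, y3} (Suc k * Suc s + r - a) (\<lambda>z. if a = 0 then 0 else fs r z * h (a - 1) z)"
      proof (cases "a = 0")
        case True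
        then show ?thesis by (simp add: pol.pol_zero)
      next
        case False
        have "pol {y2, y3} (s + (k * Suc s + r - (a - 1))) (\<lambda>z. fs r z * h (a - 1) z)"
          by (intro pol_mult fr h) (use that in simp)
        moreover have "s + (k * Suc s + r - (a - 1)) = Suc k * Suc s + r - a" using that False by simp
        ultimately have "pol {y2, y3} (Suc k * Suc s + r - a) (\<lambda>z. fs r z * h (a - 1) z)" by metis
        then show ?thesis using False by simp
      qed
      have "pol {y2, y3} (r + s - a + (k * Suc s + r - q)) (\<lambda>z. fs a z * h q z)"
        by (intro pol_mult fs h) (use that q in auto)
      moreover have "r + s - a + (k * Suc s + r - q) = Suc k * Suc s + r - a" using that q by simp
      ultimately show "pol {y2, y3} (Suc k * Suc s + r - a) (\<lambda>z. fs a z * h q z)" by metis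
    qed
    moreover have "y2 z ^ r * fs r z ^ Suc k * (l z * N z) = (\<Sum>a<r. y1 z ^ a * h' a z)" if z: "z \<in> Z" for z
    proof -
      have top: "y1 z ^ r * fs r z = - (\<Sum>a<r. y1 z ^ a * fs a z)"
        using rel[OF z] unfolding lessThan_Suc_atMost[symmetric] by (simp add: eq_neg_iff_add_eq_0 add.commute)
      have 1: "(\<Sum>a<r. y1 z ^ a * (if a = 0 then 0 else fs r z * h (a - 1) z)) = (\<Sum>a<q. y1 z ^ Suc a * (fs r z * h a z))"
        unfolding q sum.lessThan_Suc_shift by simp
      have "y2 z ^ r * fs r z ^ Suc k * (l z * N z) = (\<Sum>a<Suc q. y1 z ^ Suc a * (fs r z * h a z))"
        using split[OF z] unfolding True q[symmetric] by (simp add: sum_distrib_left mult_ac)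
      also have "\<dots> = (\<Sum>a<q. y1 z ^ Suc a * (fs r z * h a z)) + y1 z ^ r * fs r z * h q z"
        by (simp add: q)
      also have "\<dots> = (\<Sum>a<r. y1 z ^ a * (if a = 0 then 0 else fs r z * h (a - 1) z)) - (\<Sum>a<r. y1 z ^ a * fs a z) * h q z"
        unfolding 1 top by simp
      also have "\<dots> = (\<Sum>a<r. y1 z ^ a * h' a z)"
        unfolding h'_def by (simp add: right_diff_distrib sum_subtractf sum_distrib_right mult.assoc)
      finally show ?thesis .
    qed
    ultimately show ?thesis unfolding low_def by blast
  qed
next
  case (pol_plus k N N')
  from pol_plus(3) obtain h where h: "\<And>a. a < r \<Longrightarrow> pol {y2, y3} (k * Suc s + r - a) (h a)"
    "\<And>z. z \<in> Z \<Longrightarrow> y2 z ^ r * fs r z ^ k * N z = (\<Sum>a<r. y1 z ^ a * h a z)"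
    unfolding low_def by blast
  from pol_plus(4) obtain h' where h': "\<And>a. a < r \<Longrightarrow> pol {y2, y3} (k * Suc s + r - a) (h' a)"
    "\<And>z. z \<in> Z \<Longrightarrow> y2 z ^ r * fs r z ^ k * N' z = (\<Sum>a<r. y1 z ^ a * h' a z)"
    unfolding low_def by blast
  have "y2 z ^ r * fs r z ^ k * (N z + N' z) = (\<Sum>a<r. y1 z ^ a * (h a z + h' a z))" if "z \<in> Z" for z
    using h(2)[OF that] h'(2)[OF that] by (simp add: distrib_left sum.distrib)
  moreover have "pol {y2, y3} (k * Suc s + r - a) (\<lambda>z. h a z + h' a z)" if "a < r" for a
    by (rule pol.pol_plus[OF h(1)[OF that] h'(1)[OF that]])
  ultimately show ?case unfolding low_def by (intro exI[of _ "\<lambda>a z. h a z + h' a z"]) simp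
qed

text \<open>Extension by zero turns identities on \<open>Z\<close> into identities of functions, to
  which the linear algebra of spans applies.\<close>

definition rs :: "cfun \<Rightarrow> cfun" where "rs F = (\<lambda>z. if z \<in> Z then F z else 0)"

text \<open>Counts monomials with exponent of \<open>y1\<close> below \<open>r\<close>; what matters
  is that the bound is linear in \<open>n\<close>.\<close>

lemma low_span:
  obtains Y where "finite Y" "card Y \<le> r * (n + r + 1)" "\<And>F. low r n F \<Longrightarrow> rs F \<in> cfun.span Y"
proof -
  define m where "m = (\<lambda>(a, b). rs (\<lambda>z. y1 z ^ a * (y2 z ^ b * y3 z ^ (n + r - a - b))))"
  let ?I = "{..<r} \<times> {..n + r}"
  have "card (m ` ?I) \<le> r * (n + r + 1)"
    using card_image_le[of ?I m] by simp
  moreover have "rs F \<in> cfun.span (m ` ?I)" if "low r n F" for F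
  proof -
    from that obtain h where h: "\<And>a. a < r \<Longrightarrow> pol {y2, y3} (n + r - a) (h a)"
      "\<And>z. z \<in> Z \<Longrightarrow> F z = (\<Sum>a<r. y1 z ^ a * h a z)" unfolding low_def by blast
    have "\<forall>a. \<exists>c. a < r \<longrightarrow> (\<forall>x. h a x = (\<Sum>b\<le>n + r - a. c b * y2 x ^ b * y3 x ^ (n + r - a - b)))"
      using pol_binary[OF h(1)] by blast
    then obtain c where c: "\<And>a x. a < r \<Longrightarrow> h a x = (\<Sum>b\<le>n + r - a. c a b * y2 x ^ b * y3 x ^ (n + r - a - b))"
      by metis
    have "(\<lambda>z. \<Sum>a<r. \<Sum>b\<le>n + r - a. c a b * m (a, b) z) \<in> cfun.span (m ` ?I)"
      by (intro cfun_span_sum cfun_span_scale cfun.span_base imageI) auto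
    moreover have "rs F = (\<lambda>z. \<Sum>a<r. \<Sum>b\<le>n + r - a. c a b * m (a, b) z)"
    proof
      fix z
      show "rs F z = (\<Sum>a<r. \<Sum>b\<le>n + r - a. c a b * m (a, b) z)"
        by (cases "z \<in> Z") (simp_all add: rs_def h(2) c m_def sum_distrib_left mult_ac)
    qed
    ultimately show ?thesis by simp
  qed
  ultimately show ?thesis using that[of "m ` ?I"] by blast
qed

text \<open>
  In large degree there are more products \<open>Q\<^sup>i y2\<^sup>b y3\<^sup>c\<close> than the space \<open>low\<close> has dimensions. In a relation
  between them, cancelling the lowest power of \<open>Q\<close> leaves a multiple of \<open>Q\<close> that is a form in
  \<open>y2, y3\<close> on the curve.
\<close>

lemma elimination:
  assumes r: "r > 0"
    and fs: "\<And>a. a \<le> r \<Longrightarrow> pol {y2, y3} (r + s - a) (fs a)"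
    and rel: "\<And>z. z \<in> Z \<Longrightarrow> (\<Sum>a\<le>r. y1 z ^ a * fs a z) = 0"
    and nzr: "nz (fs r)"
    and Q: "pol {y1, y2, y3} (Suc m) Q" "nz Q"
    and P: "pol {y1, y2, y3} (Suc (Suc m)) P"
    and QP: "\<And>z. z \<in> Z \<Longrightarrow> x0 z * Q z = P z"
  obtains \<delta> D \<alpha> u where "pol {y2, y3} \<delta> D" "D u \<noteq> 0" "pol {y1, y2, y3} (Suc \<delta>) \<alpha>"
    "\<And>z. z \<in> Z \<Longrightarrow> D z * x0 z = \<alpha> z"
proof -
  define M where "M = Suc m"
  \<comment> \<open>The exponent of \<open>Q\<close> is at most \<open>J\<close> while the total
    degree is \<open>T = 2 J M\<close>. So at least \<open>J M\<close> of the degree remains for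
    \<open>y2, y3\<close>, and there are \<open>(J + 1) (J M + 1)\<close> products. \<open>J\<close>
    is large enough for this to exceed the bound of \<open>low_span\<close>.\<close>
  define J where "J = 2 * r * Suc s + r * (r + 1)"
  define T where "T = 2 * J * M"
  define I where "I = {..J} \<times> {..J * M}"
  define mon where "mon i b z = y2 z ^ b * y3 z ^ ((2 * J - i) * M - b)" for i b z
  define \<phi> where "\<phi> = (\<lambda>(i, b). rs (\<lambda>z. y2 z ^ r * fs r z ^ T * (Q z ^ i * mon i b z)))"
  have fr: "pol {y2, y3} s (fs r)" using fs[of r] by simp
  have frf: "fs r \<in> forms s" by (rule pol_forms[OF fr]) simp
  have Qf: "Q \<in> forms M" unfolding M_def by (rule pol_forms[OF Q(1)]) simp
  have mon: "pol {y2, y3} ((2 * J - i) * M) (mon i b)" if "i \<le> J" "b \<le> J * M" for i b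
  proof -
    have "J * M \<le> (2 * J - i) * M" using that by (intro mult_right_mono) auto
    then have "(2 * J - i) * M = b + ((2 * J - i) * M - b)" using that(2) by linarith
    then show ?thesis unfolding mon_def
      by (intro pol_mult'[OF pol_power_var pol_power_var]) auto
  qed
  have dT: "i * M + (2 * J - i) * M = T" if "i \<le> J" for i
    unfolding T_def add_mult_distrib[symmetric] using that by simp
  obtain Y where Y: "finite Y" "card Y \<le> r * (T * Suc s + r + 1)" "\<And>F. low r (T * Suc s) F \<Longrightarrow> rs F \<in> cfun.span Y"
    using low_span by blast
  have "r * (T * Suc s + r + 1) < card I"
  proof -
    have "r * (T * Suc s + r + 1) = (2 * r * Suc s) * (J * M) + r * (r + 1)"
      by (simp add: T_def algebra_simps)
    also have "\<dots> \<le> J * (J * M) + J"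
      by (intro add_mono mult_right_mono) (auto simp: J_def)
    also have "\<dots> < (J + 1) * (J * M + 1)" by (simp add: algebra_simps)
    also have "\<dots> = card I" by (simp add: I_def)
    finally show ?thesis .
  qed
  with Y(2) have card: "card Y < card I" by simp
  have "\<phi> x \<in> cfun.span Y" if "x \<in> I" for x
  proof -
    obtain i b where x: "x = (i, b)" "i \<le> J" "b \<le> J * M" using \<open>x \<in> I\<close> unfolding I_def by blast
    have "pol {y1, y2, y3} (i * M) (\<lambda>z. Q z ^ i)" unfolding M_def by (rule pol_power[OF Q(1)])
    moreover have "pol {y1, y2, y3} ((2 * J - i) * M) (mon i b)"
      by (rule pol_mono[OF mon[OF x(2,3)]]) auto
    ultimately have N: "pol {y1, y2, y3} T (\<lambda>z. Q z ^ i * mon i b z)"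
      by (rule pol_mult') (simp add: dT[OF x(2)])
    have "low r (T * Suc s) (\<lambda>z. y2 z ^ r * fs r z ^ T * (Q z ^ i * mon i b z))"
      by (rule low_step[where fs = fs, OF r _ _ N]) (use fs rel in auto)
    then show ?thesis using Y(3) by (simp add: \<phi>_def x)
  qed
  moreover have "finite I" by (simp add: I_def)
  ultimately obtain c where c: "\<exists>x\<in>I. c x \<noteq> 0" "\<And>z. (\<Sum>x\<in>I. c x * \<phi> x z) = 0"
    using cfun_pigeonhole[of I Y \<phi>] card Y(1) by blast
  define D where "D i z = (\<Sum>b\<le>J * M. c (i, b) * mon i b z)" for i z
  have D: "pol {y2, y3} ((2 * J - i) * M) (D i)" if "i \<le> J" for i
    unfolding D_def by (intro pol_sum pol_scale mon that) simp
  have Df: "D i \<in> forms ((2 * J - i) * M)" if "i \<le> J" for i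
    by (rule pol_forms[OF D[OF that]]) simp
  have QD: "(\<lambda>z. Q z ^ n * D i z) \<in> forms (n * M + (2 * J - i) * M)" if "i \<le> J" for i n
    by (intro forms_mult forms_power Qf Df that)
  have zero1: "(\<Sum>i\<le>J. Q z ^ i * D i z) = 0" if z: "z \<in> Z" for z
  proof (rule cancel[OF _ _ _ _ z])
    show "(\<lambda>z. y2 z ^ r * fs r z ^ T) \<in> forms (r + T * s)"
      by (intro forms_mult forms_power1 lin forms_power frf)
    show "nz (\<lambda>z. y2 z ^ r * fs r z ^ T)"
      by (rule nz_mult[OF forms_power1[OF lin(3)] forms_power[OF frf] nz_power[OF lin(3) nz_y2] nz_power[OF frf nzr]])
    show "(\<lambda>z. \<Sum>i\<le>J. Q z ^ i * D i z) \<in> forms T"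
    proof (rule forms_sum)
      fix i assume "i \<in> {..J}"
      then show "(\<lambda>z. Q z ^ i * D i z) \<in> forms T" using QD[of i i] dT[of i] by simp
    qed
  next
    fix z assume z: "z \<in> Z"
    have "(y2 z ^ r * fs r z ^ T) * (\<Sum>i\<le>J. Q z ^ i * D i z) =
        (\<Sum>i\<le>J. \<Sum>b\<le>J * M. c (i, b) * (y2 z ^ r * fs r z ^ T * (Q z ^ i * mon i b z)))"
      by (simp add: D_def sum_distrib_left mult_ac)
    also have "\<dots> = (\<Sum>x\<in>I. c x * \<phi> x z)"
      unfolding I_def sum.cartesian_product by (rule sum.cong) (auto simp: \<phi>_def rs_def z)
    finally show "(y2 z ^ r * fs r z ^ T) * (\<Sum>i\<le>J. Q z ^ i * D i z) = 0" using c(2) by simp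
  qed
  define i0 where "i0 = (LEAST i. i \<le> J \<and> (\<exists>b\<le>J * M. c (i, b) \<noteq> 0))"
  have ex: "\<exists>i. i \<le> J \<and> (\<exists>b\<le>J * M. c (i, b) \<noteq> 0)" using c(1) unfolding I_def by auto
  from LeastI_ex[OF ex] obtain b0 where i0: "i0 \<le> J" "b0 \<le> J * M" "c (i0, b0) \<noteq> 0"
    unfolding i0_def by blast
  have below: "D i z = 0" if "i < i0" for i z
  proof -
    have "i \<le> J" using that i0 by simp
    then have "c (i, b) = 0" if "b \<le> J * M" for b
      using not_less_Least[of i "\<lambda>i. i \<le> J \<and> (\<exists>b\<le>J * M. c (i, b) \<noteq> 0)"] \<open>i < i0\<close> that
      unfolding i0_def by blast
    then show ?thesis unfolding D_def by simp
  qed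
  define K where "K z = (\<Sum>i\<in>{Suc i0..J}. Q z ^ (i - Suc i0) * D i z)" for z
  have zero2: "D i0 z + Q z * K z = 0" if z: "z \<in> Z" for z
  proof (rule cancel[OF _ _ _ _ z])
    show "(\<lambda>z. Q z ^ i0) \<in> forms (i0 * M)" by (rule forms_power[OF Qf])
    show "nz (\<lambda>z. Q z ^ i0)" by (rule nz_power[OF Qf Q(2)])
    show "(\<lambda>z. D i0 z + Q z * K z) \<in> forms ((2 * J - i0) * M)"
      unfolding K_def sum_distrib_left
    proof (intro forms_add forms_sum Df i0)
      fix i assume i: "i \<in> {Suc i0..J}"
      have a: "(\<lambda>z. Q z ^ (i - i0) * D i z) \<in> forms ((i - i0) * M + (2 * J - i) * M)"
        by (rule QD) (use i in simp)
      have b: "(i - i0) * M + (2 * J - i) * M = (2 * J - i0) * M"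
        unfolding add_mult_distrib[symmetric] using i i0 by simp
      have c: "Q z * (Q z ^ (i - Suc i0) * D i z) = Q z ^ (i - i0) * D i z" for z
      proof -
        have "i - i0 = Suc (i - Suc i0)" using i by (auto simp: Suc_diff_Suc)
        then show ?thesis by simp
      qed
      show "(\<lambda>z. Q z * (Q z ^ (i - Suc i0) * D i z)) \<in> forms ((2 * J - i0) * M)"
        using a by (simp only: b c)
    qed
  next
    fix z assume z: "z \<in> Z"
    have "(\<Sum>i\<le>J. Q z ^ i * D i z) = (\<Sum>i\<in>{i0..J}. Q z ^ i * D i z)"
      by (rule sum.mono_neutral_right) (auto simp: below)
    also have "\<dots> = Q z ^ i0 * D i0 z + (\<Sum>i\<in>{Suc i0..J}. Q z ^ i * D i z)"
      using i0 by (simp add: sum.atLeast_Suc_atMost)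
    also have "(\<Sum>i\<in>{Suc i0..J}. Q z ^ i * D i z) = Q z ^ i0 * (Q z * K z)"
      unfolding K_def sum_distrib_left
    proof (rule sum.cong)
      fix i assume "i \<in> {Suc i0..J}"
      then have "i = i0 + Suc (i - Suc i0)" by simp
      then have "Q z ^ i = Q z ^ i0 * (Q z * Q z ^ (i - Suc i0))" by (metis power_add power_Suc)
      then show "Q z ^ i * D i z = Q z ^ i0 * (Q z * (Q z ^ (i - Suc i0) * D i z))" by (simp add: mult_ac)
    qed simp
    finally show "Q z ^ i0 * (D i0 z + Q z * K z) = 0" using zero1[OF z] by (simp add: distrib_left)
  qed
  define \<delta> where "\<delta> = (2 * J - i0) * M"
  \<comment> \<open>On the curve \<open>D i0\<close> is \<open>- Q K\<close>. In its product with
    \<open>x0\<close> the factor \<open>x0 Q\<close> is replaced by \<open>P\<close>, which removes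
    \<open>x0\<close> from the right-hand side.\<close>
  have "pol {y1, y2, y3} (Suc \<delta>) (\<lambda>z. - (\<Sum>i\<in>{Suc i0..J}. P z * (Q z ^ (i - Suc i0) * D i z)))"
  proof (intro pol_uminus pol_sum)
    fix i assume i: "i \<in> {Suc i0..J}"
    have "pol {y1, y2, y3} ((2 * J - i) * M) (D i)" by (rule pol_mono[OF D]) (use i in auto)
    moreover have "Suc \<delta> = Suc (Suc m) + ((i - Suc i0) * Suc m + (2 * J - i) * M)"
    proof -
      have "2 * J - i0 = Suc (i - Suc i0) + (2 * J - i)" using i i0 by auto
      then have "\<delta> = (Suc (i - Suc i0) + (2 * J - i)) * M" unfolding \<delta>_def by (simp only:)
      then show ?thesis by (simp add: M_def algebra_simps)
    qed
    ultimately show "pol {y1, y2, y3} (Suc \<delta>) (\<lambda>z. P z * (Q z ^ (i - Suc i0) * D i z))"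
      by (intro pol_mult'[OF P pol_mult[OF pol_power[OF Q(1)]]])
  qed
  moreover have "D i0 z * x0 z = - (\<Sum>i\<in>{Suc i0..J}. P z * (Q z ^ (i - Suc i0) * D i z))" if "z \<in> Z" for z
  proof -
    have "D i0 z = - (Q z * K z)" using zero2[OF that] by (simp add: eq_neg_iff_add_eq_0)
    then have "D i0 z * x0 z = - ((x0 z * Q z) * K z)" by simp
    then show ?thesis unfolding QP[OF that] K_def by (simp add: sum_distrib_left)
  qed
  \<comment> \<open>On the vectors \<open>t *s e2 + e3\<close> the function \<open>D i0\<close> is a
    polynomial in \<open>t\<close> with the coefficients \<open>c (i0, b)\<close>, one of which is
    nonzero.\<close>
  moreover have "\<exists>u. D i0 u \<noteq> 0"
  proof -
    have "finite {t. (\<Sum>b\<le>J * M. c (i0, b) * t ^ b) = 0}"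
      by (rule finite_poly_zeros[of b0]) (use i0 in auto)
    then have "{t. (\<Sum>b\<le>J * M. c (i0, b) * t ^ b) = 0} \<noteq> UNIV"
      using infinite_UNIV_char_0[where 'a = complex] by metis
    then obtain t where t: "(\<Sum>b\<le>J * M. c (i0, b) * t ^ b) \<noteq> 0" by blast
    have v: "l (t *s e2 + e3) = t * l e2 + l e3" if "l \<in> forms 1" for l
      using that by (simp add: forms1_add forms1_smult)
    have "D i0 (t *s e2 + e3) = (\<Sum>b\<le>J * M. c (i0, b) * t ^ b)"
      unfolding D_def mon_def by (simp add: v[OF lin(3)] v[OF lin(4)] dual)
    then show ?thesis using t by metis
  qed
  moreover have "pol {y2, y3} \<delta> (D i0)" unfolding \<delta>_def by (rule D[OF i0(1)])
  ultimately show ?thesis using that by blast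
qed

lemma rs_span: "F \<in> cfun.span Y \<Longrightarrow> rs F \<in> cfun.span (rs ` Y)"
proof (induction rule: cfun_span_induct)
  case (base f)
  then show ?case by (intro cfun.span_base imageI)
next
  case zero
  show ?case using cfun_span_zero[of "rs ` Y"] by (simp add: rs_def)
next
  case (add f g)
  have "rs (\<lambda>x. f x + g x) = (\<lambda>x. rs f x + rs g x)" by (auto simp: rs_def)
  then show ?case using cfun_span_add[OF add] by simp
next
  case (scale c f)
  have "rs (\<lambda>x. c * f x) = (\<lambda>x. c * rs f x)" by (auto simp: rs_def)
  then show ?case using cfun_span_scale[OF scale] by simp
qed

lemma mult_span: "F \<in> cfun.span Y \<Longrightarrow> (\<lambda>z. l z * F z) \<in> cfun.span ((\<lambda>b z. l z * b z) ` Y)"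
proof (induction rule: cfun_span_induct)
  case (base f)
  then show ?case by (intro cfun.span_base) auto
next
  case zero
  show ?case using cfun_span_zero by simp
next
  case (add f g)
  from cfun_span_add[OF add] show ?case by (simp add: distrib_left)
next
  case (scale c f)
  from cfun_span_scale[OF scale, of c] show ?case by (simp add: mult.left_commute)
qed

end

section \<open>The degree as a lower bound for the dimension of plane sections\<close>

text \<open>The degree enters through \<open>d\<close> points of one plane section; that they are
  distinct is expressed by linear forms separating them.\<close>

locale sectioned_curve = curve_frame +
  fixes d :: nat and \<alpha> :: cfun and pts :: "nat \<Rightarrow> vec4"
  assumes \<alpha>: "\<alpha> \<in> forms 1" "\<exists>z\<in>Z. \<alpha> z \<noteq> 0"
    and pts: "\<And>i. i < d \<Longrightarrow> pts i \<in> Z" "\<And>i. i < d \<Longrightarrow> pts i \<noteq> 0" "\<And>i. i < d \<Longrightarrow> \<alpha> (pts i) = 0"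
    and sep: "\<And>i j. i < d \<Longrightarrow> j < d \<Longrightarrow> i \<noteq> j \<Longrightarrow> \<exists>l\<in>forms 1. l (pts i) \<noteq> 0 \<and> l (pts j) = 0"
begin

lemma nz_\<alpha>: "nz \<alpha>"
  using \<alpha>(2) unfolding nz_def .

text \<open>The product of the separating linear forms, filled up to degree \<open>k\<close> by a
  power of a coordinate that is nonzero at the point.\<close>

lemma separating_form:
  assumes "i < d" "k \<ge> d"
  obtains h where "h \<in> forms k" "h (pts i) \<noteq> 0" "\<And>j. j < d \<Longrightarrow> j \<noteq> i \<Longrightarrow> h (pts j) = 0"
proof -
  have "\<forall>j. \<exists>l. j < d \<and> j \<noteq> i \<longrightarrow> l \<in> forms 1 \<and> l (pts i) \<noteq> 0 \<and> l (pts j) = 0"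
    using sep[OF assms(1)] by metis
  then obtain l where l: "\<And>j. j < d \<Longrightarrow> j \<noteq> i \<Longrightarrow> l j \<in> forms 1 \<and> l j (pts i) \<noteq> 0 \<and> l j (pts j) = 0" by metis
  obtain n where n: "pts i $ n \<noteq> 0" using pts(2)[OF assms(1)] by (metis vec_eq_iff zero_index)
  let ?I = "{..<d} - {i}"
  let ?h = "\<lambda>z. (\<Prod>j\<in>?I. l j z) * (z $ n) ^ (k - card ?I)"
  have c: "card ?I \<le> k" using card_Diff1_le[of "{..<d}" i] assms(2) by simp
  have "(\<lambda>z. \<Prod>j\<in>?I. l j z) \<in> forms (\<Sum>j\<in>?I. 1)"
    unfolding forms_iff by (rule pol_prod) (use l in \<open>auto simp: forms_iff\<close>)
  moreover have "(\<lambda>z. (z $ n) ^ (k - card ?I)) \<in> forms (k - card ?I)"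
    unfolding forms_iff by (rule pol_power_var) (simp add: crd_def)
  ultimately have "?h \<in> forms k" by (rule forms_mult') (use c in simp)
  moreover have "?h (pts i) \<noteq> 0" using l n by simp
  moreover have "?h (pts j) = 0" if "j < d" "j \<noteq> i" for j
    using l[OF that] that by auto
  ultimately show ?thesis using that by blast
qed

text \<open>
  The quotients of the coordinate ring by \<open>\<alpha>\<close> and by \<open>l\<close> have the same dimension in each
  degree, and the former is at least \<open>d\<close>, as seen by evaluating at the \<open>d\<close> points.
\<close>

lemma section_dimension:
  assumes Xs: "finite Xs" "card Xs < d" and K: "K \<ge> d"
    and span: "\<And>F. F \<in> forms (Suc K) \<Longrightarrow> \<exists>A\<in>forms K. \<exists>S\<in>cfun.span Xs. \<forall>z\<in>Z. F z = l z * A z + S z"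
  shows False
proof -
  obtain Y where Y: "finite Y" "forms K = cfun.span Y" using forms_finite_span by blast
  have sub: "rs ` forms K \<subseteq> cfun.span (rs ` Y)" using rs_span Y(2) by blast
  obtain B where B: "B \<subseteq> rs ` forms K" "finite B" "cfun.independent B" "rs ` forms K \<subseteq> cfun.span B"
    by (rule cfun_basis[OF sub finite_imageI[OF Y(1)]])
  have "\<forall>i. \<exists>h. i < d \<longrightarrow> h \<in> forms (Suc K) \<and> h (pts i) \<noteq> 0 \<and> (\<forall>j<d. j \<noteq> i \<longrightarrow> h (pts j) = 0)"
    using separating_form[of _ "Suc K"] K by (metis le_SucI)
  then obtain h where h: "\<And>i. i < d \<Longrightarrow> h i \<in> forms (Suc K)" "\<And>i. i < d \<Longrightarrow> h i (pts i) \<noteq> 0"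
    "\<And>i j. i < d \<Longrightarrow> j < d \<Longrightarrow> j \<noteq> i \<Longrightarrow> h i (pts j) = 0" by metis
  \<comment> \<open>The family consists of \<open>\<alpha>\<close> times a basis of degree
    \<open>K\<close> and of the \<open>d\<close> forms \<open>h i\<close>. It lies in the span of
    \<open>l\<close> times the same basis and of \<open>Xs\<close>, which has fewer generators. The
    resulting relation is refuted by evaluating at the points and then cancelling
    \<open>\<alpha>\<close>.\<close>
  define I where "I = B <+> {..<d}"
  define \<phi> where "\<phi> = (\<lambda>x. case x of Inl b \<Rightarrow> (\<lambda>z. \<alpha> z * b z) | Inr i \<Rightarrow> rs (h i))"
  define W where "W = (\<lambda>b z. l z * b z) ` B \<union> rs ` Xs"
  have fW: "finite W" using B Xs by (simp add: W_def)
  have "card W \<le> card B + card Xs"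
    unfolding W_def using B Xs
    by (intro order.trans[OF card_Un_le] add_mono card_image_le)
  moreover have "card I = card B + d" unfolding I_def using B(2) by (simp add: card_Plus)
  ultimately have card: "card W < card I" using Xs by simp
  have sp: "rs F \<in> cfun.span W" if "F \<in> forms (Suc K)" for F
  proof -
    obtain A S where A: "A \<in> forms K" "S \<in> cfun.span Xs" "\<And>z. z \<in> Z \<Longrightarrow> F z = l z * A z + S z"
      using span[OF \<open>F \<in> forms (Suc K)\<close>] by blast
    have "rs A \<in> cfun.span B" using A(1) B(4) by blast
    then have "(\<lambda>z. l z * rs A z) \<in> cfun.span W"
      using mult_span cfun.span_mono[of "(\<lambda>b z. l z * b z) ` B" W] unfolding W_def by blast
    moreover have "rs S \<in> cfun.span W"
      using rs_span[OF A(2)] cfun.span_mono[of "rs ` Xs" W] unfolding W_def by blast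
    ultimately have "(\<lambda>z. l z * rs A z + rs S z) \<in> cfun.span W" by (rule cfun_span_add)
    moreover have "rs F = (\<lambda>z. l z * rs A z + rs S z)" by (auto simp: rs_def A(3))
    ultimately show ?thesis by simp
  qed
  have "\<phi> x \<in> cfun.span W" if "x \<in> I" for x
  proof (cases x)
    case (Inl b)
    then obtain b' where b': "b = rs b'" "b' \<in> forms K" using \<open>x \<in> I\<close> B(1) unfolding I_def by blast
    have "(\<lambda>z. \<alpha> z * b' z) \<in> forms (Suc K)" by (rule forms_mult'[OF \<alpha>(1) b'(2)]) simp
    moreover have "\<phi> x = rs (\<lambda>z. \<alpha> z * b' z)" by (auto simp: \<phi>_def Inl b' rs_def)
    ultimately show ?thesis using sp by simp
  next
    case (Inr i)
    then have "i < d" using that unfolding I_def by auto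
    then show ?thesis using sp[OF h(1)] by (simp add: \<phi>_def Inr)
  qed
  moreover have "finite I" unfolding I_def using B(2) by simp
  ultimately obtain c where c: "\<exists>x\<in>I. c x \<noteq> 0" "\<And>z. (\<Sum>x\<in>I. c x * \<phi> x z) = 0"
    using cfun_pigeonhole[of I W \<phi>] card fW by blast
  have c2: "(\<Sum>b\<in>B. c (Inl b) * (\<alpha> z * b z)) + (\<Sum>i<d. c (Inr i) * rs (h i) z) = 0" for z
    using c(2)[of z] B(2) unfolding I_def by (simp add: sum.Plus \<phi>_def)
  have cr: "c (Inr i) = 0" if i: "i < d" for i
  proof -
    have "(\<Sum>j<d. c (Inr j) * rs (h j) (pts i)) = (\<Sum>j\<in>{i}. c (Inr j) * rs (h j) (pts i))"
      by (rule sum.mono_neutral_right) (use i h pts in \<open>auto simp: rs_def\<close>)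
    then have "c (Inr i) * h i (pts i) = 0"
      using c2[of "pts i"] pts i by (simp add: rs_def)
    then show ?thesis using h(2)[OF i] by simp
  qed
  then have c3: "\<alpha> z * (\<Sum>b\<in>B. c (Inl b) * b z) = 0" for z
    using c2[of z] by (simp add: sum_distrib_left mult.left_commute)
  have "\<forall>b. \<exists>b'. b \<in> B \<longrightarrow> b' \<in> forms K \<and> b = rs b'" using B(1) by blast
  then obtain b' where b': "\<And>b. b \<in> B \<Longrightarrow> b' b \<in> forms K" "\<And>b. b \<in> B \<Longrightarrow> b = rs (b' b)" by metis
  have bz: "b z = (if z \<in> Z then b' b z else 0)" if "b \<in> B" for b z
    using b'(2)[OF that] by (metis rs_def)
  have "(\<Sum>b\<in>B. c (Inl b) * b' b z) = 0" if "z \<in> Z" for z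
  proof (rule cancel[OF \<alpha>(1) _ nz_\<alpha> _ that])
    show "(\<lambda>z. \<Sum>b\<in>B. c (Inl b) * b' b z) \<in> forms K" by (intro forms_sum forms_scale b')
    fix z assume "z \<in> Z"
    then show "\<alpha> z * (\<Sum>b\<in>B. c (Inl b) * b' b z) = 0" using c3[of z] by (simp add: bz)
  qed
  then have "(\<Sum>b\<in>B. c (Inl b) * b z) = 0" for z
    by (cases "z \<in> Z") (simp_all add: bz)
  then have "c (Inl b) = 0" if "b \<in> B" for b
    using cfun_independentD[OF B(3,2) _ that, of "\<lambda>b. c (Inl b)"] by simp
  then show False using c(1) cr unfolding I_def by auto
qed

end

section \<open>Elimination of \<open>x0\<close> and \<open>y1\<close> modulo a plane through the
  tangent line\<close>

context curve_frame
begin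

text \<open>On the curve \<open>x0\<close> is \<open>\<alpha> / D\<close>, and modulo the plane
  \<open>D\<close> is a constant times \<open>y2 ^ \<delta>\<close>; so \<open>\<delta>\<close>
  factors \<open>y2\<close> remove one \<open>x0\<close>. The other variables receive the same
  factors to keep the degree uniform. The one extra \<open>y2\<close> is that of
  \<open>pol_Y2_scale\<close>.\<close>

lemma eliminate_x0:
  assumes D: "pol {y2, y3} \<delta> D" and c: "D (e2 + \<mu> *s e3) \<noteq> 0"
    and \<alpha>: "pol {y1, y2, y3} (Suc \<delta>) \<alpha>" "\<And>z. z \<in> Z \<Longrightarrow> D z * x0 z = \<alpha> z"
    and B: "B \<in> forms j"
  shows "\<exists>M. pol {y1, y2, y3} (\<delta> * j + j + 1) M \<and> eqL \<mu> (\<delta> * j + j) (\<lambda>z. y2 z ^ (\<delta> * j + 1) * B z) M"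
proof -
  let ?c = "D (e2 + \<mu> *s e3)"
  have sub: "{y1, y2, y3} \<subseteq> {x0, y1, y2, y3}" by blast
  have "pol {x0, y1, y2, y3} j B" using B by (simp add: forms_pol_iff)
  then show ?thesis
  proof (induction rule: pol.induct)
    case (pol_const c)
    have "pol {y1, y2, y3} 1 (\<lambda>z. c * y2 z)" by (intro pol_scale pol_var) simp
    then show ?case by (intro exI[of _ "\<lambda>z. c * y2 z"]) (auto intro: eqL_refl)
  next
    case (pol_zero k)
    show ?case by (intro exI[of _ "\<lambda>_. 0"]) (auto intro: eqL_refl pol.pol_zero)
  next
    case (pol_times l k f)
    from pol_times(3) obtain M where M: "pol {y1, y2, y3} (\<delta> * k + k + 1) M"
      "eqL \<mu> (\<delta> * k + k) (\<lambda>z. y2 z ^ (\<delta> * k + 1) * f z) M" by blast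
    have Mf: "M \<in> forms (\<delta> * k + k + 1)" by (rule pol_forms[OF M(1) sub])
    show ?case
    proof (cases "l = x0")
      case False
      then have l: "l \<in> {y1, y2, y3}" using pol_times(1) by blast
      then have lf: "l \<in> forms 1" using lin by blast
      have P: "pol {y1, y2, y3} (\<delta> * Suc k + Suc k + 1) (\<lambda>z. y2 z ^ \<delta> * (l z * M z))"
      proof (rule pol_mult'[OF pol_power_var])
        show "pol {y1, y2, y3} (Suc (\<delta> * k + k + 1)) (\<lambda>z. l z * M z)" by (rule pol.pol_times[OF l M(1)])
      qed auto
      have "eqL \<mu> (\<delta> * k + k + (\<delta> + 1)) (\<lambda>z. (y2 z ^ (\<delta> * k + 1) * f z) * (y2 z ^ \<delta> * l z)) (\<lambda>z. M z * (y2 z ^ \<delta> * l z))"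
        by (intro eqL_mult[OF M(2)] forms_mult forms_power1 lin lf)
      then have "eqL \<mu> (\<delta> * Suc k + Suc k) (\<lambda>z. (y2 z ^ (\<delta> * k + 1) * f z) * (y2 z ^ \<delta> * l z)) (\<lambda>z. M z * (y2 z ^ \<delta> * l z))"
        by (simp add: algebra_simps)
      then have "eqL \<mu> (\<delta> * Suc k + Suc k) (\<lambda>z. y2 z ^ (\<delta> * Suc k + 1) * (l z * f z)) (\<lambda>z. y2 z ^ \<delta> * (l z * M z))"
        by (rule eqL_cong) (simp_all add: power_add mult_ac)
      with P show ?thesis by blast
    next
      case True
      define M' where "M' z = inverse ?c * (\<alpha> z * M z)" for z
      have P: "pol {y1, y2, y3} (\<delta> * Suc k + Suc k + 1) M'"
        unfolding M'_def by (intro pol_scale pol_mult'[OF \<alpha>(1) M(1)]) simp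
      have Df: "D \<in> forms \<delta>" by (rule pol_forms[OF D]) simp
      have ff: "f \<in> forms k" using pol_times(2) forms_pol_iff by blast
      have ix: "\<delta> * Suc k + Suc k = \<delta> + (\<delta> * k + 1 + k)" by simp
      have 0: "eqL \<mu> (\<delta> * Suc k + Suc k) (\<lambda>z. D z * y2 z * (y2 z ^ (\<delta> * k) * (x0 z * f z)))
          (\<lambda>z. ?c * y2 z ^ Suc \<delta> * (y2 z ^ (\<delta> * k) * (x0 z * f z)))"
      proof -
        have "(\<lambda>z. y2 z ^ (\<delta> * k) * (x0 z * f z)) \<in> forms (\<delta> * k + (1 + k))"
          by (intro forms_mult forms_power1 lin ff)
        from eqL_mult[OF pol_Y2_scale[OF D] this]
        show ?thesis by (simp add: algebra_simps)
      qed
      have 1: "eqL \<mu> (\<delta> * Suc k + Suc k) (\<lambda>z. (y2 z ^ (\<delta> * k + 1) * f z) * \<alpha> z) (\<lambda>z. M z * \<alpha> z)"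
      proof -
        have "\<alpha> \<in> forms (Suc \<delta>)" by (rule pol_forms[OF \<alpha>(1) sub])
        from eqL_mult[OF M(2) this] show ?thesis by (simp add: algebra_simps)
      qed
      have "eqL \<mu> (\<delta> * Suc k + Suc k) (\<lambda>z. ?c * (y2 z ^ (\<delta> * Suc k + 1) * (l z * f z))) (\<lambda>z. M z * \<alpha> z)"
      proof (rule eqL_trans)
        show "eqL \<mu> (\<delta> * Suc k + Suc k) (\<lambda>z. ?c * (y2 z ^ (\<delta> * Suc k + 1) * (l z * f z)))
          (\<lambda>z. (y2 z ^ (\<delta> * k + 1) * f z) * \<alpha> z)"
          by (rule eqL_cong[OF eqL_sym[OF 0]])
            (simp_all add: True power_add mult_ac \<alpha>(2)[symmetric])
      qed (rule 1)
      from eqL_scale[OF this, of "inverse ?c"]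
      have "eqL \<mu> (\<delta> * Suc k + Suc k) (\<lambda>z. y2 z ^ (\<delta> * Suc k + 1) * (l z * f z)) M'"
        by (rule eqL_cong) (use c in \<open>simp_all add: M'_def mult_ac\<close>)
      with P show ?thesis by blast
    qed
  next
    case (pol_plus k f f')
    from pol_plus(3) obtain M where M: "pol {y1, y2, y3} (\<delta> * k + k + 1) M"
      "eqL \<mu> (\<delta> * k + k) (\<lambda>z. y2 z ^ (\<delta> * k + 1) * f z) M" by blast
    from pol_plus(4) obtain M' where M': "pol {y1, y2, y3} (\<delta> * k + k + 1) M'"
      "eqL \<mu> (\<delta> * k + k) (\<lambda>z. y2 z ^ (\<delta> * k + 1) * f' z) M'" by blast
    have "eqL \<mu> (\<delta> * k + k) (\<lambda>z. y2 z ^ (\<delta> * k + 1) * (f z + f' z)) (\<lambda>z. M z + M' z)"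
      using eqL_add[OF M(2) M'(2)] by (simp add: distrib_left)
    with pol.pol_plus[OF M(1) M'(1)] show ?case by blast
  qed
qed

text \<open>Pseudo-division leaves exponents of \<open>y1\<close> below \<open>r\<close>. Modulo the
  plane every form in \<open>y2, y3\<close>, the denominator \<open>fs r\<close> included, is a
  constant times a power of \<open>y2\<close>; so one monomial remains for each power of
  \<open>y1\<close>.\<close>

lemma eliminate_y1:
  assumes r: "r > 0"
    and fs: "\<And>a. a \<le> r \<Longrightarrow> pol {y2, y3} (r + s - a) (fs a)"
    and rel: "\<And>z. z \<in> Z \<Longrightarrow> (\<Sum>a\<le>r. y1 z ^ a * fs a z) = 0"
    and c: "fs r (e2 + \<mu> *s e3) \<noteq> 0"
    and M: "pol {y1, y2, y3} (Suc n) M"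
  shows "\<exists>c. eqL \<mu> (n + Suc n * Suc s + r) (\<lambda>z. y2 z ^ (Suc n * Suc s + r) * M z)
     (\<lambda>z. \<Sum>a<r. c a * (y1 z ^ a * y2 z ^ (Suc (n + Suc n * Suc s + r) - a)))"
proof -
  let ?c = "fs r (e2 + \<mu> *s e3)" and ?N = "n + Suc n * Suc s + r"
  have "low r (Suc n * Suc s) (\<lambda>z. y2 z ^ r * fs r z ^ Suc n * M z)"
    by (rule low_step[where fs = fs, OF r _ _ M]) (use fs rel in auto)
  then obtain h where h: "\<And>a. a < r \<Longrightarrow> pol {y2, y3} (Suc n * Suc s + r - a) (h a)"
    "\<And>z. z \<in> Z \<Longrightarrow> y2 z ^ r * fs r z ^ Suc n * M z = (\<Sum>a<r. y1 z ^ a * h a z)"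
    unfolding low_def by blast
  have fr: "pol {y2, y3} s (fs r)" using fs[of r] by simp
  have Mf: "M \<in> forms (Suc n)" by (rule pol_forms[OF M]) blast
  have 1: "eqL \<mu> ?N (\<lambda>z. (y2 z * fs r z) ^ Suc n * (y2 z ^ r * M z)) (\<lambda>z. (?c * y2 z ^ Suc s) ^ Suc n * (y2 z ^ r * M z))"
  proof -
    have "fs r \<in> forms s" by (rule pol_forms[OF fr]) simp
    then have "(\<lambda>z. y2 z * fs r z) \<in> forms (Suc s)" by (rule forms_mult'[OF lin(3)]) simp
    moreover have "(\<lambda>z. ?c * y2 z ^ Suc s) \<in> forms (Suc s)" by (intro forms_scale forms_power1 lin)
    ultimately have "eqL \<mu> (n * Suc s + s) (\<lambda>z. (y2 z * fs r z) ^ Suc n) (\<lambda>z. (?c * y2 z ^ Suc s) ^ Suc n)"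
      by (rule eqL_power[OF pol_Y2_scale[OF fr]])
    moreover have "(\<lambda>z. y2 z ^ r * M z) \<in> forms (r + Suc n)" by (intro forms_mult forms_power1 lin Mf)
    ultimately have "eqL \<mu> (n * Suc s + s + (r + Suc n)) (\<lambda>z. (y2 z * fs r z) ^ Suc n * (y2 z ^ r * M z)) (\<lambda>z. (?c * y2 z ^ Suc s) ^ Suc n * (y2 z ^ r * M z))"
      by (rule eqL_mult)
    moreover have "n * Suc s + s + (r + Suc n) = ?N" by simp
    ultimately show ?thesis by metis
  qed
  have 2: "eqL \<mu> ?N (\<lambda>z. \<Sum>a<r. (y2 z * h a z) * (y1 z ^ a * y2 z ^ n))
     (\<lambda>z. \<Sum>a<r. h a (e2 + \<mu> *s e3) * y2 z ^ Suc (Suc n * Suc s + r - a) * (y1 z ^ a * y2 z ^ n))"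
  proof (rule eqL_sum)
    fix a assume "a \<in> {..<r}"
    then have a: "a < r" by simp
    have "(\<lambda>z. y1 z ^ a * y2 z ^ n) \<in> forms (a + n)" by (intro forms_mult forms_power1 lin)
    from eqL_mult[OF pol_Y2_scale[OF h(1)[OF a]] this]
    have "eqL \<mu> (Suc n * Suc s + r - a + (a + n)) (\<lambda>z. (y2 z * h a z) * (y1 z ^ a * y2 z ^ n))
      (\<lambda>z. h a (e2 + \<mu> *s e3) * y2 z ^ Suc (Suc n * Suc s + r - a) * (y1 z ^ a * y2 z ^ n))" .
    moreover have "Suc n * Suc s + r - a + (a + n) = ?N" using a by simp
    ultimately show "eqL \<mu> ?N (\<lambda>z. (y2 z * h a z) * (y1 z ^ a * y2 z ^ n))
      (\<lambda>z. h a (e2 + \<mu> *s e3) * y2 z ^ Suc (Suc n * Suc s + r - a) * (y1 z ^ a * y2 z ^ n))" by metis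
  qed
  have 3: "(y2 z * fs r z) ^ Suc n * (y2 z ^ r * M z) = (\<Sum>a<r. (y2 z * h a z) * (y1 z ^ a * y2 z ^ n))" if "z \<in> Z" for z
  proof -
    have "(y2 z * fs r z) ^ Suc n * (y2 z ^ r * M z) = y2 z ^ Suc n * (y2 z ^ r * fs r z ^ Suc n * M z)"
      by (simp add: power_mult_distrib mult_ac)
    also have "\<dots> = (\<Sum>a<r. (y2 z * h a z) * (y1 z ^ a * y2 z ^ n))"
      unfolding h(2)[OF that] by (simp add: sum_distrib_left mult_ac)
    finally show ?thesis .
  qed
  have "eqL \<mu> ?N (\<lambda>z. (?c * y2 z ^ Suc s) ^ Suc n * (y2 z ^ r * M z))
     (\<lambda>z. \<Sum>a<r. h a (e2 + \<mu> *s e3) * y2 z ^ Suc (Suc n * Suc s + r - a) * (y1 z ^ a * y2 z ^ n))"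
    by (rule eqL_trans[OF eqL_sym[OF 1]]) (rule eqL_cong[OF 2 3 refl])
  from eqL_scale[OF this, of "inverse (?c ^ Suc n)"]
  have "eqL \<mu> ?N (\<lambda>z. y2 z ^ (Suc n * Suc s + r) * M z)
     (\<lambda>z. \<Sum>a<r. (inverse (?c ^ Suc n) * h a (e2 + \<mu> *s e3)) * (y1 z ^ a * y2 z ^ (Suc ?N - a)))"
  proof (rule eqL_cong)
    fix z
    have "(?c * y2 z ^ Suc s) ^ Suc n = ?c ^ Suc n * y2 z ^ (Suc n * Suc s)"
      by (simp only: power_mult_distrib power_mult[symmetric] mult.commute[of "Suc s"])
    then show "y2 z ^ (Suc n * Suc s + r) * M z = inverse (?c ^ Suc n) * ((?c * y2 z ^ Suc s) ^ Suc n * (y2 z ^ r * M z))"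
      unfolding power_add mult.assoc[symmetric] using c by (simp del: power_Suc)
  next
    fix z
    show "(\<Sum>a<r. (inverse (?c ^ Suc n) * h a (e2 + \<mu> *s e3)) * (y1 z ^ a * y2 z ^ (Suc ?N - a))) =
      inverse (?c ^ Suc n) * (\<Sum>a<r. h a (e2 + \<mu> *s e3) * y2 z ^ Suc (Suc n * Suc s + r - a) * (y1 z ^ a * y2 z ^ n))"
      unfolding sum_distrib_left
    proof (rule sum.cong)
      fix a assume "a \<in> {..<r}"
      then have "Suc ?N - a = Suc (Suc n * Suc s + r - a) + n" by simp
      then have "y2 z ^ (Suc ?N - a) = y2 z ^ Suc (Suc n * Suc s + r - a) * y2 z ^ n" by (simp only: power_add)
      then show "(inverse (?c ^ Suc n) * h a (e2 + \<mu> *s e3)) * (y1 z ^ a * y2 z ^ (Suc ?N - a)) =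
        inverse (?c ^ Suc n) * (h a (e2 + \<mu> *s e3) * y2 z ^ Suc (Suc n * Suc s + r - a) * (y1 z ^ a * y2 z ^ n))"
        by (simp only: mult_ac)
    qed simp
  qed
  then show ?thesis by (rule exI[of _ "\<lambda>a. inverse (?c ^ Suc n) * h a (e2 + \<mu> *s e3)"])
qed

end

text \<open>\<open>P / Q\<close> expresses \<open>x0\<close> on the curve in the coordinates of the
  projection from \<open>e0\<close>; such an expression exists when this projection is
  birational.\<close>

locale projected_curve = sectioned_curve +
  fixes m :: nat and Q P :: cfun
  assumes Q: "pol {y1, y2, y3} (Suc m) Q" "\<exists>z\<in>Z. Q z \<noteq> 0"
    and P: "pol {y1, y2, y3} (Suc (Suc m)) P"
    and QP: "\<And>z. z \<in> Z \<Longrightarrow> x0 z * Q z = P z"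
begin

text \<open>
  A plane curve of degree \<open>d - 1\<close> through the projection and singular at the image of the
  tangent line would meet the lines through that image in at most \<open>d - 3\<close> further
  points, while planes through the tangent line cut \<open>d - 2\<close> further points on the curve.
\<close>

lemma no_singular_equation:
  assumes d: "d \<ge> 3"
    and fs: "\<And>a. a \<le> d - 1 \<Longrightarrow> pol {y2, y3} (d - 1 - a) (fs a)"
    and rel: "\<And>z. z \<in> Z \<Longrightarrow> (\<Sum>a\<le>d - 1. y1 z ^ a * fs a z) = 0"
    and sing: "\<And>a z. d - 2 \<le> a \<Longrightarrow> a \<le> d - 1 \<Longrightarrow> fs a z = 0"
    and a: "a \<le> d - 1"
  shows "fs a z = 0"
proof (rule ccontr)
  assume "fs a z \<noteq> 0"
  define S where "S = {a. a \<le> d - 1 \<and> (\<exists>z. fs a z \<noteq> 0)}"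
  have S: "finite S" "S \<noteq> {}" using \<open>fs a z \<noteq> 0\<close> a by (auto simp: S_def)
  define r where "r = Max S"
  have "r \<in> S" unfolding r_def by (rule Max_in[OF S])
  then obtain u where u: "r \<le> d - 1" "fs r u \<noteq> 0" unfolding S_def by blast
  \<comment> \<open>That the coefficients of \<open>y1 ^ (d - 1)\<close> and
    \<open>y1 ^ (d - 2)\<close> vanish is the singularity at the image of the tangent line; it
    bounds the degree in \<open>y1\<close>.\<close>
  have rd: "r \<le> d - 3" using sing[of r u] u by linarith
  define s where "s = d - 1 - r"
  have rs': "r + s = d - 1" using u by (simp add: s_def)
  have zero: "fs b z = 0" if "r < b" "b \<le> d - 1" for b z
  proof (rule ccontr)
    assume "fs b z \<noteq> 0"
    then have "b \<in> S" using that(2) unfolding S_def by blast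
    then have "b \<le> r" unfolding r_def by (rule Max_ge[OF S(1)])
    then show False using that(1) by simp
  qed
  have fs': "\<And>b. b \<le> r \<Longrightarrow> pol {y2, y3} (r + s - b) (fs b)" using fs u unfolding rs' by auto
  have rel': "(\<Sum>a\<le>r. y1 z ^ a * fs a z) = 0" if "z \<in> Z" for z
  proof -
    have "(\<Sum>a\<le>d - 1. y1 z ^ a * fs a z) = (\<Sum>a\<le>r. y1 z ^ a * fs a z)"
      by (rule sum.mono_neutral_right) (use u zero in auto)
    then show ?thesis using rel[OF that] by simp
  qed
  have fr: "pol {y2, y3} s (fs r)" using fs'[of r] by simp
  have nzr: "nz (fs r)" by (rule nz_pol_Y2[OF fr u(2)])
  have r0: "r > 0"
  proof (rule ccontr)
    assume "\<not> r > 0"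
    then show False using rel' nzr unfolding nz_def by auto
  qed
  obtain \<delta> D \<beta> u' where D: "pol {y2, y3} \<delta> D" "D u' \<noteq> 0" "pol {y1, y2, y3} (Suc \<delta>) \<beta>"
    "\<And>z. z \<in> Z \<Longrightarrow> D z * x0 z = \<beta> z"
    by (rule elimination[where fs = fs, OF r0 _ _ nzr Q(1) _ P QP]) (use fs' rel' Q(2) in \<open>auto simp: nz_def\<close>)
  \<comment> \<open>A general slope avoids the zeros of the two denominators and the osculating
    plane \<open>\<mu> = 0\<close>.\<close>
  have "finite ({\<mu>. fs r (e2 + \<mu> *s e3) = 0} \<union> {\<mu>. D (e2 + \<mu> *s e3) = 0} \<union> {0})"
    using finite_slopes[OF fr u(2)] finite_slopes[OF D(1,2)] by simp
  then have "({\<mu>. fs r (e2 + \<mu> *s e3) = 0} \<union> {\<mu>. D (e2 + \<mu> *s e3) = 0} \<union> {0}) \<noteq> UNIV"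
    using infinite_UNIV_char_0[where 'a = complex] by metis
  then obtain \<mu> where \<mu>: "\<mu> \<noteq> 0" "fs r (e2 + \<mu> *s e3) \<noteq> 0" "D (e2 + \<mu> *s e3) \<noteq> 0" by blast
  obtain k0 where k0: "\<And>j F. j \<ge> k0 \<Longrightarrow> F \<in> forms (Suc j) \<Longrightarrow>
     \<exists>B\<in>forms j. eqL \<mu> (Suc j) (\<lambda>z. y2 z * F z) (\<lambda>z. y2 z ^ 2 * B z)"
    using plane_step[OF \<mu>(1)] by blast
  have one: "(\<lambda>_. 1) \<in> forms 0" by (rule forms_const)
  obtain i0 where i0: "\<And>i F. i \<ge> i0 \<Longrightarrow> F \<in> forms (i + 0 + 2) \<Longrightarrow>
    \<exists>\<alpha> \<beta>. inJ (i + 0 + 1) (\<lambda>z. F z - 1 * (\<alpha> * x0 z ^ (i + 2) + \<beta> * (x0 z ^ (i + 1) * y1 z)))"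
    by (rule tangent_decomposition[OF one]) auto
  \<comment> \<open>\<open>k1\<close> is the degree left by \<open>plane_iterate\<close> and lies
    beyond all bounds found so far. The eliminations of \<open>x0\<close> and \<open>y1\<close>
    together consume \<open>Suc N\<close> factors \<open>y2\<close>; between the two the degree is
    \<open>n + 1\<close>.\<close>
  define k1 where "k1 = k0 + i0 + d + 1"
  define n where "n = \<delta> * k1 + k1"
  define N where "N = \<delta> * k1 + Suc n * Suc s + r"
  define K where "K = k1 + N"
  have Kn: "K = n + Suc n * Suc s + r" by (simp add: K_def N_def n_def)
  \<comment> \<open>Two monomials for the length 2 at \<open>e0\<close> and \<open>r\<close>
    monomials from \<open>eliminate_y1\<close>: at most \<open>2 + (d - 3)\<close> functions span
    the forms modulo the plane, too few for a section with \<open>d\<close> points.\<close>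
  define Xs where "Xs = {\<lambda>z. x0 z ^ Suc K, \<lambda>z. x0 z ^ K * y1 z} \<union> (\<lambda>a z. y1 z ^ a * y2 z ^ (Suc K - a)) ` {..<r}"
  have "card Xs \<le> card {\<lambda>z. x0 z ^ Suc K, \<lambda>z. x0 z ^ K * y1 z} + card ((\<lambda>a z. y1 z ^ a * y2 z ^ (Suc K - a)) ` {..<r})"
    unfolding Xs_def by (rule card_Un_le)
  also have "\<dots> \<le> 2 + r"
    using card_image_le[of "{..<r}" "\<lambda>a z. y1 z ^ a * y2 z ^ (Suc K - a)"]
    by (intro add_mono) (auto simp: card_insert_if)
  also have "\<dots> < d" using rd d by simp
  finally have cX: "card Xs < d" .
  have fX: "finite Xs" by (simp add: Xs_def)
  have main: "\<exists>A\<in>forms K. \<exists>S\<in>cfun.span Xs. \<forall>z\<in>Z. F z = (y3 z - \<mu> * y2 z) * A z + S z"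
    if F: "F \<in> forms (Suc K)" for F
  proof -
    obtain i where i: "K = Suc i" "i \<ge> i0" unfolding K_def k1_def by (metis add.assoc add.commute add_Suc_right le_add1 plus_1_eq_Suc)
    obtain \<alpha> \<beta> where "inJ K (\<lambda>z. F z - (\<alpha> * x0 z ^ Suc K + \<beta> * (x0 z ^ K * y1 z)))"
      using i0[OF i(2), of F] F unfolding i(1) by auto
    then obtain A B where A: "A \<in> forms K" "B \<in> forms K" "\<And>z. z \<in> Z \<Longrightarrow>
        F z - (\<alpha> * x0 z ^ Suc K + \<beta> * (x0 z ^ K * y1 z)) = y2 z * A z + y3 z * B z"
      unfolding inJ_def by blast
    let ?T = "\<lambda>z. \<alpha> * x0 z ^ Suc K + \<beta> * (x0 z ^ K * y1 z)"
    define F' where "F' z = A z + \<mu> * B z" for z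
    have F': "F' \<in> forms (k1 + N)" unfolding F'_def K_def[symmetric] by (intro forms_add forms_scale A)
    have R1: "eqL \<mu> K F (\<lambda>z. ?T z + y2 z * F' z)"
    proof (rule eqLI[OF A(2)])
      fix z assume "z \<in> Z"
      then show "F z = ?T z + y2 z * F' z + (y3 z - \<mu> * y2 z) * B z"
        using A(3)[of z] by (simp add: F'_def algebra_simps)
    qed
    obtain B' where B': "B' \<in> forms k1" "eqL \<mu> (k1 + N) (\<lambda>z. y2 z * F' z) (\<lambda>z. y2 z ^ Suc N * B' z)"
      using plane_iterate[of k0 \<mu> k1 F' N] k0 F' unfolding k1_def by auto
    obtain M where M: "pol {y1, y2, y3} (\<delta> * k1 + k1 + 1) M"
      "eqL \<mu> (\<delta> * k1 + k1) (\<lambda>z. y2 z ^ (\<delta> * k1 + 1) * B' z) M"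
      using eliminate_x0[OF D(1) \<mu>(3) D(3,4) B'(1)] by blast
    have R3: "eqL \<mu> K (\<lambda>z. y2 z ^ Suc N * B' z) (\<lambda>z. y2 z ^ (Suc n * Suc s + r) * M z)"
    proof -
      have "(\<lambda>z. y2 z ^ (Suc n * Suc s + r)) \<in> forms (Suc n * Suc s + r)" by (intro forms_power1 lin)
      from eqL_mult[OF M(2) this]
      have "eqL \<mu> K (\<lambda>z. y2 z ^ (\<delta> * k1 + 1) * B' z * y2 z ^ (Suc n * Suc s + r)) (\<lambda>z. M z * y2 z ^ (Suc n * Suc s + r))"
        unfolding Kn n_def by (simp only: add.assoc)
      then show ?thesis
      proof (rule eqL_cong)
        fix z
        have "Suc N = (\<delta> * k1 + 1) + (Suc n * Suc s + r)" by (simp add: N_def)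
        then have "y2 z ^ Suc N = y2 z ^ (\<delta> * k1 + 1) * y2 z ^ (Suc n * Suc s + r)" by (simp only: power_add)
        then show "y2 z ^ Suc N * B' z = y2 z ^ (\<delta> * k1 + 1) * B' z * y2 z ^ (Suc n * Suc s + r)"
          by (simp only: mult_ac)
      qed (simp only: mult.commute)
    qed
    have "pol {y1, y2, y3} (Suc n) M" using M(1) by (simp add: n_def)
    then obtain c where R4: "eqL \<mu> K (\<lambda>z. y2 z ^ (Suc n * Suc s + r) * M z)
       (\<lambda>z. \<Sum>a<r. c a * (y1 z ^ a * y2 z ^ (Suc K - a)))"
      using eliminate_y1[OF r0 fs' rel' \<mu>(2)] unfolding Kn by blast
    have "eqL \<mu> K (\<lambda>z. y2 z * F' z) (\<lambda>z. \<Sum>a<r. c a * (y1 z ^ a * y2 z ^ (Suc K - a)))"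
      using eqL_trans[OF eqL_trans[OF B'(2)[folded K_def] R3] R4] .
    from eqL_trans[OF R1 eqL_add[OF eqL_refl[OF refl] this]]
    have "eqL \<mu> K F (\<lambda>z. ?T z + (\<Sum>a<r. c a * (y1 z ^ a * y2 z ^ (Suc K - a))))" .
    then obtain A' where A': "A' \<in> forms K" "\<And>z. z \<in> Z \<Longrightarrow>
      F z = ?T z + (\<Sum>a<r. c a * (y1 z ^ a * y2 z ^ (Suc K - a))) + (y3 z - \<mu> * y2 z) * A' z"
      unfolding eqL_def by blast
    have "(\<lambda>z. ?T z + (\<Sum>a<r. c a * (y1 z ^ a * y2 z ^ (Suc K - a)))) \<in> cfun.span Xs"
      by (intro cfun_span_add cfun_span_scale cfun_span_sum cfun.span_base) (auto simp: Xs_def)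
    with A' show ?thesis by (intro bexI[OF _ A'(1)] bexI) (auto simp: add.commute)
  qed
  have "K \<ge> d" by (simp add: K_def k1_def)
  from section_dimension[OF fX cX this main] show False .
qed

end

context curve_frame
begin

subsection \<open>Orders of vanishing at the point\<close>

text \<open>Orders are measured by powers of the local parameter \<open>y1\<close>, up to powers of the local unit \<open>G\<close>.\<close>

definition ordge :: "nat \<Rightarrow> nat \<Rightarrow> cfun \<Rightarrow> bool" where
  "ordge n k F \<longleftrightarrow> (\<exists>i m. \<exists>E\<in>forms m. m + n = i * Suc g + k \<and> (\<forall>z\<in>Z. G z ^ i * F z = y1 z ^ n * E z))"

lemma ordgeI:
  "E \<in> forms m \<Longrightarrow> m + n = i * Suc g + k \<Longrightarrow> (\<And>z. z \<in> Z \<Longrightarrow> G z ^ i * F z = y1 z ^ n * E z) \<Longrightarrow> ordge n k F"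
  unfolding ordge_def by blast

lemma ordge_forms: "F \<in> forms k \<Longrightarrow> ordge 0 k F"
  by (rule ordgeI[of F k 0 0]) auto

lemma ordge_cong: "ordge n k F \<Longrightarrow> (\<And>z. z \<in> Z \<Longrightarrow> H z = F z) \<Longrightarrow> ordge n k H"
  unfolding ordge_def by (metis (no_types, lifting))

lemma G_power: "(\<lambda>z. G z ^ i) \<in> forms (i * Suc g)"
  by (rule forms_power[OF local(1)])

lemma ordge_add:
  assumes "ordge n k F" "ordge n k H"
  shows "ordge n k (\<lambda>z. F z + H z)"
proof -
  obtain i m E where E: "E \<in> forms m" "m + n = i * Suc g + k" "\<And>z. z \<in> Z \<Longrightarrow> G z ^ i * F z = y1 z ^ n * E z"
    using assms(1) unfolding ordge_def by blast
  obtain i' m' E' where E': "E' \<in> forms m'" "m' + n = i' * Suc g + k" "\<And>z. z \<in> Z \<Longrightarrow> G z ^ i' * H z = y1 z ^ n * E' z"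
    using assms(2) unfolding ordge_def by blast
  have deg: "i * Suc g + m' = i' * Suc g + m" using E(2) E'(2) by linarith
  show ?thesis
  proof (rule ordgeI[where i = "i + i'"])
    show "(\<lambda>z. G z ^ i' * E z + G z ^ i * E' z) \<in> forms (i' * Suc g + m)"
      by (rule forms_add[OF forms_mult[OF G_power E(1)]])
        (rule forms_mult'[OF G_power E'(1)], rule deg[symmetric])
    show "i' * Suc g + m + n = (i + i') * Suc g + k" using E(2) by (simp add: algebra_simps)
    fix z assume z: "z \<in> Z"
    have "G z ^ (i + i') * (F z + H z) = G z ^ i' * (G z ^ i * F z) + G z ^ i * (G z ^ i' * H z)"
      by (simp add: power_add algebra_simps)
    then show "G z ^ (i + i') * (F z + H z) = y1 z ^ n * (G z ^ i' * E z + G z ^ i * E' z)"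
      unfolding E(3)[OF z] E'(3)[OF z] by (simp add: algebra_simps)
  qed
qed

lemma ordge_mult:
  assumes "ordge n k F" "ordge n' k' H"
  shows "ordge (n + n') (k + k') (\<lambda>z. F z * H z)"
proof -
  obtain i m E where E: "E \<in> forms m" "m + n = i * Suc g + k" "\<And>z. z \<in> Z \<Longrightarrow> G z ^ i * F z = y1 z ^ n * E z"
    using assms(1) unfolding ordge_def by blast
  obtain i' m' E' where E': "E' \<in> forms m'" "m' + n' = i' * Suc g + k'" "\<And>z. z \<in> Z \<Longrightarrow> G z ^ i' * H z = y1 z ^ n' * E' z"
    using assms(2) unfolding ordge_def by blast
  show ?thesis
  proof (rule ordgeI[OF forms_mult[OF E(1) E'(1)], where i = "i + i'"])
    show "m + m' + (n + n') = (i + i') * Suc g + (k + k')" using E(2) E'(2) by (simp add: algebra_simps)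
    fix z assume z: "z \<in> Z"
    have "G z ^ (i + i') * (F z * H z) = (G z ^ i * F z) * (G z ^ i' * H z)"
      by (simp add: power_add algebra_simps)
    then show "G z ^ (i + i') * (F z * H z) = y1 z ^ (n + n') * (E z * E' z)"
      unfolding E(3)[OF z] E'(3)[OF z] by (simp add: power_add algebra_simps)
  qed
qed

lemma ordge_mult':
  "ordge n k F \<Longrightarrow> ordge n' k' H \<Longrightarrow> n'' = n + n' \<Longrightarrow> k'' = k + k' \<Longrightarrow> ordge n'' k'' (\<lambda>z. F z * H z)"
  using ordge_mult by blast

lemma ordge_scale: "ordge n k F \<Longrightarrow> ordge n k (\<lambda>z. c * F z)"
  using ordge_mult[OF ordge_forms[OF forms_const[of c]], of n k F] by simp

lemma ordge_uminus: "ordge n k F \<Longrightarrow> ordge n k (\<lambda>z. - F z)"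
  using ordge_scale[of n k F "-1"] by simp

lemma ordge_zero: "ordge n k (\<lambda>_. 0)"
  by (rule ordgeI[of "\<lambda>_. 0" "n * g + k" n n]) (auto intro: forms_zero)

lemma ordge_sum: "(\<And>i. i \<in> I \<Longrightarrow> ordge n k (F i)) \<Longrightarrow> ordge n k (\<lambda>z. \<Sum>i\<in>I. F i z)"
  by (induction I rule: infinite_finite_induct) (auto intro: ordge_add ordge_zero)

lemma ordge_mono:
  assumes "ordge n k F" "n' \<le> n"
  shows "ordge n' k F"
proof -
  obtain i m E where E: "E \<in> forms m" "m + n = i * Suc g + k" "\<And>z. z \<in> Z \<Longrightarrow> G z ^ i * F z = y1 z ^ n * E z"
    using assms(1) unfolding ordge_def by blast
  show ?thesis
  proof (rule ordgeI[OF forms_mult[OF forms_power1[OF lin(2)] E(1)]])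
    show "n - n' + m + n' = i * Suc g + k" using E(2) assms(2) by simp
    fix z assume "z \<in> Z"
    then show "G z ^ i * F z = y1 z ^ n' * (y1 z ^ (n - n') * E z)"
      using E(3)[of z] assms(2) by (simp add: mult.assoc[symmetric] power_add[symmetric])
  qed
qed

lemma ordge_y1: "ordge 1 1 y1"
  by (rule ordgeI[of "\<lambda>_. 1" 0 1 0]) (auto intro: forms_const)

lemma ordge_y2: "ordge 2 1 y2"
  by (rule ordgeI[of E2 g 2 1]) (auto simp: local)

lemma ordge_y3: "ordge 2 1 y3"
  by (rule ordgeI[of E3 g 2 1]) (auto simp: local)

lemma ordge_pol:
  assumes "pol X k f" "\<And>l. l \<in> X \<Longrightarrow> ordge n 1 l"
  shows "ordge (n * k) k f"
  using assms(1)
proof (induction rule: pol.induct)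
  case (pol_const c)
  show ?case using ordge_forms[OF forms_const] by simp
next
  case (pol_times l k f)
  show ?case by (rule ordge_mult'[OF assms(2)[OF pol_times(1)] pol_times(3)]) auto
qed (auto intro: ordge_zero ordge_add)

lemma ordge_pol_Y2: "pol {y2, y3} k f \<Longrightarrow> ordge (2 * k) k f"
  by (erule ordge_pol) (use ordge_y2 ordge_y3 in auto)

lemma ordge_pol_Y3: "pol {y1, y2, y3} k f \<Longrightarrow> ordge k k f"
  using ordge_pol[of "{y1, y2, y3}" k f 1] ordge_y1 ordge_mono[OF ordge_y2, of 1] ordge_mono[OF ordge_y3, of 1]
  by auto

lemma ordge_y1_power: "ordge n n (\<lambda>z. y1 z ^ n)"
  using ordge_pol_Y3[OF pol_power_var] by simp

lemma ordge_diff_value: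
  assumes "F \<in> forms k"
  shows "ordge 1 k (\<lambda>z. F z - F e0 * x0 z ^ k)"
proof (cases k)
  case 0
  then have "pol crd 0 F" using assms by (simp add: forms_iff)
  then obtain c where "F = (\<lambda>_. c)" using pol_0D by blast
  then show ?thesis using ordge_zero by (simp add: 0)
next
  case (Suc j)
  obtain F1 F2 F3 where F: "F1 \<in> forms j" "F2 \<in> forms j" "F3 \<in> forms j"
    "\<And>z. F z = F e0 * x0 z ^ Suc j + y1 z * F1 z + y2 z * F2 z + y3 z * F3 z"
    using expand0[of F j] assms Suc by blast
  have y2: "ordge 1 1 y2" and y3: "ordge 1 1 y3"
    using ordge_mono[OF ordge_y2, of 1] ordge_mono[OF ordge_y3, of 1] by auto
  have "ordge 1 k (\<lambda>z. y1 z * F1 z + y2 z * F2 z + y3 z * F3 z)"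
    by (intro ordge_add ordge_mult'[OF ordge_y1 ordge_forms[OF F(1)]] ordge_mult'[OF y2 ordge_forms[OF F(2)]]
        ordge_mult'[OF y3 ordge_forms[OF F(3)]]) (auto simp: Suc)
  then show ?thesis
  proof (rule ordge_cong)
    fix z
    show "F z - F e0 * x0 z ^ k = y1 z * F1 z + y2 z * F2 z + y3 z * F3 z"
      using F(4)[of z] by (simp add: Suc)
  qed
qed

text \<open>The order of \<open>x0 ^ j y1 ^ n\<close> is exactly \<open>n\<close>: once
  \<open>y1 ^ n\<close> is cancelled the identity can be evaluated at \<open>e0\<close>, where
  \<open>y1\<close> vanishes but \<open>G\<close> and \<open>x0\<close> do not.\<close>

lemma ordge_leading:
  assumes "ordge (Suc n) (j + n) (\<lambda>z. c * (x0 z ^ j * y1 z ^ n))"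
  shows "c = 0"
proof -
  obtain i m E where E: "E \<in> forms m" "m + Suc n = i * Suc g + (j + n)"
    "\<And>z. z \<in> Z \<Longrightarrow> G z ^ i * (c * (x0 z ^ j * y1 z ^ n)) = y1 z ^ Suc n * E z"
    using assms unfolding ordge_def by blast
  have "G e0 ^ i * (c * x0 e0 ^ j) - y1 e0 * E e0 = 0"
  proof (rule cancel[OF forms_power1[OF lin(2)] _ nz_power[OF lin(2) nz_y1] _ e0_Z])
    show "(\<lambda>z. G z ^ i * (c * x0 z ^ j) - y1 z * E z) \<in> forms (i * Suc g + j)"
    proof (rule forms_diff)
      show "(\<lambda>z. G z ^ i * (c * x0 z ^ j)) \<in> forms (i * Suc g + j)"
        by (intro forms_mult G_power forms_scale forms_power1 lin)
      show "(\<lambda>z. y1 z * E z) \<in> forms (i * Suc g + j)"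
        by (rule forms_mult'[OF lin(2) E(1)]) (use E(2) in simp)
    qed
    fix z assume "z \<in> Z"
    then show "y1 z ^ n * (G z ^ i * (c * x0 z ^ j) - y1 z * E z) = 0"
      using E(3)[of z] by (simp add: algebra_simps)
  qed
  then show ?thesis using local(4) by (simp add: dual)
qed

subsection \<open>Moving the vertex of a cone\<close>

text \<open>
  Composition with \<open>mv v w t\<close> turns polynomials in \<open>y1, y2, y3\<close>, the forms of the cones with
  vertex \<open>e0\<close>, into those of the cones with vertex \<open>vtx v w t\<close>.
\<close>

definition vtx :: "vec4 \<Rightarrow> vec4 \<Rightarrow> complex \<Rightarrow> vec4" where
  "vtx v w t = e0 + t *s v + t ^ 2 *s w"

text \<open>Up to the factor \<open>x0 (vtx v w t)\<close> this is the projection from the vertex to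
  the plane \<open>x0 = 0\<close>.\<close>

definition mv :: "vec4 \<Rightarrow> vec4 \<Rightarrow> complex \<Rightarrow> vec4 \<Rightarrow> vec4" where
  "mv v w t z = x0 (vtx v w t) *s z - x0 z *s vtx v w t"

text \<open>The first-order variation of a cone form as its vertex leaves \<open>e0\<close> in
  direction \<open>v\<close>; for polynomials \<open>f\<close> it does not depend on
  \<open>w\<close>, which enters to second order.\<close>

definition mvder :: "vec4 \<Rightarrow> vec4 \<Rightarrow> cfun \<Rightarrow> cfun \<Rightarrow> bool" where
  "mvder v w f f' \<longleftrightarrow> (\<forall>z. ((\<lambda>t. f (mv v w t z)) has_field_derivative f' z) (at 0))"

lemma forms1_vtx: "l \<in> forms 1 \<Longrightarrow> l (vtx v w t) = l e0 + t * l v + t ^ 2 * l w"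
  by (simp add: vtx_def forms1_add forms1_smult)

lemma forms1_mv: "l \<in> forms 1 \<Longrightarrow> l (mv v w t z) = x0 (vtx v w t) * l z - x0 z * l (vtx v w t)"
  by (simp add: mv_def forms1_diff forms1_smult)

lemma mvder_linear:
  assumes "l \<in> forms 1" "l e0 = 0"
  shows "mvder v w l (\<lambda>z. x0 v * l z - x0 z * l v)"
  unfolding mvder_def forms1_mv[OF assms(1)] forms1_vtx[OF assms(1)] forms1_vtx[OF lin(1)] assms(2) dual
  by (auto intro!: derivative_eq_intros)

lemma mv_0: "pol {y1, y2, y3} k f \<Longrightarrow> f (mv v w 0 z) = f z"
proof (induction rule: pol.induct)
  case (pol_times l k f)
  then have l: "l \<in> forms 1" "l e0 = 0" using lin dual by auto
  have "l (mv v w 0 z) = l z"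
    unfolding forms1_mv[OF l(1)] forms1_vtx[OF l(1)] forms1_vtx[OF lin(1)] by (simp add: l dual)
  then show ?case using pol_times by simp
qed auto

lemma mvder_mult:
  assumes "mvder v w f f'" "mvder v w h h'" "\<And>z. f (mv v w 0 z) = f z" "\<And>z. h (mv v w 0 z) = h z"
  shows "mvder v w (\<lambda>z. f z * h z) (\<lambda>z. f' z * h z + f z * h' z)"
  using assms unfolding mvder_def by (auto intro!: derivative_eq_intros)

lemma mvder_add: "mvder v w f f' \<Longrightarrow> mvder v w h h' \<Longrightarrow> mvder v w (\<lambda>z. f z + h z) (\<lambda>z. f' z + h' z)"
  unfolding mvder_def by (auto intro!: derivative_eq_intros)

lemma mvder_scale: "mvder v w f f' \<Longrightarrow> mvder v w (\<lambda>z. c * f z) (\<lambda>z. c * f' z)"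
  unfolding mvder_def by (auto intro!: derivative_eq_intros)

lemma mvder_const: "mvder v w (\<lambda>_. c) (\<lambda>_. 0)"
  unfolding mvder_def by auto

lemma mvder_sum: "(\<And>i. i \<in> I \<Longrightarrow> mvder v w (f i) (f' i)) \<Longrightarrow> mvder v w (\<lambda>z. \<Sum>i\<in>I. f i z) (\<lambda>z. \<Sum>i\<in>I. f' i z)"
  by (induction I rule: infinite_finite_induct) (auto intro: mvder_add mvder_const)

lemma mvder_unique: "mvder v w f f' \<Longrightarrow> mvder v w f f'' \<Longrightarrow> f' = f''"
  unfolding mvder_def using DERIV_unique by blast

text \<open>By the product rule a variation is a sum of terms in which one factor is replaced by
  some linear form while the others stay in \<open>X\<close>; so the order at \<open>e0\<close>
  drops by that of one factor at most.\<close>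

lemma pol_mvder:
  assumes "pol X k f" "X \<subseteq> {y1, y2, y3}"
  shows "\<exists>f'. mvder v w f f' \<and> (case k of 0 \<Rightarrow> f' = (\<lambda>_. 0)
     | Suc j \<Rightarrow> f' \<in> cfun.span {\<lambda>z. l z * h z |l h. l \<in> forms 1 \<and> pol X j h})"
  using assms(1)
proof (induction rule: pol.induct)
  case (pol_const c)
  show ?case using mvder_const by (intro exI[of _ "\<lambda>_. 0"]) auto
next
  case (pol_zero k)
  show ?case using mvder_const by (intro exI[of _ "\<lambda>_. 0"]) (auto split: nat.split simp: cfun_span_zero)
next
  case (pol_times l k f)
  have l: "l \<in> forms 1" "l e0 = 0" "l \<in> {y1, y2, y3}" using pol_times(1) assms(2) lin dual by auto
  from pol_times(3) obtain f' where f': "mvder v w f f'"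
    "case k of 0 \<Rightarrow> f' = (\<lambda>_. 0) | Suc j \<Rightarrow> f' \<in> cfun.span {\<lambda>z. l z * h z |l h. l \<in> forms 1 \<and> pol X j h}" by blast
  define l' where "l' z = x0 v * l z - x0 z * l v" for z
  have l'f: "l' \<in> forms 1"
    unfolding l'_def using forms_diff[OF forms_scale[OF l(1), of "x0 v"] forms_scale[OF lin(1), of "l v"]]
    by (simp add: mult.commute)
  have "mvder v w l l'" unfolding l'_def by (rule mvder_linear[OF l(1,2)])
  then have "mvder v w (\<lambda>z. l z * f z) (\<lambda>z. l' z * f z + l z * f' z)"
    by (rule mvder_mult[OF _ f'(1)])
      (rule mv_0[OF pol_var[OF l(3)]], rule mv_0[OF pol_mono[OF pol_times(2) assms(2)]])
  moreover have "(\<lambda>z. l' z * f z + l z * f' z) \<in> cfun.span {\<lambda>z. l z * h z |l h. l \<in> forms 1 \<and> pol X k h}"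
  proof (rule cfun_span_add)
    show "(\<lambda>z. l' z * f z) \<in> cfun.span {\<lambda>z. l z * h z |l h. l \<in> forms 1 \<and> pol X k h}"
      by (rule cfun.span_base) (use l'f pol_times(2) in blast)
    show "(\<lambda>z. l z * f' z) \<in> cfun.span {\<lambda>z. l z * h z |l h. l \<in> forms 1 \<and> pol X k h}"
    proof (cases k)
      case 0
      then show ?thesis using f'(2) cfun_span_zero by simp
    next
      case (Suc j)
      then have "f' \<in> cfun.span {\<lambda>z. l z * h z |l h. l \<in> forms 1 \<and> pol X j h}" using f'(2) by simp
      then show ?thesis
      proof (induction rule: cfun_span_induct)
        case (base u)
        then obtain p h where u: "u = (\<lambda>z. p z * h z)" "p \<in> forms 1" "pol X j h" by blast
        have "(\<lambda>z. l z * u z) = (\<lambda>z. p z * (l z * h z))" by (simp add: u mult.left_commute)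
        moreover have "pol X k (\<lambda>z. l z * h z)" unfolding Suc by (rule pol.pol_times[OF pol_times(1) u(3)])
        ultimately show ?case using u(2)
          by (intro cfun.span_base CollectI exI[of _ p] exI[of _ "\<lambda>z. l z * h z"] conjI)
      next
        case zero
        show ?case using cfun_span_zero by simp
      next
        case (add f h)
        from cfun_span_add[OF add] show ?case by (simp add: distrib_left)
      next
        case (scale c f)
        from cfun_span_scale[OF scale, of c] show ?case by (simp add: mult.left_commute)
      qed
    qed
  qed
  ultimately show ?case unfolding nat.case by blast
next
  case (pol_plus k f h)
  from pol_plus(3) obtain f' where f': "mvder v w f f'"
    "case k of 0 \<Rightarrow> f' = (\<lambda>_. 0) | Suc j \<Rightarrow> f' \<in> cfun.span {\<lambda>z. l z * h z |l h. l \<in> forms 1 \<and> pol X j h}" by blast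
  from pol_plus(4) obtain h' where h': "mvder v w h h'"
    "case k of 0 \<Rightarrow> h' = (\<lambda>_. 0) | Suc j \<Rightarrow> h' \<in> cfun.span {\<lambda>z. l z * h z |l h. l \<in> forms 1 \<and> pol X j h}" by blast
  have "case k of 0 \<Rightarrow> (\<lambda>z. f' z + h' z) = (\<lambda>_. 0)
     | Suc j \<Rightarrow> (\<lambda>z. f' z + h' z) \<in> cfun.span {\<lambda>z. l z * h z |l h. l \<in> forms 1 \<and> pol X j h}"
    using f'(2) h'(2) by (cases k) (auto intro: cfun_span_add)
  then show ?case using mvder_add[OF f'(1) h'(1)] by blast
qed

lemma pol_mvder_order:
  assumes "pol X (Suc j) f" "X \<subseteq> {y1, y2, y3}" "\<And>l. l \<in> X \<Longrightarrow> ordge n 1 l" "mvder v w f f'"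
  shows "ordge (n * j) (Suc j) f'"
proof -
  have "f' \<in> cfun.span {\<lambda>z. l z * h z |l h. l \<in> forms 1 \<and> pol X j h}"
    using pol_mvder[OF assms(1,2), of v w] mvder_unique[OF assms(4)] by auto
  then show ?thesis
  proof (induction rule: cfun_span_induct)
    case (base u)
    then obtain p h where u: "u = (\<lambda>z. p z * h z)" "p \<in> forms 1" "pol X j h" by blast
    show ?case unfolding u(1)
      by (rule ordge_mult'[OF ordge_forms[OF u(2)] ordge_pol[OF u(3) assms(3)]]) auto
  qed (auto intro: ordge_zero ordge_add ordge_scale)
qed

end

section \<open>Variations of cone equations of the curve\<close>

context projected_curve
begin

text \<open>Orders at \<open>e0\<close> are compared in the expansion of \<open>f\<close> in powers
  of \<open>y1\<close>; there \<open>y1\<close> and \<open>y2\<close> have orders exactly 1 and 2,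
  and \<open>y3\<close> at least 3. Vanishing on the curve kills the top coefficient and makes the
  next one a multiple of \<open>y3\<close>. Varying the vertex off the osculating plane turns this
  multiple into a term of order \<open>d - 2\<close>, lower than all others, so it vanishes too, and
  \<open>no_singular_equation\<close> applies.\<close>

lemma vertex_derivative:
  assumes d: "d \<ge> 3" and f: "pol {y1, y2, y3} (d - 1) f" and f0: "\<And>z. z \<in> Z \<Longrightarrow> f z = 0"
    and f': "mvder v w f f'" and h: "pol {y1, y2, y3} (d - 1) h" and f'h: "\<And>z. z \<in> Z \<Longrightarrow> f' z = h z"
    and v: "y3 v \<noteq> 0"
  shows "f z = 0"
proof -
  define q where "q = d - 2"
  have dq: "d - 1 = Suc q" "q \<ge> 1" using d by (auto simp: q_def)
  obtain fs where fs: "\<And>a. a \<le> Suc q \<Longrightarrow> pol {y2, y3} (Suc q - a) (fs a)"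
    "\<And>x. f x = (\<Sum>a\<le>Suc q. y1 x ^ a * fs a x)"
    using pol_expand_power[OF f] unfolding dq by blast
  have rel: "(\<Sum>a\<le>Suc q. y1 z ^ a * fs a z) = 0" if "z \<in> Z" for z
    using f0[OF that] unfolding fs(2) .
  have ofs: "ordge (a + 2 * (Suc q - a)) (Suc q) (\<lambda>z. y1 z ^ a * fs a z)" if "a \<le> Suc q" for a
    by (rule ordge_mult'[OF ordge_y1_power ordge_pol_Y2[OF fs(1)[OF that]]]) (use that in auto)
  have "pol {y2, y3} 0 (fs (Suc q))" using fs(1)[of "Suc q"] by simp
  then obtain c where c: "fs (Suc q) = (\<lambda>_. c)" using pol_0D by blast
  \<comment> \<open>The coefficient of \<open>y1 ^ (d - 1)\<close> is a constant, and every other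
    term has order at least \<open>d\<close>.\<close>
  have "ordge (Suc (Suc q)) (0 + Suc q) (\<lambda>z. c * (x0 z ^ 0 * y1 z ^ Suc q))"
  proof (rule ordge_cong)
    show "ordge (Suc (Suc q)) (0 + Suc q) (\<lambda>z. - (\<Sum>a\<le>q. y1 z ^ a * fs a z))"
      unfolding add_0 by (intro ordge_uminus ordge_sum ordge_mono[OF ofs]) auto
    fix z assume "z \<in> Z"
    then show "c * (x0 z ^ 0 * y1 z ^ Suc q) = - (\<Sum>a\<le>q. y1 z ^ a * fs a z)"
      using rel[of z] by (simp add: c eq_neg_iff_add_eq_0 add.commute mult.commute)
  qed
  then have c0: "c = 0" by (rule ordge_leading)
  have "pol {y2, y3} 1 (fs q)" using fs(1)[of q] by simp
  from pol_binary[OF this] obtain b where "\<And>x. fs q x = (\<Sum>i\<le>1. b i * y2 x ^ i * y3 x ^ (1 - i))" by blast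
  then have b: "fs q x = b 0 * y3 x + b 1 * y2 x" for x by simp
  have rel2: "y1 z ^ q * fs q z = - (\<Sum>a<q. y1 z ^ a * fs a z)" if "z \<in> Z" for z
    using rel[OF that] by (simp add: c c0 eq_neg_iff_add_eq_0 add.commute lessThan_Suc_atMost[symmetric])
  have E3: "ordge 3 (Suc g + 1) (\<lambda>z. G z * y3 z)"
  proof -
    have "ordge 1 g E3" using ordge_diff_value[OF local(3)] local(6) by simp
    from ordge_mult[OF ordge_y1_power[of 2] this] have "ordge 3 (Suc g + 1) (\<lambda>z. y1 z ^ 2 * E3 z)" by simp
    then show ?thesis by (rule ordge_cong) (rule local(8))
  qed
  \<comment> \<open>After multiplication by the unit \<open>G\<close>: the \<open>y2\<close> part of
    the coefficient of \<open>y1 ^ (d - 2)\<close> contributes order exactly \<open>d\<close>, the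
    \<open>y3\<close> part and the lower powers of \<open>y1\<close> at least
    \<open>d + 1\<close>.\<close>
  have "ordge (Suc (q + 2)) (g + (q + 2)) (\<lambda>z. (b 1 * E2 e0) * (x0 z ^ g * y1 z ^ (q + 2)))"
  proof (rule ordge_cong)
    have A: "ordge (Suc (q + 2)) (g + (q + 2)) (\<lambda>z. (G z * y3 z) * y1 z ^ q)"
      by (rule ordge_mult'[OF E3 ordge_y1_power]) auto
    have B: "ordge (Suc (q + 2)) (g + (q + 2)) (\<lambda>z. G z * (\<Sum>a<q. y1 z ^ a * fs a z))"
    proof (rule ordge_mult'[OF ordge_forms[OF local(1)]])
      show "ordge (Suc (q + 2)) (Suc q) (\<lambda>z. \<Sum>a<q. y1 z ^ a * fs a z)"
        by (intro ordge_sum ordge_mono[OF ofs]) auto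
    qed auto
    have C: "ordge (Suc (q + 2)) (g + (q + 2)) (\<lambda>z. (E2 z - E2 e0 * x0 z ^ g) * y1 z ^ (q + 2))"
      by (rule ordge_mult'[OF ordge_diff_value[OF local(2)] ordge_y1_power]) auto
    show "ordge (Suc (q + 2)) (g + (q + 2)) (\<lambda>z. - (b 0 * ((G z * y3 z) * y1 z ^ q)) + (- (G z * (\<Sum>a<q. y1 z ^ a * fs a z)) +
        - (b 1 * ((E2 z - E2 e0 * x0 z ^ g) * y1 z ^ (q + 2)))))"
      by (intro ordge_add ordge_uminus ordge_scale A B C)
    fix z assume z: "z \<in> Z"
    have "G z * (y1 z ^ q * (b 0 * y3 z + b 1 * y2 z)) = - (G z * (\<Sum>a<q. y1 z ^ a * fs a z))"
      using rel2[OF z] unfolding b by simp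
    moreover have "G z * (y1 z ^ q * (b 0 * y3 z + b 1 * y2 z)) = b 0 * ((G z * y3 z) * y1 z ^ q) + b 1 * (y1 z ^ q * (G z * y2 z))"
      by (simp add: algebra_simps)
    moreover have "y1 z ^ q * (G z * y2 z) = E2 z * y1 z ^ (q + 2)"
      unfolding local(7)[OF z] by (simp add: power_add power2_eq_square)
    ultimately have "b 0 * ((G z * y3 z) * y1 z ^ q) + b 1 * (E2 z * y1 z ^ (q + 2)) = - (G z * (\<Sum>a<q. y1 z ^ a * fs a z))"
      by metis
    moreover have "s * A + t * (E * Y) = - R \<Longrightarrow> (t * e) * (x * Y) = - (s * A) + (- R + - (t * ((E - e * x) * Y)))"
      for s t A E Y R e x :: complex
      by (simp add: algebra_simps)
    ultimately show "(b 1 * E2 e0) * (x0 z ^ g * y1 z ^ (q + 2)) = - (b 0 * ((G z * y3 z) * y1 z ^ q)) + (- (G z * (\<Sum>a<q. y1 z ^ a * fs a z)) +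
        - (b 1 * ((E2 z - E2 e0 * x0 z ^ g) * y1 z ^ (q + 2))))"
      by blast
  qed
  then have "b 1 * E2 e0 = 0" by (rule ordge_leading)
  then have b1: "fs q x = b 0 * y3 x" for x using local(5) b by simp
  have ex: "\<exists>f'. mvder v w f f'" if "pol X k f" "X \<subseteq> {y1, y2, y3}" for X k f
    using pol_mvder[OF that] by blast
  have "\<forall>a. \<exists>p. mvder v w (\<lambda>z. y1 z ^ a) p"
    using ex[OF pol_power_var[of y1 "{y1}"]] by simp
  then obtain p where p: "\<And>a. mvder v w (\<lambda>z. y1 z ^ a) (p a)" by metis
  have "\<forall>a. \<exists>u. a \<le> Suc q \<longrightarrow> mvder v w (fs a) u"
    using ex[OF fs(1)] by blast
  then obtain u where u: "\<And>a. a \<le> Suc q \<Longrightarrow> mvder v w (fs a) (u a)" by metis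
  have op: "ordge (a - 1) a (p a)" for a
  proof (cases a)
    case 0
    have "p 0 = (\<lambda>_. 0)" using mvder_unique[OF p[of 0]] mvder_const[of v w 1] by simp
    then show ?thesis using ordge_zero 0 by simp
  next
    case (Suc j)
    have "pol {y1} (Suc j) (\<lambda>z. y1 z ^ a)" unfolding Suc by (rule pol_power_var) simp
    from pol_mvder_order[OF this _ _ p, of 1] show ?thesis using ordge_y1 Suc by simp
  qed
  have ou: "ordge (2 * (q - a)) (Suc q - a) (u a)" if "a \<le> q" for a
  proof -
    have *: "Suc q - a = Suc (q - a)" using that by simp
    have "pol {y2, y3} (Suc (q - a)) (fs a)" using fs(1)[of a] that * by simp
    from pol_mvder_order[OF this _ _ u, of 2] show ?thesis using ordge_y2 ordge_y3 that * by auto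
  qed
  define T where "T a z = p a z * fs a z + y1 z ^ a * u a z" for a z
  have "mvder v w (\<lambda>z. \<Sum>a\<le>q. y1 z ^ a * fs a z) (\<lambda>z. \<Sum>a\<le>q. T a z)"
    unfolding T_def
  proof (rule mvder_sum)
    fix a assume "a \<in> {..q}"
    then have a: "a \<le> Suc q" by simp
    show "mvder v w (\<lambda>z. y1 z ^ a * fs a z) (\<lambda>z. p a z * fs a z + y1 z ^ a * u a z)"
    proof (rule mvder_mult[OF p u[OF a]])
      fix z
      show "y1 (mv v w 0 z) ^ a = y1 z ^ a"
        by (rule mv_0[of _ "\<lambda>z. y1 z ^ a"]) (rule pol_power_var, simp)
      show "fs a (mv v w 0 z) = fs a z"
        by (rule mv_0[OF pol_mono[OF fs(1)[OF a]]]) auto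
    qed
  qed
  moreover have "f = (\<lambda>z. \<Sum>a\<le>q. y1 z ^ a * fs a z)" by (rule ext) (simp add: fs(2) c c0)
  ultimately have f'T: "f' = (\<lambda>z. \<Sum>a\<le>q. T a z)" using mvder_unique[OF f'] by simp
  have uq: "u q = (\<lambda>z. b 0 * (x0 v * y3 z - x0 z * y3 v))"
  proof -
    have "fs q = (\<lambda>z. b 0 * y3 z)" using b1 by blast
    then have "mvder v w (fs q) (\<lambda>z. b 0 * (x0 v * y3 z - x0 z * y3 v))"
      using mvder_scale[OF mvder_linear[OF lin(4)]] dual by simp
    then show ?thesis using mvder_unique[OF u[of q]] by simp
  qed
  have o1: "ordge (Suc q) (Suc q) (\<lambda>z. p a z * fs a z)" if "a \<le> q" for a
  proof (rule ordge_mono)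
    show "ordge (a - 1 + 2 * (Suc q - a)) (Suc q) (\<lambda>z. p a z * fs a z)"
      by (rule ordge_mult'[OF op ordge_pol_Y2[OF fs(1)]]) (use that in auto)
  qed (use that in auto)
  have o2: "ordge (Suc q) (Suc q) (\<lambda>z. y1 z ^ a * u a z)" if "a < q" for a
  proof (rule ordge_mono)
    show "ordge (a + 2 * (q - a)) (Suc q) (\<lambda>z. y1 z ^ a * u a z)"
      by (rule ordge_mult'[OF ordge_y1_power ou]) (use that in auto)
  qed (use that in auto)
  have o3: "ordge (Suc q) (Suc q) (\<lambda>z. y1 z ^ q * y3 z)"
    by (rule ordge_mono[OF ordge_mult'[OF ordge_y1_power ordge_y3 refl]]) auto
  \<comment> \<open>The variation of \<open>b 0 * y3\<close> contains \<open>x0\<close> times the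
    constant \<open>- b 0 * y3 v\<close>, which gives order \<open>d - 2\<close>. All other terms,
    and the cone form \<open>h\<close> of degree \<open>d - 1\<close>, have order at least
    \<open>d - 1\<close>.\<close>
  have "ordge (Suc q) (1 + q) (\<lambda>z. (b 0 * y3 v) * (x0 z ^ 1 * y1 z ^ q))"
  proof (rule ordge_cong)
    show "ordge (Suc q) (1 + q) (\<lambda>z. (\<Sum>a\<le>q. p a z * fs a z) + ((\<Sum>a<q. y1 z ^ a * u a z) +
       ((b 0 * x0 v) * (y1 z ^ q * y3 z) + - h z)))"
      unfolding plus_1_eq_Suc using h[unfolded dq]
      by (intro ordge_add ordge_sum ordge_scale ordge_uminus o1 o2 o3 ordge_pol_Y3) auto
    fix z assume z: "z \<in> Z"
    have "h z = (\<Sum>a\<le>q. p a z * fs a z) + (\<Sum>a\<le>q. y1 z ^ a * u a z)"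
      using f'h[OF z] unfolding f'T T_def by (simp add: sum.distrib)
    also have "(\<Sum>a\<le>q. y1 z ^ a * u a z) = (\<Sum>a<q. y1 z ^ a * u a z) + y1 z ^ q * u q z"
      by (simp add: lessThan_Suc_atMost[symmetric])
    finally show "(b 0 * y3 v) * (x0 z ^ 1 * y1 z ^ q) = (\<Sum>a\<le>q. p a z * fs a z) + ((\<Sum>a<q. y1 z ^ a * u a z) +
       ((b 0 * x0 v) * (y1 z ^ q * y3 z) + - h z))"
      unfolding uq by (simp add: algebra_simps)
  qed
  then have "b 0 * y3 v = 0" by (rule ordge_leading)
  then have b0: "fs q x = 0" for x using b1 v by simp
  have "fs a z = 0" if "a \<le> Suc q" for a
  proof (rule no_singular_equation[OF d, where fs = fs])
    show "pol {y2, y3} (d - 1 - a) (fs a)" if "a \<le> d - 1" for a using fs(1) that unfolding dq .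
    show "(\<Sum>a\<le>d - 1. y1 z ^ a * fs a z) = 0" if "z \<in> Z" for z using rel[OF that] unfolding dq .
    show "fs a z = 0" if "d - 2 \<le> a" "a \<le> d - 1" for a z
    proof -
      have "a = q \<or> a = Suc q" using that dq unfolding q_def by linarith
      then show ?thesis using b0 c c0 by auto
    qed
  qed (use that dq in simp)
  then show ?thesis unfolding fs(2) by simp
qed

end

section \<open>Limits of spans\<close>

lemma bounded_family_subsequence:
  fixes c :: "nat \<Rightarrow> 'i \<Rightarrow> complex"
  assumes "finite I" "\<And>n i. i \<in> I \<Longrightarrow> cmod (c n i) \<le> 1"
  shows "\<exists>r l. strict_mono r \<and> (\<forall>i\<in>I. (\<lambda>n. c (r n) i) \<longlonglongrightarrow> l i)"
  using assms
proof (induction I rule: finite_induct)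
  case empty
  show ?case by (intro exI[of _ id]) (auto simp: strict_mono_def)
next
  case (insert a I)
  then obtain r l where r: "strict_mono r" "\<And>i. i \<in> I \<Longrightarrow> (\<lambda>n. c (r n) i) \<longlonglongrightarrow> l i" by blast
  have "bounded (range (\<lambda>n. c (r n) a))"
    unfolding bounded_iff using insert.prems by (intro exI[of _ 1]) auto
  then obtain r' l' where r': "strict_mono r'" "((\<lambda>n. c (r n) a) \<circ> r') \<longlonglongrightarrow> l'"
    using bounded_imp_convergent_subsequence by blast
  have "(\<lambda>n. c ((r \<circ> r') n) i) \<longlonglongrightarrow> (if i = a then l' else l i)" if "i \<in> insert a I" for i
  proof (cases "i = a")
    case True
    then show ?thesis using r'(2) by (simp add: o_def)
  next
    case False
    then have "i \<in> I" using that by blast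
    from LIMSEQ_subseq_LIMSEQ[OF r(2)[OF this] r'(1)] False show ?thesis by (simp add: o_def)
  qed
  then show ?case
    using strict_mono_o[OF r(1) r'(1)] by (intro exI[of _ "r \<circ> r'"] exI[of _ "\<lambda>i. if i = a then l' else l i"]) blast
qed

text \<open>
  Bounding the pair \<open>(c / M, 1 / M)\<close> with \<open>M = 1 + \<Sum> |c|\<close> avoids a case distinction on
  whether the coefficients stay bounded.
\<close>

lemma limit_of_spans:
  fixes \<phi> :: "'i \<Rightarrow> nat \<Rightarrow> 'a \<Rightarrow> complex"
  assumes I: "finite I"
    and conv: "\<And>i z. i \<in> I \<Longrightarrow> z \<in> Z \<Longrightarrow> (\<lambda>n. \<phi> i n z) \<longlonglongrightarrow> \<phi>0 i z"
    and indep: "\<And>c i. (\<And>z. z \<in> Z \<Longrightarrow> (\<Sum>i\<in>I. c i * \<phi>0 i z) = 0) \<Longrightarrow> i \<in> I \<Longrightarrow> c i = 0"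
    and u: "\<And>n z. z \<in> Z \<Longrightarrow> u n z = (\<Sum>i\<in>I. c n i * \<phi> i n z)"
    and ulim: "\<And>z. z \<in> Z \<Longrightarrow> (\<lambda>n. u n z) \<longlonglongrightarrow> u0 z"
  shows "\<exists>a. \<forall>z\<in>Z. u0 z = (\<Sum>i\<in>I. a i * \<phi>0 i z)"
proof -
  define M where "M n = 1 + (\<Sum>i\<in>I. cmod (c n i))" for n
  have M: "M n \<ge> 1" "M n > 0" for n
    using sum_nonneg[of I "\<lambda>i. cmod (c n i)"] by (auto simp: M_def)
  define d where "d n x = (case x of None \<Rightarrow> complex_of_real (1 / M n) | Some i \<Rightarrow> c n i / M n)" for n x
  let ?J = "insert None (Some ` I)"
  have cM: "cmod (c n i) \<le> M n" if "i \<in> I" for n i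
    using member_le_sum[OF that, of "\<lambda>i. cmod (c n i)"] I by (auto simp: M_def)
  have dJ: "cmod (d n x) \<le> 1" if "x \<in> ?J" for n x
  proof (cases x)
    case None
    then show ?thesis using M[of n] by (simp add: d_def norm_divide)
  next
    case (Some i)
    then show ?thesis using that cM[of i n] M[of n] by (auto simp: d_def norm_divide)
  qed
  have "\<exists>r l. strict_mono r \<and> (\<forall>x\<in>?J. (\<lambda>n. d (r n) x) \<longlonglongrightarrow> l x)"
    by (rule bounded_family_subsequence) (simp add: I, rule dJ)
  then obtain r l where r: "strict_mono r" "\<And>x. x \<in> ?J \<Longrightarrow> (\<lambda>n. d (r n) x) \<longlonglongrightarrow> l x"
    by blast
  have ln: "(\<lambda>n. complex_of_real (1 / M (r n))) \<longlonglongrightarrow> l None"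
    using r(2)[of None] by (simp add: d_def)
  have ls: "(\<lambda>n. c (r n) i / M (r n)) \<longlonglongrightarrow> l (Some i)" if "i \<in> I" for i
    using r(2)[of "Some i"] that by (simp add: d_def)
  have eq: "l None * u0 z = (\<Sum>i\<in>I. l (Some i) * \<phi>0 i z)" if z: "z \<in> Z" for z
  proof (rule LIMSEQ_unique)
    show "(\<lambda>n. complex_of_real (1 / M (r n)) * u (r n) z) \<longlonglongrightarrow> l None * u0 z"
      using LIMSEQ_subseq_LIMSEQ[OF ulim[OF z] r(1)] by (intro tendsto_mult ln) (simp add: o_def)
    have "(\<lambda>n. \<Sum>i\<in>I. c (r n) i / M (r n) * \<phi> i (r n) z) \<longlonglongrightarrow> (\<Sum>i\<in>I. l (Some i) * \<phi>0 i z)"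
    proof (intro tendsto_sum tendsto_mult ls)
      fix i assume i: "i \<in> I"
      show "(\<lambda>n. \<phi> i (r n) z) \<longlonglongrightarrow> \<phi>0 i z"
        using LIMSEQ_subseq_LIMSEQ[OF conv[OF i z] r(1)] by (simp add: o_def)
    qed
    moreover have "(\<Sum>i\<in>I. c (r n) i / M (r n) * \<phi> i (r n) z) = complex_of_real (1 / M (r n)) * u (r n) z" for n
      unfolding u[OF z] by (simp add: sum_distrib_left)
    ultimately show "(\<lambda>n. complex_of_real (1 / M (r n)) * u (r n) z) \<longlonglongrightarrow> (\<Sum>i\<in>I. l (Some i) * \<phi>0 i z)"
      by simp
  qed
  \<comment> \<open>The norms of the normalised coefficients have sum 1, so not all limits vanish.
    By independence of the \<open>\<phi>0\<close> the limit belonging to \<open>u\<close> itself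
    cannot vanish, and one can divide by it.\<close>
  have tot: "cmod (l None) + (\<Sum>i\<in>I. cmod (l (Some i))) = 1"
  proof (rule LIMSEQ_unique)
    show "(\<lambda>n. cmod (complex_of_real (1 / M (r n))) + (\<Sum>i\<in>I. cmod (c (r n) i / M (r n)))) \<longlonglongrightarrow> cmod (l None) + (\<Sum>i\<in>I. cmod (l (Some i)))"
      by (intro tendsto_add tendsto_sum tendsto_norm ln ls)
    have "cmod (complex_of_real (1 / M (r n))) + (\<Sum>i\<in>I. cmod (c (r n) i / M (r n))) = 1" for n
    proof -
      have "cmod (complex_of_real (1 / M (r n))) + (\<Sum>i\<in>I. cmod (c (r n) i / M (r n))) = (1 + (\<Sum>i\<in>I. cmod (c (r n) i))) / M (r n)"
        using M[of "r n"] by (simp add: norm_divide sum_divide_distrib add_divide_distrib)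
      then show ?thesis using M[of "r n"] by (simp add: M_def)
    qed
    then show "(\<lambda>n. cmod (complex_of_real (1 / M (r n))) + (\<Sum>i\<in>I. cmod (c (r n) i / M (r n)))) \<longlonglongrightarrow> 1" by simp
  qed
  have "l None \<noteq> 0"
  proof
    assume 0: "l None = 0"
    then have "(\<Sum>i\<in>I. l (Some i) * \<phi>0 i z) = 0" if "z \<in> Z" for z using eq[OF that] by simp
    then have "l (Some i) = 0" if "i \<in> I" for i using indep[of "\<lambda>i. l (Some i)"] that by blast
    then show False using tot 0 by simp
  qed
  then have "u0 z = (\<Sum>i\<in>I. (l (Some i) / l None) * \<phi>0 i z)" if "z \<in> Z" for z
    using eq[OF that] by (simp add: sum_divide_distrib[symmetric] field_simps)
  then show ?thesis by (intro exI[of _ "\<lambda>i. l (Some i) / l None"]) blast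
qed

section \<open>Limits of forms on the curve and of cone forms\<close>

context curve_frame
begin

text \<open>\<open>limit_of_spans\<close> for a family not depending on \<open>n\<close>, namely a
  basis of the restrictions to \<open>Z\<close>: a finite-dimensional space of functions is closed
  under pointwise limits.\<close>

lemma span_limit_closed:
  assumes PY: "A \<subseteq> forms k" and u: "\<And>n z. z \<in> Z \<Longrightarrow> u n z = H n z" "\<And>n. H n \<in> cfun.span A"
    and ulim: "\<And>z. z \<in> Z \<Longrightarrow> (\<lambda>n. u n z) \<longlonglongrightarrow> u0 z"
  shows "\<exists>F\<in>cfun.span A. \<forall>z\<in>Z. u0 z = F z"
proof -
  obtain Y where Y: "finite Y" "forms k = cfun.span Y" using forms_finite_span by blast
  have "cfun.span A \<subseteq> forms k"
    unfolding Y(2) by (rule cfun.span_minimal) (use PY Y(2) cfun.subspace_span in auto)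
  then have sub: "rs ` cfun.span A \<subseteq> cfun.span (rs ` Y)" using rs_span Y(2) by blast
  obtain B where B: "B \<subseteq> rs ` cfun.span A" "finite B" "cfun.independent B" "rs ` cfun.span A \<subseteq> cfun.span B"
    by (rule cfun_basis[OF sub finite_imageI[OF Y(1)]])
  have off: "b z = 0" if "b \<in> B" "z \<notin> Z" for b z using that B(1) by (auto simp: rs_def)
  have "\<exists>c. rs (H n) = (\<lambda>z. \<Sum>b\<in>B. c b * b z)" for n
    using cfun_span_family[OF B(2), of "rs (H n)" "\<lambda>b. b"] B(4) u(2) by auto
  then obtain c where c: "\<And>n. rs (H n) = (\<lambda>z. \<Sum>b\<in>B. c n b * b z)" by metis
  have "\<exists>a. \<forall>z\<in>Z. u0 z = (\<Sum>b\<in>B. a b * b z)"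
  proof (rule limit_of_spans[where \<phi> = "\<lambda>b n z. b z" and c = c, OF B(2) _ _ _ ulim])
    fix c :: "cfun \<Rightarrow> complex" and b
    assume 0: "\<And>z. z \<in> Z \<Longrightarrow> (\<Sum>b\<in>B. c b * b z) = 0" and b: "b \<in> B"
    have "(\<Sum>b\<in>B. c b * b z) = 0" for z
    proof (cases "z \<in> Z")
      case False
      then show ?thesis by (intro sum.neutral) (simp add: off)
    qed (rule 0)
    then show "c b = 0" using cfun_independentD[OF B(3,2)] b by blast
  next
    fix n z assume z: "z \<in> Z"
    show "u n z = (\<Sum>b\<in>B. c n b * b z)"
      using fun_cong[OF c[of n], of z] u(1)[OF z] z by (simp add: rs_def)
  qed auto
  then obtain a where a: "\<And>z. z \<in> Z \<Longrightarrow> u0 z = (\<Sum>b\<in>B. a b * b z)" by blast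
  have "\<forall>b. \<exists>b'. b \<in> B \<longrightarrow> b' \<in> cfun.span A \<and> b = rs b'" using B(1) by blast
  then obtain b' where b': "\<And>b. b \<in> B \<Longrightarrow> b' b \<in> cfun.span A" "\<And>b. b \<in> B \<Longrightarrow> b = rs (b' b)" by metis
  have "b z = b' b z" if "b \<in> B" "z \<in> Z" for b z
    using fun_cong[OF b'(2)[OF that(1)], of z] that(2) by (simp add: rs_def)
  then have "\<forall>z\<in>Z. u0 z = (\<Sum>b\<in>B. a b * b' b z)" using a by auto
  moreover have "(\<lambda>z. \<Sum>b\<in>B. a b * b' b z) \<in> cfun.span A" by (intro cfun_span_sum cfun_span_scale b')
  ultimately show ?thesis by (intro bexI[of _ "\<lambda>z. \<Sum>b\<in>B. a b * b' b z"])
qed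

lemma pol_Suc_span:
  assumes "pol {y1, y2, y3} (Suc j) f"
  shows "f \<in> cfun.span {\<lambda>z. l z * h z |l h. l \<in> forms 1 \<and> pol {y1, y2, y3} j h}"
  using assms
proof (induction "Suc j" f rule: pol.induct)
  case pol_zero
  show ?case by (rule cfun_span_zero)
next
  case (pol_times l f)
  then have "l \<in> forms 1" using lin by auto
  then show ?case using pol_times by (intro cfun.span_base) blast
next
  case (pol_plus f g)
  then show ?case by (intro cfun_span_add)
qed

end

context projected_curve
begin

text \<open>The limits of the moved basis elements are dependent on the curve as soon as some cone
  forms vanish on it. Dividing those by \<open>t n\<close> replaces their limits by variations;
  \<open>vertex_derivative\<close> provides the independence that \<open>limit_of_spans\<close>
  requires.\<close>

lemma cone_limit:
  assumes d: "d \<ge> 3" and v: "y3 v \<noteq> 0"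
    and t: "t \<longlonglongrightarrow> 0" "\<And>n. t n \<noteq> 0"
    and u: "\<And>n z. z \<in> Z \<Longrightarrow> u n z = f n (mv v w (t n) z)" "\<And>n. pol {y1, y2, y3} (d - 1) (f n)"
    and ulim: "\<And>z. z \<in> Z \<Longrightarrow> (\<lambda>n. u n z) \<longlonglongrightarrow> u0 z"
  shows "\<exists>F\<in>cfun.span {\<lambda>z. l z * h z |l h. l \<in> forms 1 \<and> pol {y1, y2, y3} (d - 2) h}. \<forall>z\<in>Z. u0 z = F z"
proof -
  have d2: "d - 1 = Suc (d - 2)" using d by simp
  define V where "V = {f. pol {y1, y2, y3} (d - 1) f}"
  define K where "K = {f\<in>V. \<forall>z\<in>Z. f z = 0}"
  obtain Y where Y: "finite Y" "forms (d - 1) = cfun.span Y" using forms_finite_span by blast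
  have VY: "V \<subseteq> cfun.span Y" unfolding Y(2)[symmetric] V_def using pol_forms by blast
  obtain BK where BK: "BK \<subseteq> K" "finite BK" "cfun.independent BK" "K \<subseteq> cfun.span BK"
    by (rule cfun_basis[of K Y]) (use VY Y(1) in \<open>auto simp: K_def\<close>)
  have "BK \<subseteq> V" using BK(1) unfolding K_def by blast
  from cfun.maximal_independent_subset_extend[OF this BK(3)]
  obtain B where B: "BK \<subseteq> B" "B \<subseteq> V" "cfun.independent B" "V \<subseteq> cfun.span B" by blast
  have finB: "finite B" using cfun.independent_span_bound[OF Y(1) B(3)] B(2) VY by blast
  have polB: "pol {y1, y2, y3} (d - 1) b" if "b \<in> B" for b using that B(2) unfolding V_def by blast
  have BK0: "b z = 0" if "b \<in> BK" "z \<in> Z" for b z using that BK(1) unfolding K_def by blast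
  have "\<forall>b\<in>B. \<exists>b'. mvder v w b b' \<and>
     b' \<in> cfun.span {\<lambda>z. l z * h z |l h. l \<in> forms 1 \<and> pol {y1, y2, y3} (d - 2) h}"
  proof
    fix b assume "b \<in> B"
    from pol_mvder[OF polB[OF this, unfolded d2] subset_refl, of v w]
    show "\<exists>b'. mvder v w b b' \<and>
     b' \<in> cfun.span {\<lambda>z. l z * h z |l h. l \<in> forms 1 \<and> pol {y1, y2, y3} (d - 2) h}"
      by (simp only: nat.case)
  qed
  from bchoice[OF this] obtain D where D: "\<And>b. b \<in> B \<Longrightarrow> mvder v w b (D b)"
    "\<And>b. b \<in> B \<Longrightarrow> D b \<in> cfun.span {\<lambda>z. l z * h z |l h. l \<in> forms 1 \<and> pol {y1, y2, y3} (d - 2) h}"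
    by blast
  have "\<exists>a. f n = (\<lambda>z. \<Sum>b\<in>B. a b * b z)" for n
    using cfun_span_family[OF finB, of "f n" "\<lambda>b. b"] B(4) u(2) by (auto simp: V_def)
  then obtain a where a: "\<And>n. f n = (\<lambda>z. \<Sum>b\<in>B. a n b * b z)" by metis
  define \<phi> where "\<phi> b n z = (if b \<in> BK then b (mv v w (t n) z) / t n else b (mv v w (t n) z))" for b :: cfun and n z
  define \<phi>0 where "\<phi>0 b = (if b \<in> BK then D b else b)" for b
  have t0: "filterlim t (at 0) sequentially"
    unfolding filterlim_at using t by auto
  have "\<exists>c. \<forall>z\<in>Z. u0 z = (\<Sum>b\<in>B. c b * \<phi>0 b z)"
  proof (rule limit_of_spans[where \<phi> = \<phi> and c = "\<lambda>n b. if b \<in> BK then a n b * t n else a n b" and u = u, OF finB])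
    fix b z assume b: "b \<in> B" and z: "z \<in> Z"
    have der: "((\<lambda>s. b (mv v w s z)) has_field_derivative D b z) (at 0)"
      using D(1)[OF b] unfolding mvder_def by blast
    have b0: "b (mv v w 0 z) = b z" by (rule mv_0[OF polB[OF b]])
    show "(\<lambda>n. \<phi> b n z) \<longlonglongrightarrow> \<phi>0 b z"
    proof (cases "b \<in> BK")
      case True
      have "((\<lambda>s. b (mv v w s z) / s) \<longlongrightarrow> D b z) (at 0)"
        using der unfolding has_field_derivative_iff b0 BK0[OF True z] by simp
      from filterlim_compose[OF this t0] show ?thesis by (simp add: \<phi>_def \<phi>0_def True)
    next
      case False
      have "((\<lambda>s. b (mv v w s z)) \<longlongrightarrow> b z) (at 0)"
        using DERIV_isCont[OF der] unfolding isCont_def b0 .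
      from filterlim_compose[OF this t0] show ?thesis by (simp add: \<phi>_def \<phi>0_def False)
    qed
  next
    fix n z assume z: "z \<in> Z"
    show "u n z = (\<Sum>b\<in>B. (if b \<in> BK then a n b * t n else a n b) * \<phi> b n z)"
      unfolding u(1)[OF z] a by (intro sum.cong) (use t(2) in \<open>auto simp: \<phi>_def\<close>)
  next
    fix c :: "cfun \<Rightarrow> complex" and b
    assume zero: "\<And>z. z \<in> Z \<Longrightarrow> (\<Sum>b\<in>B. c b * \<phi>0 b z) = 0" and b: "b \<in> B"
    \<comment> \<open>\<open>\<kappa>\<close> collects the equations of the curve and
      \<open>\<eta>\<close> the rest. The relation says that the variation of
      \<open>\<kappa>\<close> is the cone form \<open>- \<eta>\<close> on the curve, so
      \<open>\<kappa>\<close> is zero. Then \<open>\<eta>\<close> vanishes on the curve as well, and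
      independence of \<open>B\<close> finishes.\<close>
    define \<kappa> where "\<kappa> z = (\<Sum>b\<in>BK. c b * b z)" for z
    define \<eta> where "\<eta> z = (\<Sum>b\<in>B - BK. c b * b z)" for z
    have split: "(\<Sum>b\<in>B. F b) = (\<Sum>b\<in>BK. F b) + (\<Sum>b\<in>B - BK. F b)" for F :: "cfun \<Rightarrow> complex"
      using sum.subset_diff[OF B(1) finB, of F] by (simp add: add.commute)
    have zero': "(\<Sum>b\<in>BK. c b * D b z) + \<eta> z = 0" if "z \<in> Z" for z
      using zero[OF that] unfolding split \<eta>_def by (simp add: \<phi>0_def)
    have "\<kappa> z = 0" for z
    proof (rule vertex_derivative[OF d])
      show "pol {y1, y2, y3} (d - 1) \<kappa>"
        unfolding \<kappa>_def by (intro pol_sum pol_scale polB) (use B(1) in blast)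
      show "\<kappa> z = 0" if "z \<in> Z" for z unfolding \<kappa>_def by (intro sum.neutral ballI) (simp add: BK0 that)
      show "mvder v w \<kappa> (\<lambda>z. \<Sum>b\<in>BK. c b * D b z)"
        unfolding \<kappa>_def by (intro mvder_sum mvder_scale D) (use B(1) in blast)
      show "pol {y1, y2, y3} (d - 1) (\<lambda>z. - \<eta> z)"
        unfolding \<eta>_def by (intro pol_uminus pol_sum pol_scale polB) blast
      show "(\<Sum>b\<in>BK. c b * D b z) = - \<eta> z" if "z \<in> Z" for z
        using zero'[OF that] by (simp add: eq_neg_iff_add_eq_0)
    qed (rule v)
    then have cBK: "c b = 0" if "b \<in> BK" for b
      using cfun_independentD[OF BK(3,2) _ that, of c] unfolding \<kappa>_def by blast
    have "pol {y1, y2, y3} (d - 1) \<eta>" unfolding \<eta>_def by (intro pol_sum pol_scale polB) blast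
    moreover have "\<eta> z = 0" if "z \<in> Z" for z using zero'[OF that] cBK by simp
    ultimately have "\<eta> \<in> cfun.span BK" using BK(4) by (auto simp: K_def V_def)
    then obtain a' where a': "\<eta> = (\<lambda>z. \<Sum>b\<in>BK. a' b * b z)"
      using cfun_span_family[OF BK(2), of \<eta> "\<lambda>b. b"] by auto
    have "(\<Sum>b\<in>B. (if b \<in> BK then - a' b else c b) * b z) = 0" for z
    proof -
      have "(\<Sum>b\<in>B. (if b \<in> BK then - a' b else c b) * b z) = - (\<Sum>b\<in>BK. a' b * b z) + \<eta> z"
        unfolding split \<eta>_def by (simp add: sum_negf)
      then show ?thesis using fun_cong[OF a', of z] by simp
    qed
    from cfun_independentD[OF B(3) finB this b] cBK show "c b = 0" by (auto split: if_splits)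
  qed (rule ulim)
  then obtain c where c: "\<And>z. z \<in> Z \<Longrightarrow> u0 z = (\<Sum>b\<in>B. c b * \<phi>0 b z)" by blast
  have "\<phi>0 b \<in> cfun.span {\<lambda>z. l z * h z |l h. l \<in> forms 1 \<and> pol {y1, y2, y3} (d - 2) h}" if "b \<in> B" for b
    using D(2)[OF that] pol_Suc_span polB[OF that] unfolding \<phi>0_def d2 by auto
  then have "(\<lambda>z. \<Sum>b\<in>B. c b * \<phi>0 b z) \<in> cfun.span {\<lambda>z. l z * h z |l h. l \<in> forms 1 \<and> pol {y1, y2, y3} (d - 2) h}"
    by (intro cfun_span_sum cfun_span_scale)
  with c show ?thesis by (intro bexI[of _ "\<lambda>z. \<Sum>b\<in>B. c b * \<phi>0 b z"]) auto
qed

end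

section \<open>Points, cones and tangent lines\<close>

lemma P3_eq_range:
  assumes "q \<in> P3" "z \<in> q" "z \<noteq> 0"
  shows "q = range (\<lambda>c. c *s z)"
proof -
  have q: "vec.subspace q" "vec.dim q = 1" using assms(1) by (auto simp: P3_def)
  have "vec.independent {z}" using assms(3) by simp
  then have "q \<subseteq> vec.span {z}"
    using vec.card_eq_dim[of "{z}" q] assms(2) q(2) by simp
  moreover have "vec.span {z} \<subseteq> q" using q(1) assms(2) by (simp add: vec.span_minimal)
  ultimately show ?thesis by (simp add: vec.span_singleton)
qed

lemma span_in_P3: "z \<noteq> 0 \<Longrightarrow> vec.span {z} \<in> P3"
  by (simp add: P3_def)

lemma P3_nonzero:
  assumes "q \<in> P3"
  obtains z where "z \<in> q" "z \<noteq> 0"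
proof -
  have "vec.dim q = 1" using assms by (simp add: P3_def)
  then have "\<not> q \<subseteq> {0}" by (metis vec.dim_eq_0 zero_neq_one)
  then show ?thesis using that by blast
qed

lemma vanishes_at_iff:
  assumes "q \<in> P3" "z \<in> q" "z \<noteq> 0" "F \<in> forms m"
  shows "vanishes_at F q \<longleftrightarrow> F z = 0"
proof
  assume "F z = 0"
  then show "vanishes_at F q"
    unfolding vanishes_at_def P3_eq_range[OF assms(1-3)] using forms_homog[OF assms(4)] by auto
qed (use assms(2) in \<open>auto simp: vanishes_at_def\<close>)

lemma cone_iff:
  assumes "C \<subseteq> P3"
  shows "z \<in> cone C \<longleftrightarrow> z \<noteq> 0 \<and> vec.span {z} \<in> C"
proof
  assume "z \<in> cone C"
  then obtain q where q: "q \<in> C" "z \<in> q" "z \<noteq> 0" unfolding cone_def by blast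
  then have "q = vec.span {z}" using P3_eq_range[of q z] assms by (auto simp: vec.span_singleton)
  then show "z \<noteq> 0 \<and> vec.span {z} \<in> C" using q by simp
next
  assume "z \<noteq> 0 \<and> vec.span {z} \<in> C"
  then show "z \<in> cone C" unfolding cone_def using vec.span_base[of z "{z}"] by blast
qed

lemma in_coneI: "q \<in> C \<Longrightarrow> z \<in> q \<Longrightarrow> z \<noteq> 0 \<Longrightarrow> z \<in> cone C"
  unfolding cone_def by blast

lemma zclosed_P3: "zclosed C \<Longrightarrow> C \<subseteq> P3"
  unfolding zclosed_def by blast

lemma ideal_of_iff:
  assumes "C \<subseteq> P3"
  shows "F \<in> ideal_of C m \<longleftrightarrow> F \<in> forms m \<and> (\<forall>z\<in>cone C. F z = 0)"
proof
  assume "F \<in> ideal_of C m"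
  then show "F \<in> forms m \<and> (\<forall>z\<in>cone C. F z = 0)"
    unfolding ideal_of_def vanishes_at_def cone_def by blast
next
  assume F: "F \<in> forms m \<and> (\<forall>z\<in>cone C. F z = 0)"
  have "vanishes_at F q" if "q \<in> C" for q
  proof -
    have q: "q \<in> P3" using that assms by blast
    obtain z where z: "z \<in> q" "z \<noteq> 0" by (rule P3_nonzero[OF q])
    have "F z = 0" using F in_coneI[OF that z] by blast
    then show ?thesis using vanishes_at_iff[OF q z] F by blast
  qed
  with F show "F \<in> ideal_of C m" unfolding ideal_of_def by blast
qed

text \<open>The zero loci of \<open>F\<close> and \<open>H\<close> are closed and together cover the
  curve.\<close>

lemma irreducible_product:
  assumes C: "irreducible_closed C" and F: "F \<in> forms a" and H: "H \<in> forms b"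
    and FH: "\<And>z. z \<in> cone C \<Longrightarrow> F z * H z = 0"
  shows "(\<forall>z\<in>cone C. F z = 0) \<or> (\<forall>z\<in>cone C. H z = 0)"
proof -
  have CP: "C \<subseteq> P3" using C zclosed_P3 unfolding irreducible_closed_def by blast
  have cl: "zclosed {q \<in> P3. \<forall>F\<in>{K}. vanishes_at F q}" if "K \<in> forms k" for K k
    unfolding zclosed_def using that by blast
  let ?A = "{q \<in> P3. \<forall>F\<in>{F}. vanishes_at F q}" and ?B = "{q \<in> P3. \<forall>F\<in>{H}. vanishes_at F q}"
  have "C \<subseteq> ?A \<union> ?B"
  proof
    fix q assume q: "q \<in> C"
    then have qP: "q \<in> P3" using CP by blast
    obtain z where z: "z \<in> q" "z \<noteq> 0" by (rule P3_nonzero[OF qP])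
    have "F z = 0 \<or> H z = 0" using FH[OF in_coneI[OF q z]] by simp
    then show "q \<in> ?A \<union> ?B" using vanishes_at_iff[OF qP z F] vanishes_at_iff[OF qP z H] qP by blast
  qed
  then have "C \<subseteq> ?A \<or> C \<subseteq> ?B" using C cl[OF F] cl[OF H] unfolding irreducible_closed_def by blast
  then show ?thesis unfolding cone_def vanishes_at_def by blast
qed

text \<open>The kernel of \<open>F\<close> has dimension 3, because \<open>u\<close> spans a
  complement.\<close>

lemma nondegenerate_linear:
  assumes "nondegenerate C" "F \<in> forms 1" "F u \<noteq> 0"
  shows "\<exists>z\<in>cone C. F z \<noteq> 0"
proof -
  let ?H = "{z. F z = 0}"
  have sub: "vec.subspace ?H"
    unfolding vec.subspace_def
    by (auto simp: forms1_zero[OF assms(2)] forms1_add[OF assms(2)] forms1_smult[OF assms(2)])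
  have "u \<notin> vec.span ?H" using assms(3) vec.span_eq_iff[THEN iffD2, OF sub] by (metis mem_Collect_eq)
  then have d1: "vec.dim (insert u ?H) = vec.dim ?H + 1" by (simp add: vec.dim_insert)
  have "vec.span (insert u ?H) = UNIV"
  proof -
    have "z \<in> vec.span (insert u ?H)" for z
    proof -
      have "F (z - (F z / F u) *s u) = 0"
        using assms(3) by (simp add: forms1_diff[OF assms(2)] forms1_smult[OF assms(2)])
      then have "z - (F z / F u) *s u \<in> vec.span (insert u ?H)" by (intro vec.span_base) simp
      moreover have "(F z / F u) *s u \<in> vec.span (insert u ?H)" by (intro vec.span_scale vec.span_base) simp
      ultimately show ?thesis using vec.span_add by fastforce
    qed
    then show ?thesis by blast
  qed
  then have "vec.dim (insert u ?H) = 4"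
    using vec.dim_span[of "insert u ?H"] vec_dim_card[where 'n = 4 and 'a = complex] by simp
  then have "?H \<in> planes" using d1 sub by (simp add: planes_def)
  then obtain q where "q \<in> C" "\<not> q \<subseteq> ?H" using assms(1) unfolding nondegenerate_def by blast
  then obtain z where "z \<in> q" "F z \<noteq> 0" by blast
  then show ?thesis using \<open>q \<in> C\<close> forms1_zero[OF assms(2)] in_coneI[of q C z] by metis
qed

lemma zclosed_cut:
  assumes "zclosed C" "z \<noteq> 0" "z \<notin> cone C"
  shows "\<exists>m. \<exists>h\<in>forms m. (\<forall>x\<in>cone C. h x = 0) \<and> h z \<noteq> 0"
proof -
  obtain T where T: "T \<subseteq> (\<Union>m. forms m)" "C = {q \<in> P3. \<forall>F\<in>T. vanishes_at F q}"
    using assms(1) unfolding zclosed_def by blast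
  have CP: "C \<subseteq> P3" using T(2) by blast
  have "vec.span {z} \<notin> C" using assms cone_iff[OF CP] by blast
  then obtain F where F: "F \<in> T" "\<not> vanishes_at F (vec.span {z})" using T(2) span_in_P3[OF assms(2)] by blast
  obtain m where m: "F \<in> forms m" using F(1) T(1) by blast
  have "F z \<noteq> 0"
    using vanishes_at_iff[OF span_in_P3[OF assms(2)] vec.span_base assms(2) m] F(2) by simp
  moreover have "\<forall>x\<in>cone C. F x = 0" using T(2) F(1) unfolding cone_def vanishes_at_def by blast
  ultimately show ?thesis using m by blast
qed

text \<open>Stated for arcs with a quadratic term because the vertex will move on such arcs; the
  term does not affect the derivative at 0.\<close>

lemma forms_gradient:
  assumes "F \<in> forms m"
  shows "\<exists>D\<in>forms 1. \<forall>v w. ((\<lambda>t. F (x + t *s v + t ^ 2 *s w)) has_field_derivative D v) (at 0)"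
proof -
  have "pol crd m F" using assms by (simp add: forms_iff)
  then show ?thesis
  proof (induction rule: pol.induct)
    case (pol_times l k f)
    then obtain D where D: "D \<in> forms 1" "\<And>v w. ((\<lambda>t. f (x + t *s v + t ^ 2 *s w)) has_field_derivative D v) (at 0)"
      by blast
    have l: "l \<in> forms 1" using pol_times(1) pol_var forms_iff by blast
    have E: "(\<lambda>v. l v * f x + l x * D v) \<in> forms 1"
      using forms_add[OF forms_scale[OF l, of "f x"] forms_scale[OF D(1), of "l x"]] by (simp add: mult.commute)
    show ?case
    proof (intro bexI[OF _ E] allI)
      fix v w
      have "((\<lambda>t. l (x + t *s v + t ^ 2 *s w)) has_field_derivative l v) (at 0)"
        unfolding forms1_add[OF l] forms1_smult[OF l] by (auto intro!: derivative_eq_intros)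
      from DERIV_mult[OF this D(2)[of v w]]
      show "((\<lambda>t. l (x + t *s v + t ^ 2 *s w) * f (x + t *s v + t ^ 2 *s w)) has_field_derivative l v * f x + l x * D v) (at 0)"
        by (simp add: algebra_simps)
    qed
  next
    case (pol_plus k f h)
    then obtain D D' where D: "D \<in> forms 1" "\<And>v w. ((\<lambda>t. f (x + t *s v + t ^ 2 *s w)) has_field_derivative D v) (at 0)"
      and D': "D' \<in> forms 1" "\<And>v w. ((\<lambda>t. h (x + t *s v + t ^ 2 *s w)) has_field_derivative D' v) (at 0)"
      by blast
    show ?case
      by (intro bexI[OF _ forms_add[OF D(1) D'(1)]] allI DERIV_add D D')
  qed (auto intro!: bexI[of _ "\<lambda>_. 0"] forms_zero)
qed

text \<open>By homogeneity the condition at one vector of \<open>p\<close> implies it at all nonzero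
  multiples.\<close>

lemma tangent_space_iff:
  assumes "p \<in> P3" "x \<in> p" "x \<noteq> 0"
  shows "v \<in> tangent_space C p \<longleftrightarrow> (\<forall>m. \<forall>F\<in>ideal_of C m. deriv (\<lambda>t. F (x + t *s v)) 0 = 0)"
proof
  assume "v \<in> tangent_space C p"
  then show "\<forall>m. \<forall>F\<in>ideal_of C m. deriv (\<lambda>t. F (x + t *s v)) 0 = 0"
    using assms(2,3) unfolding tangent_space_def by blast
next
  assume R: "\<forall>m. \<forall>F\<in>ideal_of C m. deriv (\<lambda>t. F (x + t *s v)) 0 = 0"
  have "deriv (\<lambda>t. F (y + t *s v)) 0 = 0" if F: "F \<in> ideal_of C m" and y: "y \<in> p - {0}" for m F y
  proof -
    obtain c where c: "y = c *s x" using y P3_eq_range[OF assms] by blast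
    have c0: "c \<noteq> 0" using y c by auto
    have Ff: "F \<in> forms m" using F unfolding ideal_of_def by blast
    obtain D where D: "\<And>v w. ((\<lambda>t. F (x + t *s v + t ^ 2 *s w)) has_field_derivative D v) (at 0)"
      using forms_gradient[OF Ff] by blast
    have "((\<lambda>t. F (x + t *s v)) has_field_derivative D v) (at 0)" using D[of v 0] by simp
    then have Dv: "((\<lambda>t. F (x + t *s v)) has_field_derivative 0) (at 0)"
      using DERIV_imp_deriv R F by metis
    have "((\<lambda>t. c ^ m * F (x + (t / c) *s v)) has_field_derivative c ^ m * (0 * (1 / c))) (at 0)"
    proof (rule DERIV_cmult, rule DERIV_chain2[where f = "\<lambda>t. F (x + t *s v)"])
      show "((\<lambda>t. F (x + t *s v)) has_field_derivative 0) (at (0 / c))" using Dv by simp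
      show "((\<lambda>t. t / c) has_field_derivative 1 / c) (at 0)" using DERIV_cdivide[OF DERIV_ident] by blast
    qed
    moreover have "c ^ m * F (x + (t / c) *s v) = F (y + t *s v)" for t
    proof -
      have "y + t *s v = c *s (x + (t / c) *s v)" using c0 by (simp add: c vec.scale_right_distrib)
      then show ?thesis by (simp only: forms_homog[OF Ff])
    qed
    ultimately have "((\<lambda>t. F (y + t *s v)) has_field_derivative 0) (at 0)" by simp
    then show ?thesis by (rule DERIV_imp_deriv)
  qed
  then show "v \<in> tangent_space C p" unfolding tangent_space_def by blast
qed

lemma ideal_gradient:
  assumes "F \<in> ideal_of C m"
  obtains D where "D \<in> forms 1"
    "\<And>v w. ((\<lambda>t. F (x + t *s v + t ^ 2 *s w)) has_field_derivative D v) (at 0)"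
    "\<And>v. deriv (\<lambda>t. F (x + t *s v)) 0 = D v"
proof -
  have "F \<in> forms m" using assms unfolding ideal_of_def by blast
  then obtain D where D: "D \<in> forms 1"
    "\<And>v w. ((\<lambda>t. F (x + t *s v + t ^ 2 *s w)) has_field_derivative D v) (at 0)"
    using forms_gradient by blast
  have "deriv (\<lambda>t. F (x + t *s v)) 0 = D v" for v
    using D(2)[of v 0] DERIV_imp_deriv by fastforce
  with D show ?thesis using that by blast
qed

lemma tangent_subspace:
  assumes "p \<in> P3"
  shows "vec.subspace (tangent_space C p)"
proof -
  obtain x where x: "x \<in> p" "x \<noteq> 0" by (rule P3_nonzero[OF assms])
  show ?thesis
    unfolding vec.subspace_def
  proof (intro conjI ballI allI)
    show "0 \<in> tangent_space C p" unfolding tangent_space_iff[OF assms x] by simp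
    fix u v assume u: "u \<in> tangent_space C p" and v: "v \<in> tangent_space C p"
    show "u + v \<in> tangent_space C p" unfolding tangent_space_iff[OF assms x]
    proof (intro allI ballI)
      fix m F assume F: "F \<in> ideal_of C m"
      obtain D where D: "D \<in> forms 1" "\<And>v. deriv (\<lambda>t. F (x + t *s v)) 0 = D v"
        by (rule ideal_gradient[OF F, of x]) blast
      then show "deriv (\<lambda>t. F (x + t *s (u + v))) 0 = 0"
        using u v F unfolding tangent_space_iff[OF assms x] by (metis add_0 forms1_add)
    qed
  next
    fix c v assume v: "v \<in> tangent_space C p"
    show "c *s v \<in> tangent_space C p" unfolding tangent_space_iff[OF assms x]
    proof (intro allI ballI)
      fix m F assume F: "F \<in> ideal_of C m"
      obtain D where D: "D \<in> forms 1" "\<And>v. deriv (\<lambda>t. F (x + t *s v)) 0 = D v"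
        by (rule ideal_gradient[OF F, of x]) blast
      then show "deriv (\<lambda>t. F (x + t *s (c *s v))) 0 = 0"
        using v F unfolding tangent_space_iff[OF assms x] by (metis mult_zero_right forms1_smult)
    qed
  qed
qed

text \<open>Along \<open>x + t *s x\<close> a form is a multiple of its value at \<open>x\<close>,
  as in Euler's relation.\<close>

lemma point_in_tangent:
  assumes "C \<subseteq> P3" "p \<in> C" "x \<in> p" "x \<noteq> 0"
  shows "x \<in> tangent_space C p"
proof -
  have p: "p \<in> P3" using assms by blast
  have "deriv (\<lambda>t. F (x + t *s x)) 0 = 0" if F: "F \<in> ideal_of C m" for F m
  proof -
    have Fx: "F x = 0" "F \<in> forms m" using F assms in_coneI unfolding ideal_of_iff[OF assms(1)] by blast+
    have "F (x + t *s x) = 0" for t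
    proof -
      have "x + t *s x = (1 + t) *s x" by (simp add: vec.scale_left_distrib)
      then have "F (x + t *s x) = (1 + t) ^ m * F x" by (simp only: forms_homog[OF Fx(2)])
      then show ?thesis using Fx(1) by simp
    qed
    then show ?thesis by simp
  qed
  then show ?thesis unfolding tangent_space_iff[OF p assms(3,4)] by blast
qed

text \<open>A basis of \<open>t\<close> starting with \<open>e0\<close> is extended to the whole
  space; the linear forms are the coordinates with respect to it.\<close>

lemma adapted_frame_exists:
  assumes t: "vec.subspace t" "vec.dim t = 2" and e0: "e0 \<in> t" "e0 \<noteq> 0"
  obtains e1 e2 e3 x0 y1 y2 y3 where "adapted_frame e0 e1 e2 e3 x0 y1 y2 y3"
    "\<And>z. z \<in> t \<longleftrightarrow> y2 z = 0 \<and> y3 z = 0"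
proof -
  have "vec.independent {e0}" "{e0} \<subseteq> t" using e0 by auto
  from vec.maximal_independent_subset_extend[OF this(2,1)]
  obtain B1 where B1: "{e0} \<subseteq> B1" "B1 \<subseteq> t" "vec.independent B1" "t \<subseteq> vec.span B1" by blast
  have c1: "card B1 = 2" using vec.basis_card_eq_dim[OF B1(2,4,3)] t(2) by simp
  then have fB1: "finite B1" by (simp add: card_ge_0_finite)
  have "card (B1 - {e0}) = 1" using c1 B1(1) fB1 by (simp add: card_Diff_singleton)
  then obtain e1 where e1: "B1 - {e0} = {e1}" by (auto simp: card_1_singleton_iff)
  then have B1e: "B1 = {e0, e1}" "e1 \<noteq> e0" using B1(1) by auto
  obtain B where B: "B1 \<subseteq> B" "vec.independent B" "UNIV \<subseteq> vec.span B"
    by (rule vec.maximal_independent_subset_extend[OF subset_UNIV B1(3)])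
  have c: "card B = 4"
    using vec.basis_card_eq_dim[OF subset_UNIV B(3,2)] vec_dim_card[where 'n = 4 and 'a = complex] by simp
  then have fB: "finite B" by (simp add: card_ge_0_finite)
  have "card (B - B1) = 2" using c c1 B(1) fB fB1 by (simp add: card_Diff_subset)
  then obtain e2 e3 where e23: "B - B1 = {e2, e3}" "e2 \<noteq> e3" by (auto simp: card_2_iff)
  then have Be: "B = {e0, e1, e2, e3}" using B(1) B1e by blast
  have ne: "e0 \<noteq> e1" "e0 \<noteq> e2" "e0 \<noteq> e3" "e1 \<noteq> e2" "e1 \<noteq> e3" "e2 \<noteq> e3"
    using e23 B1e by auto
  have sp: "v \<in> vec.span B" for v using B(3) by blast
  define \<phi> where "\<phi> b z = vec.representation B z b" for b z
  have \<phi>f: "\<phi> b \<in> forms 1" for b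
    by (rule forms1I) (simp_all add: \<phi>_def vec.representation_add[OF B(2) sp sp] vec.representation_scale[OF B(2) sp])
  have \<phi>b: "\<phi> b b' = (if b = b' then 1 else 0)" if "b' \<in> B" for b b'
    unfolding \<phi>_def by (simp add: vec.representation_basis[OF B(2) that])
  have exp: "z = \<phi> e0 z *s e0 + \<phi> e1 z *s e1 + \<phi> e2 z *s e2 + \<phi> e3 z *s e3" for z
  proof -
    have "(\<Sum>b\<in>B. \<phi> b z *s b) = z"
      unfolding \<phi>_def by (rule vec.sum_representation_eq[OF B(2) sp fB]) simp
    then show ?thesis unfolding Be using ne by (simp add: add.assoc)
  qed
  have "adapted_frame e0 e1 e2 e3 (\<phi> e0) (\<phi> e1) (\<phi> e2) (\<phi> e3)"
  proof
    fix F z assume F: "F \<in> forms 1"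
    have "F z = F (\<phi> e0 z *s e0 + \<phi> e1 z *s e1 + \<phi> e2 z *s e2 + \<phi> e3 z *s e3)" by (rule arg_cong[OF exp])
    then show "F z = F e0 * \<phi> e0 z + F e1 * \<phi> e1 z + F e2 * \<phi> e2 z + F e3 * \<phi> e3 z"
      by (simp add: forms1_add[OF F] forms1_smult[OF F] mult.commute)
  qed (use \<phi>f \<phi>b ne in \<open>auto simp: Be\<close>)
  moreover have "z \<in> t \<longleftrightarrow> \<phi> e2 z = 0 \<and> \<phi> e3 z = 0" for z
  proof
    assume "z \<in> t"
    then have "z \<in> vec.span {e0, e1}" using B1(4) B1e by blast
    then obtain a b where "z = a *s e0 + b *s e1"
      by (auto simp: vec.span_breakdown_eq vec.span_singleton algebra_simps)
    then show "\<phi> e2 z = 0 \<and> \<phi> e3 z = 0"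
      using ne by (simp add: forms1_add[OF \<phi>f] forms1_smult[OF \<phi>f] \<phi>b Be)
  next
    assume "\<phi> e2 z = 0 \<and> \<phi> e3 z = 0"
    then have "z = \<phi> e0 z *s e0 + \<phi> e1 z *s e1" using exp[of z] by simp
    moreover have "e1 \<in> t" using B1e B1(2) by blast
    ultimately show "z \<in> t" using t(1) e0(1) by (metis vec.subspace_add vec.subspace_scale)
  qed
  ultimately show ?thesis using that by blast
qed

section \<open>Local equations of the curve at the point\<close>

context adapted_frame
begin

text \<open>At \<open>e0\<close> the factors \<open>y1, y2, y3\<close> vanish, so the product rule
  leaves the values of the cofactors there.\<close>

lemma gradient_expansion:
  assumes F: "F1 \<in> forms j" "F2 \<in> forms j" "F3 \<in> forms j"
    "\<And>z. F z = y1 z * F1 z + y2 z * F2 z + y3 z * F3 z"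
    and D: "((\<lambda>t. F (e0 + t *s v)) has_field_derivative D) (at 0)"
  shows "D = y1 v * F1 e0 + y2 v * F2 e0 + y3 v * F3 e0"
proof -
  have y: "l (e0 + t *s v) = t * l v" if "l \<in> forms 1" "l e0 = 0" for l t
    using that by (simp add: forms1_add forms1_smult)
  have E: "\<exists>D. ((\<lambda>t. H (e0 + t *s v)) has_field_derivative D) (at 0)" if H: "H \<in> forms j" for H
  proof -
    obtain D where "\<And>v w. ((\<lambda>t. H (e0 + t *s v + t ^ 2 *s w)) has_field_derivative D v) (at 0)"
      using forms_gradient[OF H] by blast
    from this[of v 0] show ?thesis by auto
  qed
  obtain D1 D2 D3 where D': "((\<lambda>t. F1 (e0 + t *s v)) has_field_derivative D1) (at 0)"
    "((\<lambda>t. F2 (e0 + t *s v)) has_field_derivative D2) (at 0)"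
    "((\<lambda>t. F3 (e0 + t *s v)) has_field_derivative D3) (at 0)"
    using E[OF F(1)] E[OF F(2)] E[OF F(3)] by blast
  have l: "((\<lambda>t. t * a) has_field_derivative a) (at 0)" for a :: complex
    by (auto intro!: derivative_eq_intros)
  have eq: "F (e0 + t *s v) = t * y1 v * F1 (e0 + t *s v) + t * y2 v * F2 (e0 + t *s v) + t * y3 v * F3 (e0 + t *s v)" for t
    unfolding F(4) y[OF lin(2) dual(5)] y[OF lin(3) dual(9)] y[OF lin(4) dual(13)] ..
  have "((\<lambda>t. t * y1 v * F1 (e0 + t *s v) + t * y2 v * F2 (e0 + t *s v) + t * y3 v * F3 (e0 + t *s v)) has_field_derivative
     y1 v * F1 e0 + y2 v * F2 e0 + y3 v * F3 e0) (at 0)"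
    using DERIV_add[OF DERIV_add[OF DERIV_mult[OF l[of "y1 v"] D'(1)] DERIV_mult[OF l[of "y2 v"] D'(2)]] DERIV_mult[OF l[of "y3 v"] D'(3)]]
    by (simp add: algebra_simps)
  then show ?thesis using D unfolding eq by (rule DERIV_unique[THEN sym])
qed

text \<open>
  Two equations of the curve with independent differentials modulo the tangent line
  express \<open>y2\<close> and \<open>y3\<close>, up to units, as multiples of \<open>y1\<close> (Cramer's rule), the factor
  again vanishing at the point.
\<close>

lemma local_parameters:
  assumes A: "A \<in> forms ma" "\<And>z. z \<in> Z \<Longrightarrow> A z = 0"
    and B: "B \<in> forms mb" "\<And>z. z \<in> Z \<Longrightarrow> B z = 0"
    and e0: "e0 \<in> Z"
    and DA: "\<And>v. ((\<lambda>t. A (e0 + t *s v)) has_field_derivative DA v) (at 0)"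
    and DB: "\<And>v. ((\<lambda>t. B (e0 + t *s v)) has_field_derivative DB v) (at 0)"
    and e1: "DA e1 = 0" "DB e1 = 0" and det: "DA e2 * DB e3 - DA e3 * DB e2 \<noteq> 0"
  shows "\<exists>g. \<exists>G\<in>forms (Suc g). \<exists>E2\<in>forms g. \<exists>E3\<in>forms g. G e0 \<noteq> 0 \<and>
    (\<forall>z\<in>Z. G z * y2 z = y1 z ^ 2 * E2 z \<and> G z * y3 z = y1 z ^ 2 * E3 z)"
proof -
  have ex: "\<exists>F1 F2 F3. F1 \<in> forms m \<and> F2 \<in> forms m \<and> F3 \<in> forms m \<and>
      (\<forall>z\<in>Z. y1 z * F1 z + y2 z * F2 z + y3 z * F3 z = 0) \<and>
      F1 e0 = D e1 \<and> F2 e0 = D e2 \<and> F3 e0 = D e3"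
    if F: "F \<in> forms m" "\<And>z. z \<in> Z \<Longrightarrow> F z = 0" and D: "\<And>v. ((\<lambda>t. F (e0 + t *s v)) has_field_derivative D v) (at 0)"
    for F m D
  proof -
    \<comment> \<open>The factor \<open>x0\<close>, which is 1 at \<open>e0\<close>, makes the
      degree positive, as \<open>expand0\<close> demands; since \<open>F\<close> vanishes at
      \<open>e0\<close>, the differential is unchanged.\<close>
    define H where "H z = x0 z * F z" for z
    have Hf: "H \<in> forms (Suc m)" unfolding H_def by (rule forms_mult'[OF lin(1) F(1)]) simp
    have H0: "H e0 = 0" using F(2)[OF e0] by (simp add: H_def)
    obtain F1 F2 F3 where F': "F1 \<in> forms m" "F2 \<in> forms m" "F3 \<in> forms m"
      "\<And>z. H z = H e0 * x0 z ^ Suc m + y1 z * F1 z + y2 z * F2 z + y3 z * F3 z"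
      using expand0[OF Hf] by blast
    have H: "H z = y1 z * F1 z + y2 z * F2 z + y3 z * F3 z" for z
      using F'(4)[of z] H0 by simp
    have DH: "((\<lambda>t. H (e0 + t *s v)) has_field_derivative D v) (at 0)" for v
    proof -
      have "((\<lambda>t. x0 (e0 + t *s v)) has_field_derivative x0 v) (at 0)"
        unfolding forms1_add[OF lin(1)] forms1_smult[OF lin(1)] by (auto intro!: derivative_eq_intros)
      from DERIV_mult[OF this D[of v]] show ?thesis
        unfolding H_def using F(2)[OF e0] dual(1) by simp
    qed
    note gr = gradient_expansion[OF F'(1-3) H DH]
    have "y1 z * F1 z + y2 z * F2 z + y3 z * F3 z = 0" if "z \<in> Z" for z
      using H[of z] F(2)[OF that] by (simp add: H_def)
    then show ?thesis using F'(1-3) gr[of e1] gr[of e2] gr[of e3] dual by auto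
  qed
  obtain A1 A2 A3 where A': "A1 \<in> forms ma" "A2 \<in> forms ma" "A3 \<in> forms ma"
    "\<And>z. z \<in> Z \<Longrightarrow> y1 z * A1 z + y2 z * A2 z + y3 z * A3 z = 0"
    "A1 e0 = 0" "A2 e0 = DA e2" "A3 e0 = DA e3"
    using ex[OF A DA] e1 by metis
  obtain B1 B2 B3 where B': "B1 \<in> forms mb" "B2 \<in> forms mb" "B3 \<in> forms mb"
    "\<And>z. z \<in> Z \<Longrightarrow> y1 z * B1 z + y2 z * B2 z + y3 z * B3 z = 0"
    "B1 e0 = 0" "B2 e0 = DB e2" "B3 e0 = DB e3"
    using ex[OF B DB] e1 by metis
  define n where "n = ma + mb"
  \<comment> \<open>The determinants of Cramer's rule for the two relations, again with a factor
    \<open>x0\<close> for the sake of \<open>expand0\<close>.\<close>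
  define \<Delta> where "\<Delta> z = x0 z * (A2 z * B3 z - A3 z * B2 z)" for z
  define P2 where "P2 z = x0 z * (A3 z * B1 z - A1 z * B3 z)" for z
  define P3' where "P3' z = x0 z * (B2 z * A1 z - A2 z * B1 z)" for z
  have f: "\<Delta> \<in> forms (Suc n)"
    unfolding \<Delta>_def n_def
    by (rule forms_mult'[OF lin(1) forms_diff[OF forms_mult[OF A'(2) B'(3)] forms_mult[OF A'(3) B'(2)]]]) simp
  have f2: "P2 \<in> forms (Suc n)"
    unfolding P2_def n_def
    by (rule forms_mult'[OF lin(1) forms_diff[OF forms_mult[OF A'(3) B'(1)] forms_mult[OF A'(1) B'(3)]]]) simp
  have f3: "P3' \<in> forms (Suc n)"
    unfolding P3'_def n_def
    by (rule forms_mult'[OF lin(1) forms_diff[OF forms_mult'[OF B'(2) A'(1)] forms_mult[OF A'(2) B'(1)]]]) simp_all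
  have \<Delta>0: "\<Delta> e0 \<noteq> 0" using det by (simp add: \<Delta>_def dual A' B')
  have P0: "P2 e0 = 0" "P3' e0 = 0" by (simp_all add: P2_def P3'_def A' B')
  have cr: "\<Delta> z * y2 z = y1 z * P2 z" "\<Delta> z * y3 z = y1 z * P3' z" if z: "z \<in> Z" for z
  proof -
    have a: "y1 z * A1 z = - (y2 z * A2 z + y3 z * A3 z)" and b: "y1 z * B1 z = - (y2 z * B2 z + y3 z * B3 z)"
      using A'(4)[OF z] B'(4)[OF z] unfolding eq_neg_iff_add_eq_0 by (simp_all only: add.assoc)
    have "y1 z * P2 z = x0 z * (A3 z * (y1 z * B1 z) - (y1 z * A1 z) * B3 z)"
      by (simp add: P2_def algebra_simps)
    then show "\<Delta> z * y2 z = y1 z * P2 z" unfolding a b by (simp add: \<Delta>_def algebra_simps)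
    have "y1 z * P3' z = x0 z * (B2 z * (y1 z * A1 z) - A2 z * (y1 z * B1 z))"
      by (simp add: P3'_def algebra_simps)
    then show "\<Delta> z * y3 z = y1 z * P3' z" unfolding a b by (simp add: \<Delta>_def algebra_simps)
  qed
  \<comment> \<open>\<open>P2\<close> and \<open>P3'\<close> vanish at \<open>e0\<close>, so
    \<open>\<Delta>\<close> times each of them is once more a multiple of \<open>y1\<close> on the
    curve. This accounts for \<open>y1 ^ 2\<close> and for the square of
    \<open>\<Delta>\<close>.\<close>
  define G where "G z = \<Delta> z * \<Delta> z" for z
  have quad: "\<exists>E\<in>forms (Suc n + n). \<forall>z\<in>Z. \<Delta> z * P z = y1 z * E z" if P: "P \<in> forms (Suc n)" "P e0 = 0" for P
  proof -
    obtain a1 a2 a3 where a: "a1 \<in> forms n" "a2 \<in> forms n" "a3 \<in> forms n"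
      "\<And>z. P z = P e0 * x0 z ^ Suc n + y1 z * a1 z + y2 z * a2 z + y3 z * a3 z"
      using expand0[OF P(1)] by blast
    have Pz: "P z = y1 z * a1 z + y2 z * a2 z + y3 z * a3 z" for z using a(4)[of z] P(2) by simp
    show ?thesis
    proof (intro bexI ballI)
      show "(\<lambda>z. \<Delta> z * a1 z + P2 z * a2 z + P3' z * a3 z) \<in> forms (Suc n + n)"
        by (intro forms_add forms_mult f f2 f3 a)
      fix z assume z: "z \<in> Z"
      have "\<Delta> z * P z = y1 z * (\<Delta> z * a1 z) + (\<Delta> z * y2 z) * a2 z + (\<Delta> z * y3 z) * a3 z"
        unfolding Pz by (simp add: algebra_simps)
      then show "\<Delta> z * P z = y1 z * (\<Delta> z * a1 z + P2 z * a2 z + P3' z * a3 z)"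
        unfolding cr[OF z] by (simp add: algebra_simps)
    qed
  qed
  obtain E2 where E2: "E2 \<in> forms (Suc n + n)" "\<And>z. z \<in> Z \<Longrightarrow> \<Delta> z * P2 z = y1 z * E2 z"
    using quad[OF f2 P0(1)] by blast
  obtain E3 where E3: "E3 \<in> forms (Suc n + n)" "\<And>z. z \<in> Z \<Longrightarrow> \<Delta> z * P3' z = y1 z * E3 z"
    using quad[OF f3 P0(2)] by blast
  show ?thesis
  proof (rule exI[of _ "Suc n + n"], rule bexI[of _ G], rule bexI[OF _ E2(1)], rule bexI[OF _ E3(1)],
      intro conjI ballI)
    show "G \<in> forms (Suc (Suc n + n))" unfolding G_def by (rule forms_mult'[OF f f]) simp
    show "G e0 \<noteq> 0" using \<Delta>0 by (simp add: G_def)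
    fix z assume z: "z \<in> Z"
    have "G z * y2 z = \<Delta> z * (\<Delta> z * y2 z)" by (simp add: G_def)
    also have "\<dots> = y1 z * (\<Delta> z * P2 z)" unfolding cr(1)[OF z] by simp
    finally show "G z * y2 z = y1 z ^ 2 * E2 z" unfolding E2(2)[OF z] by (simp add: power2_eq_square)
    have "G z * y3 z = \<Delta> z * (\<Delta> z * y3 z)" by (simp add: G_def)
    also have "\<dots> = y1 z * (\<Delta> z * P3' z)" unfolding cr(2)[OF z] by simp
    finally show "G z * y3 z = y1 z ^ 2 * E3 z" unfolding E3(2)[OF z] by (simp add: power2_eq_square)
  qed
qed

text \<open>Makes the osculating plane a coordinate plane; \<open>c\<close> will be the quotient of
  the leading coefficients of \<open>y3\<close> and \<open>y2\<close> at the point.\<close>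

lemma shear: "adapted_frame e0 e1 (e2 + c *s e3) e3 x0 y1 y2 (\<lambda>z. y3 z - c * y2 z)"
proof
  show "(\<lambda>z. y3 z - c * y2 z) \<in> forms 1" by (intro forms_diff forms_scale lin)
  fix F z assume F: "F \<in> forms 1"
  show "F z = F e0 * x0 z + F e1 * y1 z + F (e2 + c *s e3) * y2 z + F e3 * (y3 z - c * y2 z)"
    by (subst lin_expand[OF F]) (simp add: forms1_add[OF F] forms1_smult[OF F] algebra_simps)
qed (simp_all add: lin[unfolded One_nat_def] dual forms1_add[OF lin(1)] forms1_add[OF lin(2)] forms1_add[OF lin(3)]
  forms1_add[OF lin(4)] forms1_smult[OF lin(1)] forms1_smult[OF lin(2)] forms1_smult[OF lin(3)] forms1_smult[OF lin(4)])

text \<open>Serves to make \<open>y2\<close> a coordinate of order exactly 2.\<close>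

lemma swap: "adapted_frame e0 e1 e3 e2 x0 y1 y3 y2"
proof
  fix F z assume F: "F \<in> forms 1"
  show "F z = F e0 * x0 z + F e1 * y1 z + F e3 * y3 z + F e2 * y2 z"
    by (subst lin_expand[OF F]) simp
qed (simp_all add: lin[unfolded One_nat_def] dual)

end

section \<open>Orders of vanishing and the hypotheses on the tangent line\<close>

lemma ideal_powI:
  assumes "\<And>i. i < k \<Longrightarrow> f i \<in> ideal_of Z (e i)" "h \<in> forms j" "(\<Sum>i<k. e i) + j = m"
  shows "(\<lambda>x. (\<Prod>i<k. f i x) * h x) \<in> ideal_pow Z k m"
  unfolding ideal_pow_def using assms by (intro cfun.span_base) blast

lemma ord_at_ge: "vanishes_to_order C k p n u \<Longrightarrow> enat n \<le> ord_at C k p u"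
  unfolding ord_at_def by (rule Sup_upper) blast

lemma ideal_of_point: "p \<in> P3 \<Longrightarrow> x \<in> p \<Longrightarrow> x \<noteq> 0 \<Longrightarrow> F \<in> forms m \<Longrightarrow> F x = 0 \<Longrightarrow> F \<in> ideal_of {p} m"
  unfolding ideal_of_def using vanishes_at_iff by blast

lemma restr_cone: "z \<in> cone C \<Longrightarrow> restr C F z = F z"
  by (simp add: restr_def)

text \<open>If \<open>q\<close> lay on \<open>t\<close>, all linear forms vanishing on
  \<open>t\<close> would have order at least 1 at \<open>q\<close>.\<close>

lemma not_in_tangent:
  assumes C: "C \<subseteq> P3" and q: "q \<in> C" and i0: "intersection_mult C t q = 0"
  shows "\<not> q \<subseteq> t"
proof
  assume qt: "q \<subseteq> t"
  have "intersection_mult C t q < 1" using i0 by simp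
  then obtain l where l: "l \<in> forms 1" "vanishes_at l t" "ord_at C 1 q (restr C l) < 1"
    unfolding intersection_mult_def INF_less_iff by blast
  have lq: "l \<in> ideal_of {q} 1" using l qt unfolding ideal_of_def vanishes_at_def by blast
  have "(\<lambda>x. (\<Prod>i<(1::nat). l x) * 1) \<in> ideal_pow {q} 1 1"
    by (rule ideal_powI[where k = 1 and f = "\<lambda>_. l" and e = "\<lambda>_. 1" and h = "\<lambda>_. 1" and j = 0]) (use lq forms_const in auto)
  then have lp: "l \<in> ideal_pow {q} 1 (0 + 1)" by simp
  have "vanishes_to_order C 1 q 1 (restr C l)"
    unfolding vanishes_to_order_def
  proof (intro exI[of _ 0] bexI[OF _ lp] bexI[of _ "\<lambda>_. 1"] conjI ballI impI)
    show "\<not> vanishes_at (\<lambda>_. 1) q"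
      using P3_nonzero[of q] q C unfolding vanishes_at_def by (metis subsetD zero_neq_one)
    show "(\<lambda>_. 1) \<in> forms 0" by (rule forms_const)
  qed (simp add: restr_cone)
  from ord_at_ge[OF this] l(3) show False by (simp add: one_enat_def)
qed

lemma tangent_order_two:
  assumes "intersection_mult C t p = 2"
  obtains l where "l \<in> forms 1" "vanishes_at l t" "\<not> vanishes_to_order C 1 p 3 (restr C l)"
proof -
  have "(2::enat) < 3" by simp
  then have "intersection_mult C t p < 3" using assms by simp
  then obtain l where l: "l \<in> forms 1" "vanishes_at l t" "ord_at C 1 p (restr C l) < 3"
    unfolding intersection_mult_def INF_less_iff by blast
  have "\<not> vanishes_to_order C 1 p 3 (restr C l)"
  proof
    assume "vanishes_to_order C 1 p 3 (restr C l)"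
    from ord_at_ge[OF this] have "3 \<le> ord_at C 1 p (restr C l)" by (simp add: numeral_eq_enat)
    then show False using l(3) by simp
  qed
  then show ?thesis using that l by blast
qed

text \<open>The inverse sends \<open>z\<close> to a multiple of \<open>z\<close> wherever
  \<open>B\<close> and \<open>y1\<close> are nonzero. Comparing the coordinates \<open>x0\<close>
  and \<open>y1\<close> gives \<open>x0 Q0 = y1 R0\<close> there, and on the whole curve by
  irreducibility. Multiplying by \<open>y1\<close> makes the degree of \<open>Q\<close>
  positive.\<close>

lemma birational_inverse:
  assumes C: "irreducible_closed C" "nondegenerate C" and p: "p \<in> C" and bir: "proj_birational C p"
    and fr: "adapted_frame e0 e1 e2 e3 x0 y1 y2 y3" and e0: "e0 \<in> p" "e0 \<noteq> 0"
  obtains m Q P where "pol {y1, y2, y3} (Suc m) Q" "\<exists>z\<in>cone C. Q z \<noteq> 0" "pol {y1, y2, y3} (Suc (Suc m)) P"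
    "\<And>z. z \<in> cone C \<Longrightarrow> x0 z * Q z = P z"
proof -
  interpret adapted_frame e0 e1 e2 e3 x0 y1 y2 y3 by (rule fr)
  have CP: "C \<subseteq> P3" using C zclosed_P3 unfolding irreducible_closed_def by blast
  then have pP: "p \<in> P3" using p by blast
  have pe: "p = range (\<lambda>c. c *s e0)" by (rule P3_eq_range[OF pP e0])
  obtain m G j B where G: "\<And>i. G i \<in> Wk p m" and B: "B \<in> forms j" "\<exists>x\<in>C. \<not> vanishes_at B x"
    "\<And>x z. x \<in> C \<Longrightarrow> \<not> vanishes_at B x \<Longrightarrow> z \<in> proj_from C p x - p \<Longrightarrow> (\<chi> i. G i z) \<in> x - {0}"
    using bir unfolding proj_birational_def by blast
  have Wp: "pol {y1, y2, y3} 1 l" if "l \<in> W p" for l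
  proof -
    have l: "l \<in> forms 1" "l e0 = 0" using that e0(1) unfolding W_iff by auto
    have "l z = l e1 * y1 z + l e2 * y2 z + l e3 * y3 z" for z using lin_expand[OF l(1), of z] l(2) by simp
    then have "l = (\<lambda>z. l e1 * y1 z + l e2 * y2 z + l e3 * y3 z)" by (rule ext)
    moreover have "pol {y1, y2, y3} 1 (\<lambda>z. l e1 * y1 z + l e2 * y2 z + l e3 * y3 z)"
      by (intro pol_plus pol_scale pol_var) auto
    ultimately show ?thesis by metis
  qed
  have Gp: "pol {y1, y2, y3} m (G i)" for i
    using G[of i] unfolding Wk_iff by (rule pol_trans[OF _ Wp])
  have comb: "l (\<chi> i. G i z) = (\<Sum>i\<in>UNIV. l (axis i 1) * G i z)" if "l \<in> forms 1" for l z
    using that unfolding forms1_iff by (metis (no_types, lifting) sum.cong vec_lambda_beta)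
  define Q0 where "Q0 z = y1 (\<chi> i. G i z)" for z
  define R0 where "R0 z = x0 (\<chi> i. G i z)" for z
  have Q0: "pol {y1, y2, y3} m Q0" "pol {y1, y2, y3} m R0"
    unfolding Q0_def R0_def comb[OF lin(1)] comb[OF lin(2)] by (intro pol_sum pol_scale Gp)+
  have rel: "\<exists>c. c \<noteq> 0 \<and> Q0 z = c * y1 z \<and> R0 z = c * x0 z" if z: "z \<in> cone C" "B z \<noteq> 0" "y1 z \<noteq> 0" for z
  proof -
    define q where "q = vec.span {z}"
    have q: "q \<in> C" "z \<noteq> 0" using z(1) cone_iff[OF CP] q_def by auto
    have zq: "z \<in> q" unfolding q_def by (rule vec.span_base) simp
    \<comment> \<open>\<open>y1\<close> vanishes on \<open>p\<close>, so \<open>z\<close> spans,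
      modulo \<open>p\<close>, the line through \<open>p\<close> and \<open>q\<close> at which the
      inverse is evaluated.\<close>
    have zp: "z \<notin> p" using z(3) dual forms1_smult[OF lin(2)] unfolding pe by auto
    then have "q \<noteq> p" using zq by blast
    then have "z \<in> proj_from C p q - p" using zq zp vec.span_base[of z "p \<union> q"] by (simp add: proj_from_def)
    moreover have "\<not> vanishes_at B q" using z(2) zq unfolding vanishes_at_def by blast
    ultimately have "(\<chi> i. G i z) \<in> q - {0}" using B(3) q(1) by blast
    then obtain c where "(\<chi> i. G i z) = c *s z" "(\<chi> i. G i z) \<noteq> 0" unfolding q_def vec.span_singleton by blast
    then show ?thesis unfolding Q0_def R0_def
      by (intro exI[of _ c]) (auto simp: forms1_smult[OF lin(1)] forms1_smult[OF lin(2)])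
  qed
  have By: "\<exists>z\<in>cone C. B z * y1 z \<noteq> 0"
  proof (rule ccontr)
    assume "\<not> ?thesis"
    then have "(\<forall>z\<in>cone C. B z = 0) \<or> (\<forall>z\<in>cone C. y1 z = 0)"
      by (intro irreducible_product[OF C(1) B(1) lin(2)]) blast
    moreover have "\<exists>z\<in>cone C. y1 z \<noteq> 0" using nondegenerate_linear[OF C(2) lin(2), of e1] dual by simp
    moreover have "\<exists>z\<in>cone C. B z \<noteq> 0"
    proof -
      obtain q where q: "q \<in> C" "\<not> vanishes_at B q" using B(2) by blast
      have qP: "q \<in> P3" using q CP by blast
      obtain z where z: "z \<in> q" "z \<noteq> 0" by (rule P3_nonzero[OF qP])
      then show ?thesis using q vanishes_at_iff[OF qP z B(1)] in_coneI[OF q(1) z] by blast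
    qed
    ultimately show False by blast
  qed
  have Q0f: "Q0 \<in> forms m" "R0 \<in> forms m" using pol_forms[OF Q0(1)] pol_forms[OF Q0(2)] by auto
  have eq: "x0 z * Q0 z = y1 z * R0 z" if z: "z \<in> cone C" for z
  proof -
    have "(\<forall>z\<in>cone C. B z * y1 z = 0) \<or> (\<forall>z\<in>cone C. x0 z * Q0 z - y1 z * R0 z = 0)"
    proof (rule irreducible_product[OF C(1) forms_mult[OF B(1) lin(2)] forms_diff[OF forms_mult[OF lin(1) Q0f(1)] forms_mult[OF lin(2) Q0f(2)]]])
      fix z assume z: "z \<in> cone C"
      show "B z * y1 z * (x0 z * Q0 z - y1 z * R0 z) = 0"
        using rel[OF z] by (cases "B z = 0 \<or> y1 z = 0") auto
    qed
    then show ?thesis using By z by auto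
  qed
  show ?thesis
  proof (rule that[of m "\<lambda>z. y1 z * Q0 z" "\<lambda>z. y1 z * (y1 z * R0 z)"])
    show "pol {y1, y2, y3} (Suc m) (\<lambda>z. y1 z * Q0 z)" by (intro pol_times Q0) simp
    show "pol {y1, y2, y3} (Suc (Suc m)) (\<lambda>z. y1 z * (y1 z * R0 z))" by (intro pol_times Q0) simp_all
    obtain z where z: "z \<in> cone C" "B z \<noteq> 0" "y1 z \<noteq> 0" using By by auto
    then show "\<exists>z\<in>cone C. y1 z * Q0 z \<noteq> 0" using rel[OF z] by auto
    show "x0 z * (y1 z * Q0 z) = y1 z * (y1 z * R0 z)" if "z \<in> cone C" for z
      using eq[OF that] by simp
  qed
qed

text \<open>Vectors are chosen from the \<open>d\<close> points of one plane section. The separating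
  forms are minors against \<open>pts j\<close>: if all of them vanish at \<open>pts i\<close>, the
  two vectors are proportional.\<close>

lemma plane_section_points:
  assumes C: "C \<subseteq> P3" "nondegenerate C" and d: "has_degree C d"
  obtains \<alpha> pts where "\<alpha> \<in> forms 1" "\<exists>z\<in>cone C. \<alpha> z \<noteq> 0"
    "\<And>i. i < d \<Longrightarrow> pts i \<in> cone C" "\<And>i. i < d \<Longrightarrow> pts i \<noteq> (0::vec4)" "\<And>i. i < d \<Longrightarrow> \<alpha> (pts i) = 0"
    "\<And>i j. i < d \<Longrightarrow> j < d \<Longrightarrow> i \<noteq> j \<Longrightarrow> \<exists>l\<in>forms 1. l (pts i) \<noteq> 0 \<and> l (pts j) = 0"
proof -
  obtain a :: vec4 where a: "a \<noteq> 0"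
    and fin: "finite {q\<in>C. \<forall>x\<in>q. (\<Sum>i\<in>UNIV. a $ i * x $ i) = 0}"
    and card: "card {q\<in>C. \<forall>x\<in>q. (\<Sum>i\<in>UNIV. a $ i * x $ i) = 0} = d"
    using d unfolding has_degree_def by blast
  let ?S = "{q\<in>C. \<forall>x\<in>q. (\<Sum>i\<in>UNIV. a $ i * x $ i) = 0}"
  define \<alpha> where "\<alpha> x = (\<Sum>i\<in>UNIV. a $ i * x $ i)" for x :: vec4
  have \<alpha>f: "\<alpha> \<in> forms 1"
    by (rule forms1I) (simp_all add: \<alpha>_def algebra_simps sum.distrib sum_distrib_left)
  obtain i where i: "a $ i \<noteq> 0" using a by (metis vec_eq_iff zero_index)
  have "\<alpha> (axis i 1) = (\<Sum>j\<in>{i}. a $ j * axis i 1 $ j)"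
    unfolding \<alpha>_def by (rule sum.mono_neutral_right) (auto simp: axis_def)
  then have "\<alpha> (axis i 1) \<noteq> 0" using i by simp
  then have nz: "\<exists>z\<in>cone C. \<alpha> z \<noteq> 0" by (rule nondegenerate_linear[OF C(2) \<alpha>f])
  obtain f where f: "bij_betw f {..<d} ?S" using ex_bij_betw_nat_finite[OF fin] card by (auto simp: atLeast0LessThan)
  have fS: "f i \<in> ?S" if "i < d" for i using bij_betwE[OF f] that by blast
  define pts where "pts i = (SOME z. z \<in> f i \<and> z \<noteq> 0)" for i
  have pts: "pts i \<in> f i" "pts i \<noteq> 0" if i: "i < d" for i
  proof -
    have "f i \<in> P3" using fS[OF i] C(1) by blast
    then have "\<exists>z. z \<in> f i \<and> z \<noteq> 0" using P3_nonzero by metis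
    from someI_ex[OF this] show "pts i \<in> f i" "pts i \<noteq> 0" unfolding pts_def by auto
  qed
  have sep: "\<exists>l\<in>forms 1. l (pts i) \<noteq> 0 \<and> l (pts j) = 0" if ij: "i < d" "j < d" "i \<noteq> j" for i j
  proof (rule ccontr)
    assume none: "\<not> ?thesis"
    obtain k where k: "pts j $ k \<noteq> 0" using pts(2)[OF ij(2)] by (metis vec_eq_iff zero_index)
    have "pts j $ k * pts i $ n = pts i $ k * pts j $ n" for n
    proof -
      define l where "l x = pts j $ k * x $ n - x $ k * pts j $ n" for x :: vec4
      have "l \<in> forms 1" by (rule forms1I) (simp_all add: l_def algebra_simps)
      moreover have "l (pts j) = 0" by (simp add: l_def)
      ultimately have "l (pts i) = 0" using none by blast
      then show ?thesis by (simp add: l_def)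
    qed
    then have "pts i = (pts i $ k / pts j $ k) *s pts j"
      unfolding vec_eq_iff using k by (simp add: field_simps)
    moreover have "f j \<in> P3" using fS[OF ij(2)] C(1) by blast
    ultimately have "pts i \<in> f j" using P3_eq_range[OF _ pts[OF ij(2)]] by blast
    moreover have "f i \<in> P3" using fS[OF ij(1)] C(1) by blast
    ultimately have "f i = f j"
      using P3_eq_range[OF _ pts[OF ij(1)]] P3_eq_range[OF \<open>f j \<in> P3\<close> _ pts(2)[OF ij(1)]] by simp
    moreover have "i \<in> {..<d}" "j \<in> {..<d}" using ij by auto
    ultimately show False using bij_betw_imp_inj_on[OF f] ij(3) unfolding inj_on_def by blast
  qed
  show ?thesis
  proof (rule that[OF \<alpha>f nz _ _ _ sep])
    fix i assume i: "i < d"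
    show "pts i \<in> cone C" using fS[OF i] pts[OF i] in_coneI by blast
    show "pts i \<noteq> 0" by (rule pts(2)[OF i])
    show "\<alpha> (pts i) = 0" using fS[OF i] pts(1)[OF i] unfolding \<alpha>_def by blast
  qed
qed

text \<open>Smoothness gives two equations with independent differentials modulo the tangent line,
  hence local parameters. Multiplicity 2 at \<open>p\<close> prevents \<open>y2\<close> and
  \<open>y3\<close> from both having order 3 or more, and a swap and a shear normalise them.
  Multiplicity 0 at the other points says that the tangent line meets the curve in \<open>p\<close>
  alone.\<close>

lemma projected_frame_exists:
  assumes C: "smooth_irreducible_curve C" "nondegenerate C" "has_degree C d" and p: "p \<in> C - \<Gamma> C"
    and e0: "e0 \<in> p" "e0 \<noteq> 0"
  obtains e1 e2 e3 x0 y1 y2 y3 g G E2 E3 \<alpha> pts m Q P where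
    "projected_curve e0 e1 e2 e3 x0 y1 y2 y3 (cone C) g G E2 E3 d \<alpha> pts m Q P"
    "\<And>z. z \<in> tangent_space C p \<longleftrightarrow> y2 z = 0 \<and> y3 z = 0"
proof -
  have irr: "irreducible_closed C" and pd: "proj_dim C = 1"
    and sm: "\<And>q. q \<in> C \<Longrightarrow> enat (vec.dim (tangent_space C q)) = proj_dim C + 1"
    using C(1) unfolding smooth_irreducible_curve_def by auto
  have zc: "zclosed C" using irr unfolding irreducible_closed_def by blast
  have CP: "C \<subseteq> P3" by (rule zclosed_P3[OF zc])
  have pC: "p \<in> C" and bir: "p \<in> C' C"
    and im: "\<And>x. x \<in> C \<Longrightarrow> intersection_mult C (tangent_space C p) x = (if x = p then 2 else 0)"
    using p unfolding \<Gamma>_def by auto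
  have pP: "p \<in> P3" using pC CP by blast
  have pe: "p = range (\<lambda>c. c *s e0)" by (rule P3_eq_range[OF pP e0])
  have e0Z: "e0 \<in> cone C" by (rule in_coneI[OF pC e0])
  define t where "t = tangent_space C p"
  have t: "vec.subspace t" "vec.dim t = 2" "e0 \<in> t"
    using tangent_subspace[OF pP] sm[OF pC] point_in_tangent[OF CP pC e0]
    unfolding t_def pd by (auto simp: one_enat_def)
  obtain e1 e2 e3 x0 y1 y2 y3 where fr: "adapted_frame e0 e1 e2 e3 x0 y1 y2 y3"
    and tt: "\<And>z. z \<in> t \<longleftrightarrow> y2 z = 0 \<and> y3 z = 0"
    by (rule adapted_frame_exists[OF t(1,2,3) e0(2)]) blast
  interpret f1: adapted_frame e0 e1 e2 e3 x0 y1 y2 y3 by (rule fr)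
  have grad: "\<exists>m F D. F \<in> forms m \<and> (\<forall>z\<in>cone C. F z = 0) \<and> D \<in> forms 1 \<and>
      (\<forall>v. ((\<lambda>t. F (e0 + t *s v)) has_field_derivative D v) (at 0)) \<and> D e1 = 0 \<and> D v \<noteq> 0"
    if v: "v \<notin> t" for v
  proof -
    obtain m F where F: "F \<in> ideal_of C m" "deriv (\<lambda>t. F (e0 + t *s v)) 0 \<noteq> 0"
      using v unfolding t_def tangent_space_iff[OF pP e0] by blast
    obtain D where D: "D \<in> forms 1"
      "\<And>v w. ((\<lambda>t. F (e0 + t *s v + t ^ 2 *s w)) has_field_derivative D v) (at 0)"
      "\<And>v. deriv (\<lambda>t. F (e0 + t *s v)) 0 = D v"
      by (rule ideal_gradient[OF F(1), of e0]) blast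
    have "e1 \<in> t" using tt f1.dual by simp
    then have "D e1 = 0" using D(3)[of e1] F(1) unfolding t_def tangent_space_iff[OF pP e0] by metis
    moreover have "((\<lambda>t. F (e0 + t *s v)) has_field_derivative D v) (at 0)" for v
      using D(2)[of v 0] by simp
    moreover have "D v \<noteq> 0" using F(2) D(3) by simp
    ultimately show ?thesis using F(1) D(1) unfolding ideal_of_iff[OF CP] by blast
  qed
  have "e2 \<notin> t" using tt f1.dual by simp
  from grad[OF this] obtain ma A DA where A: "A \<in> forms ma" "\<And>z. z \<in> cone C \<Longrightarrow> A z = 0"
    "DA \<in> forms 1" "\<And>v. ((\<lambda>t. A (e0 + t *s v)) has_field_derivative DA v) (at 0)" "DA e1 = 0" "DA e2 \<noteq> 0"
    by blast
  \<comment> \<open>\<open>DA\<close> vanishes on \<open>v\<close>, so an equation with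
    \<open>DB v \<noteq> 0\<close> has a differential independent of \<open>DA\<close>.\<close>
  define v where "v = e3 - (DA e3 / DA e2) *s e2"
  have "v \<notin> t" using tt by (simp add: v_def forms1_diff[OF f1.lin(4)] forms1_smult[OF f1.lin(4)] f1.dual)
  from grad[OF this] obtain mb B DB where B: "B \<in> forms mb" "\<And>z. z \<in> cone C \<Longrightarrow> B z = 0"
    "DB \<in> forms 1" "\<And>v. ((\<lambda>t. B (e0 + t *s v)) has_field_derivative DB v) (at 0)" "DB e1 = 0" "DB v \<noteq> 0"
    by blast
  have "DB v = DB e3 - (DA e3 / DA e2) * DB e2"
    by (simp add: v_def forms1_diff[OF B(3)] forms1_smult[OF B(3)])
  then have det: "DA e2 * DB e3 - DA e3 * DB e2 \<noteq> 0" using B(6) A(6) by (auto simp: field_simps)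
  obtain g G E2 E3 where loc: "G \<in> forms (Suc g)" "E2 \<in> forms g" "E3 \<in> forms g" "G e0 \<noteq> 0"
    "\<And>z. z \<in> cone C \<Longrightarrow> G z * y2 z = y1 z ^ 2 * E2 z" "\<And>z. z \<in> cone C \<Longrightarrow> G z * y3 z = y1 z ^ 2 * E3 z"
    using f1.local_parameters[OF A(1,2) B(1,2) e0Z A(4) B(4) A(5) B(5) det] by blast
  have ne: "E2 e0 \<noteq> 0 \<or> E3 e0 \<noteq> 0"
  proof (rule ccontr)
    assume "\<not> ?thesis"
    then have E0: "E2 e0 = 0" "E3 e0 = 0" by auto
    obtain l where l: "l \<in> forms 1" "vanishes_at l t" "\<not> vanishes_to_order C 1 p 3 (restr C l)"
      using tangent_order_two[of C t p] im[OF pC] unfolding t_def by auto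
    have l01: "l e0 = 0" "l e1 = 0" using l(2) tt f1.dual unfolding vanishes_at_def by auto
    define E where "E z = l e2 * E2 z + l e3 * E3 z" for z
    have Ef: "E \<in> forms g" unfolding E_def by (intro forms_add forms_scale loc)
    have Gl: "G z * l z = y1 z ^ 2 * E z" if "z \<in> cone C" for z
    proof -
      have "l z = l e2 * y2 z + l e3 * y3 z" using f1.lin_expand[OF l(1), of z] l01 by simp
      then have "G z * l z = l e2 * (G z * y2 z) + l e3 * (G z * y3 z)" by (simp add: algebra_simps)
      then show ?thesis unfolding loc(5)[OF that] loc(6)[OF that] by (simp add: E_def algebra_simps)
    qed
    \<comment> \<open>If \<open>E\<close> vanishes at \<open>p\<close>, then \<open>y1^2 E\<close>
      is a product of three forms in the ideal of \<open>p\<close>: twice \<open>y1\<close> and once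
      \<open>E\<close>.\<close>
    define fs where "fs i = (if i < 2 then y1 else E)" for i :: nat
    have "(\<lambda>z. (\<Prod>i<3. fs i z) * 1) \<in> ideal_pow {p} 3 (Suc g + 1)"
    proof (rule ideal_powI[where e = "\<lambda>i. if i < 2 then 1 else g" and f = fs and h = "\<lambda>_. 1" and j = 0])
      show "fs i \<in> ideal_of {p} (if i < 2 then 1 else g)" for i
        using ideal_of_point[OF pP e0 f1.lin(2)] ideal_of_point[OF pP e0 Ef] f1.dual E0
        by (auto simp: fs_def E_def)
    qed (auto simp: forms_const numeral_3_eq_3)
    moreover have "(\<Prod>i<3. fs i z) * 1 = y1 z ^ 2 * E z" for z
      by (simp add: fs_def numeral_3_eq_3 power2_eq_square)
    ultimately have ip: "(\<lambda>z. y1 z ^ 2 * E z) \<in> ideal_pow {p} 3 (Suc g + 1)" by simp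
    have "vanishes_to_order C 1 p 3 (restr C l)"
      unfolding vanishes_to_order_def
    proof (intro exI[of _ "Suc g"] bexI[OF _ ip] bexI[OF _ loc(1)] conjI ballI impI)
      show "\<not> vanishes_at G p" using loc(4) e0(1) unfolding vanishes_at_def by blast
      fix z assume z: "z \<in> cone C" "G z \<noteq> 0"
      show "restr C l z = y1 z ^ 2 * E z / G z"
        using Gl[OF z(1)] z by (simp add: restr_cone field_simps)
    qed
    then show False using l(3) by blast
  qed
  have "\<exists>e2 e3 y2 y3 E2 E3. adapted_frame e0 e1 e2 e3 x0 y1 y2 y3 \<and> (\<forall>z. z \<in> t \<longleftrightarrow> y2 z = 0 \<and> y3 z = 0) \<and>
     E2 \<in> forms g \<and> E3 \<in> forms g \<and> E2 e0 \<noteq> 0 \<and>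
     (\<forall>z\<in>cone C. G z * y2 z = y1 z ^ 2 * E2 z) \<and> (\<forall>z\<in>cone C. G z * y3 z = y1 z ^ 2 * E3 z)"
  proof (cases "E2 e0 = 0")
    case True
    then have "E3 e0 \<noteq> 0" using ne by blast
    then show ?thesis using f1.swap tt loc by blast
  next
    case False
    then show ?thesis using fr tt loc by blast
  qed
  then obtain e2 e3 y2 y3 E2 E3 where fr2: "adapted_frame e0 e1 e2 e3 x0 y1 y2 y3"
    and tt2: "\<And>z. z \<in> t \<longleftrightarrow> y2 z = 0 \<and> y3 z = 0"
    and loc2: "E2 \<in> forms g" "E3 \<in> forms g" "E2 e0 \<noteq> 0"
     "\<And>z. z \<in> cone C \<Longrightarrow> G z * y2 z = y1 z ^ 2 * E2 z" "\<And>z. z \<in> cone C \<Longrightarrow> G z * y3 z = y1 z ^ 2 * E3 z"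
    by blast
  interpret f2: adapted_frame e0 e1 e2 e3 x0 y1 y2 y3 by (rule fr2)
  define c where "c = E3 e0 / E2 e0"
  define y3' where "y3' z = y3 z - c * y2 z" for z
  define E3' where "E3' z = E3 z - c * E2 z" for z
  have fr3: "adapted_frame e0 e1 (e2 + c *s e3) e3 x0 y1 y2 y3'"
    using f2.shear[of c] unfolding y3'_def[abs_def] .
  interpret f3: adapted_frame e0 e1 "e2 + c *s e3" e3 x0 y1 y2 y3' by (rule fr3)
  have tt3: "z \<in> t \<longleftrightarrow> y2 z = 0 \<and> y3' z = 0" for z
    unfolding tt2 by (auto simp: y3'_def)
  have "curve_frame e0 e1 (e2 + c *s e3) e3 x0 y1 y2 y3' (cone C) g G E2 E3'"
  proof (unfold_locales)
    show "(\<forall>z\<in>cone C. F z = 0) \<or> (\<forall>z\<in>cone C. H z = 0)"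
      if "F \<in> forms a" "H \<in> forms b" "\<And>z. z \<in> cone C \<Longrightarrow> F z * H z = 0" for F H a b
      by (rule irreducible_product[OF irr that])
    show "\<exists>z\<in>cone C. F z \<noteq> 0" if "F \<in> forms 1" "F u \<noteq> 0" for F u
      by (rule nondegenerate_linear[OF C(2) that])
    show "e0 \<in> cone C" by (rule e0Z)
    show "\<exists>m. \<exists>h\<in>forms m. (\<forall>x\<in>cone C. h x = 0) \<and> h z \<noteq> 0" if "z \<noteq> 0" "z \<notin> cone C" for z
      by (rule zclosed_cut[OF zc that])
    show "y1 z = 0" if z: "z \<in> cone C" "y2 z = 0" "y3' z = 0" for z
    proof -
      define q where "q = vec.span {z}"
      have q: "q \<in> C" "z \<noteq> 0" using z(1) cone_iff[OF CP] q_def by auto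
      have "z \<in> t" using tt3 z by blast
      then have "q \<subseteq> t" unfolding q_def using t(1) by (simp add: vec.span_minimal)
      then have "q = p" using not_in_tangent[OF CP q(1), of t] im[OF q(1)] unfolding t_def by metis
      then have "z \<in> p" unfolding q_def using vec.span_base[of z "{z}"] by simp
      then show ?thesis unfolding pe using f3.dual forms1_smult[OF f3.lin(2)] by auto
    qed
    show "G \<in> forms (Suc g)" "E2 \<in> forms g" "G e0 \<noteq> 0" "E2 e0 \<noteq> 0" using loc loc2 by auto
    show "E3' \<in> forms g" unfolding E3'_def by (intro forms_diff forms_scale loc2)
    show "E3' e0 = 0" using loc2(3) by (simp add: E3'_def c_def)
    show "G z * y2 z = y1 z ^ 2 * E2 z" if "z \<in> cone C" for z by (rule loc2(4)[OF that])
    show "G z * y3' z = y1 z ^ 2 * E3' z" if "z \<in> cone C" for z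
    proof -
      have "G z * y3' z = G z * y3 z - c * (G z * y2 z)" by (simp add: y3'_def algebra_simps)
      then show ?thesis unfolding loc2(4)[OF that] loc2(5)[OF that] by (simp add: E3'_def algebra_simps)
    qed
  qed
  then interpret cf: curve_frame e0 e1 "e2 + c *s e3" e3 x0 y1 y2 y3' "cone C" g G E2 E3' .
  obtain \<alpha> pts where pts: "\<alpha> \<in> forms 1" "\<exists>z\<in>cone C. \<alpha> z \<noteq> 0"
    "\<And>i. i < d \<Longrightarrow> pts i \<in> cone C" "\<And>i. i < d \<Longrightarrow> pts i \<noteq> (0::vec4)" "\<And>i. i < d \<Longrightarrow> \<alpha> (pts i) = 0"
    "\<And>i j. i < d \<Longrightarrow> j < d \<Longrightarrow> i \<noteq> j \<Longrightarrow> \<exists>l\<in>forms 1. l (pts i) \<noteq> 0 \<and> l (pts j) = 0"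
    by (rule plane_section_points[OF CP C(2,3)]) blast
  have "sectioned_curve e0 e1 (e2 + c *s e3) e3 x0 y1 y2 y3' (cone C) g G E2 E3' d \<alpha> pts"
    by unfold_locales (fact pts)+
  then interpret sc: sectioned_curve e0 e1 "e2 + c *s e3" e3 x0 y1 y2 y3' "cone C" g G E2 E3' d \<alpha> pts .
  have "proj_birational C p" using bir pP unfolding C'_def S_def by blast
  from birational_inverse[OF irr C(2) pC this fr3 e0]
  obtain m Q P where Q: "pol {y1, y2, y3'} (Suc m) Q" "\<exists>z\<in>cone C. Q z \<noteq> 0" "pol {y1, y2, y3'} (Suc (Suc m)) P"
    "\<And>z. z \<in> cone C \<Longrightarrow> x0 z * Q z = P z"
    by blast
  have "projected_curve e0 e1 (e2 + c *s e3) e3 x0 y1 y2 y3' (cone C) g G E2 E3' d \<alpha> pts m Q P"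
    by unfold_locales (fact Q)+
  then show ?thesis using that tt3 unfolding t_def by blast
qed

section \<open>The blow-up along curves through the point\<close>

text \<open>Each factor in the ideal of the curve contributes its differential at \<open>x\<close>,
  a linear form vanishing on the tangent space. So the leading coefficient depends on the normal
  direction alone, is homogeneous of degree \<open>k\<close>, and ignores the quadratic term of the
  arc.\<close>

lemma ideal_pow_leading:
  assumes C: "C \<subseteq> P3" and p: "p \<in> C" "x \<in> p" "x \<noteq> 0" and a: "a \<in> ideal_pow C k m"
  obtains A where "\<And>v w. ((\<lambda>t. a (x + t *s v + t ^ 2 *s w) / t ^ k) \<longlongrightarrow> A v) (at 0)"
    "continuous_on UNIV A" "\<And>c v \<tau>. \<tau> \<in> tangent_space C p \<Longrightarrow> A (c *s v + \<tau>) = c ^ k * A v"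
proof -
  have pP: "p \<in> P3" using C p by blast
  have "\<exists>A. (\<forall>v w. ((\<lambda>t. a (x + t *s v + t ^ 2 *s w) / t ^ k) \<longlongrightarrow> A v) (at 0)) \<and>
    continuous_on UNIV A \<and> (\<forall>c v \<tau>. \<tau> \<in> tangent_space C p \<longrightarrow> A (c *s v + \<tau>) = c ^ k * A v)"
    using a unfolding ideal_pow_def
  proof (induction rule: cfun_span_induct)
    case (base a)
    then obtain f h e j where a: "a = (\<lambda>x. (\<Prod>i<k. f i x) * h x)" and f: "\<And>i. i < k \<Longrightarrow> f i \<in> ideal_of C (e i)"
      and h: "h \<in> forms j" by blast
    have "\<exists>D. D \<in> forms 1 \<and> (\<forall>v w. ((\<lambda>t. f i (x + t *s v + t ^ 2 *s w) / t) \<longlongrightarrow> D v) (at 0)) \<and>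
       (\<forall>\<tau>\<in>tangent_space C p. D \<tau> = 0)" if i: "i < k" for i
    proof -
      obtain D where D: "D \<in> forms 1"
        "\<And>v w. ((\<lambda>t. f i (x + t *s v + t ^ 2 *s w)) has_field_derivative D v) (at 0)"
        "\<And>v. deriv (\<lambda>t. f i (x + t *s v)) 0 = D v"
        by (rule ideal_gradient[OF f[OF i], of x]) blast
      have fx: "f i x = 0" using f[OF i] in_coneI[OF p] unfolding ideal_of_iff[OF C] by blast
      have "((\<lambda>t. f i (x + t *s v + t ^ 2 *s w) / t) \<longlongrightarrow> D v) (at 0)" for v w
        using D(2)[of v w] unfolding has_field_derivative_iff by (simp add: fx)
      moreover have "D \<tau> = 0" if "\<tau> \<in> tangent_space C p" for \<tau>
        using that D(3)[of \<tau>] f[OF i] unfolding tangent_space_iff[OF pP p(2,3)] by metis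
      ultimately show ?thesis using D(1) by blast
    qed
    then have "\<forall>i\<in>{..<k}. \<exists>D. D \<in> forms 1 \<and> (\<forall>v w. ((\<lambda>t. f i (x + t *s v + t ^ 2 *s w) / t) \<longlongrightarrow> D v) (at 0)) \<and>
       (\<forall>\<tau>\<in>tangent_space C p. D \<tau> = 0)" by simp
    from bchoice[OF this] obtain D where D0: "\<forall>i\<in>{..<k}. D i \<in> forms 1 \<and>
       (\<forall>v w. ((\<lambda>t. f i (x + t *s v + t ^ 2 *s w) / t) \<longlongrightarrow> D i v) (at 0)) \<and>
       (\<forall>\<tau>\<in>tangent_space C p. D i \<tau> = 0)" ..
    have D: "\<And>i. i < k \<Longrightarrow> D i \<in> forms 1"
      "\<And>i v w. i < k \<Longrightarrow> ((\<lambda>t. f i (x + t *s v + t ^ 2 *s w) / t) \<longlongrightarrow> D i v) (at 0)"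
      "\<And>i \<tau>. i < k \<Longrightarrow> \<tau> \<in> tangent_space C p \<Longrightarrow> D i \<tau> = 0"
      using D0 by blast+
    define A where "A v = (\<Prod>i<k. D i v) * h x" for v
    have "((\<lambda>t. a (x + t *s v + t ^ 2 *s w) / t ^ k) \<longlongrightarrow> A v) (at 0)" for v w
    proof -
      have "((\<lambda>t. h (x + t *s v + t ^ 2 *s w)) \<longlongrightarrow> h x) (at 0)"
      proof -
        obtain Dh where "\<And>v w. ((\<lambda>t. h (x + t *s v + t ^ 2 *s w)) has_field_derivative Dh v) (at 0)"
          using forms_gradient[OF h] by blast
        from DERIV_isCont[OF this[of v w]] show ?thesis unfolding isCont_def by simp
      qed
      moreover have "((\<lambda>t. \<Prod>i<k. f i (x + t *s v + t ^ 2 *s w) / t) \<longlongrightarrow> (\<Prod>i<k. D i v)) (at 0)"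
        by (intro tendsto_prod D(2)) simp
      ultimately have "((\<lambda>t. (\<Prod>i<k. f i (x + t *s v + t ^ 2 *s w) / t) * h (x + t *s v + t ^ 2 *s w)) \<longlongrightarrow> A v) (at 0)"
        unfolding A_def by (intro tendsto_mult)
      moreover have "(\<Prod>i<k. f i y / t) * h y = a y / t ^ k" for y t
        unfolding a by (simp add: prod_dividef)
      ultimately show ?thesis by simp
    qed
    moreover have "continuous_on UNIV A"
      unfolding A_def by (intro continuous_intros continuous_on_prod forms_continuous[OF D(1)]) simp
    moreover have "A (c *s v + \<tau>) = c ^ k * A v" if "\<tau> \<in> tangent_space C p" for c v \<tau>
    proof -
      have "D i (c *s v + \<tau>) = c * D i v" if "i < k" for i
        using D(3)[OF that \<open>\<tau> \<in> _\<close>] by (simp add: forms1_add[OF D(1)[OF that]] forms1_smult[OF D(1)[OF that]])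
      then have "(\<Prod>i<k. D i (c *s v + \<tau>)) = (\<Prod>i<k. c * D i v)" by (intro prod.cong) auto
      then show ?thesis unfolding A_def by (simp add: prod.distrib)
    qed
    ultimately show ?case by blast
  next
    case zero
    show ?case by (intro exI[of _ "\<lambda>_. 0"]) simp
  next
    case (add a b)
    from add(1) obtain A where A: "\<And>v w. ((\<lambda>t. a (x + t *s v + t ^ 2 *s w) / t ^ k) \<longlongrightarrow> A v) (at 0)"
      "continuous_on UNIV A" "\<And>c v \<tau>. \<tau> \<in> tangent_space C p \<Longrightarrow> A (c *s v + \<tau>) = c ^ k * A v" by blast
    from add(2) obtain B where B: "\<And>v w. ((\<lambda>t. b (x + t *s v + t ^ 2 *s w) / t ^ k) \<longlongrightarrow> B v) (at 0)"
      "continuous_on UNIV B" "\<And>c v \<tau>. \<tau> \<in> tangent_space C p \<Longrightarrow> B (c *s v + \<tau>) = c ^ k * B v" by blast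
    show ?case
      using tendsto_add[OF A(1) B(1)] continuous_on_add[OF A(2) B(2)] A(3) B(3)
      by (intro exI[of _ "\<lambda>v. A v + B v"]) (simp add: add_divide_distrib distrib_left)
  next
    case (scale c a)
    then obtain A where A: "\<And>v w. ((\<lambda>t. a (x + t *s v + t ^ 2 *s w) / t ^ k) \<longlongrightarrow> A v) (at 0)"
      "continuous_on UNIV A" "\<And>c v \<tau>. \<tau> \<in> tangent_space C p \<Longrightarrow> A (c *s v + \<tau>) = c ^ k * A v" by blast
    show ?case
      using tendsto_mult_left[OF A(1), of c] continuous_on_mult_left[OF A(2), of c] A(3)
      by (intro exI[of _ "\<lambda>v. c * A v"]) (simp add: mult.left_commute)
  qed
  then show ?thesis using that by blast
qed

lemma ideal_pow_forms:
  assumes "a \<in> ideal_pow C k m"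
  shows "a \<in> forms m"
  using assms unfolding ideal_pow_def
proof (induction rule: cfun_span_induct)
  case (base a)
  then obtain f h e j where a: "a = (\<lambda>x. (\<Prod>i<k. f i x) * h x)" and f: "\<And>i. i < k \<Longrightarrow> f i \<in> ideal_of C (e i)"
    and h: "h \<in> forms j" and m: "(\<Sum>i<k. e i) + j = m" by blast
  have "(\<lambda>x. \<Prod>i<k. f i x) \<in> forms (\<Sum>i<k. e i)"
    unfolding forms_iff by (rule pol_prod) (use f in \<open>auto simp: ideal_of_def forms_iff\<close>)
  from forms_mult[OF this h] show ?case unfolding a m .
qed (auto intro: forms_zero forms_add forms_scale)

lemma sequence_at_zero:
  assumes "eventually P (at (0::complex))"
  obtains t :: "nat \<Rightarrow> complex" where "t \<longlonglongrightarrow> 0" "\<And>n. t n \<noteq> 0" "\<And>n. P (t n)"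
proof -
  obtain \<delta> where \<delta>: "\<delta> > 0" "\<And>t. t \<noteq> 0 \<Longrightarrow> dist t 0 < \<delta> \<Longrightarrow> P t"
    using assms unfolding eventually_at by auto
  have "inverse (real (Suc n)) \<le> 1" for n by (simp add: inverse_le_1_iff)
  then have less: "\<delta> / 2 * inverse (real (Suc n)) < \<delta>" for n
    using \<delta>(1) mult_left_le[of "inverse (real (Suc n))" "\<delta> / 2"] by (smt (verit) field_sum_of_halves)
  define t :: "nat \<Rightarrow> complex" where "t n = of_real (\<delta> / 2 * inverse (real (Suc n)))" for n
  have "(\<lambda>n. \<delta> / 2 * inverse (real (Suc n))) \<longlonglongrightarrow> \<delta> / 2 * 0"
    by (intro tendsto_mult tendsto_const LIMSEQ_inverse_real_of_nat)
  then have "t \<longlonglongrightarrow> of_real (\<delta> / 2 * 0)" unfolding t_def by (rule tendsto_of_real)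
  moreover have "t n \<noteq> 0" for n unfolding t_def of_real_eq_0_iff using \<delta>(1) by simp
  moreover have "P (t n)" for n
  proof (rule \<delta>(2))
    show "t n \<noteq> 0" unfolding t_def of_real_eq_0_iff using \<delta>(1) by simp
    have "norm (t n) = \<delta> / 2 * inverse (real (Suc n))"
      unfolding t_def norm_of_real using \<delta>(1) by simp
    then show "dist (t n) 0 < \<delta>" using less[of n] by simp
  qed
  ultimately show ?thesis using that by simp
qed

lemma sequence_filterlim: "t \<longlonglongrightarrow> (0::complex) \<Longrightarrow> (\<And>n. t n \<noteq> 0) \<Longrightarrow> filterlim t (at 0) sequentially"
  unfolding filterlim_at by auto

lemma forms_path_poly:
  assumes "F \<in> forms m"
  shows "\<exists>P. \<forall>t. F (x + t *s v + t ^ 2 *s w) = poly P t"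
proof -
  have "pol crd m F" using assms by (simp add: forms_iff)
  then show ?thesis
  proof (induction rule: pol.induct)
    case (pol_const c)
    show ?case by (intro exI[of _ "[:c:]"]) simp
  next
    case (pol_zero k)
    show ?case by (intro exI[of _ 0]) simp
  next
    case (pol_times l k f)
    then obtain P where P: "\<And>t. f (x + t *s v + t ^ 2 *s w) = poly P t" by blast
    from pol_times(1) obtain i where l: "l = (\<lambda>x. x $ i)" unfolding crd_def by blast
    have "(x + t *s v + t ^ 2 *s w) $ i = poly [:x $ i, v $ i, w $ i:] t" for t
      by (simp add: algebra_simps power2_eq_square)
    then show ?case unfolding l
      by (intro exI[of _ "[:x $ i, v $ i, w $ i:] * P"] allI) (simp only: P poly_mult)
  next
    case (pol_plus k f h)
    then obtain P P' where "\<And>t. f (x + t *s v + t ^ 2 *s w) = poly P t"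
      "\<And>t. h (x + t *s v + t ^ 2 *s w) = poly P' t" by blast
    then show ?case by (intro exI[of _ "P + P'"]) simp
  qed
qed

text \<open>Along the arc a form is a polynomial in the parameter; one nonzero value leaves finitely
  many zeros, and these stay away from 0 apart from 0 itself.\<close>

lemma forms_path_eventually_nonzero:
  assumes "F \<in> forms m" "F (x + s *s v + s ^ 2 *s w) \<noteq> 0"
  shows "\<forall>\<^sub>F t in at 0. F (x + t *s v + t ^ 2 *s w) \<noteq> 0"
proof -
  obtain P where P: "\<And>t. F (x + t *s v + t ^ 2 *s w) = poly P t" using forms_path_poly[OF assms(1)] by blast
  have "P \<noteq> 0" using assms(2) P by auto
  then have "finite ({t. poly P t = 0} - {0})" using poly_roots_finite by blast
  then have "open (- ({t. poly P t = 0} - {0}))" by (intro open_Compl finite_imp_closed)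
  then show ?thesis unfolding eventually_at_topological P by blast
qed

lemma bl_eval_Exc:
  assumes "x = (SOME x. x \<in> p - {0})"
    and "\<And>v w. ((\<lambda>t. a (x + t *s v + t ^ 2 *s w) / t ^ k) \<longlongrightarrow> A v) (at 0)"
  shows "bl_eval C k a (Exc p H) = A (SOME v. v \<in> H - tangent_space C p)"
proof -
  have "Lim (at 0) (\<lambda>t. a (x + t *s v) / t ^ k) = A v" for v
    using assms(2)[of v 0] by (intro tendsto_Lim) auto
  then show ?thesis unfolding bl_eval.simps Let_def assms(1)[symmetric] by blast
qed

text \<open>The vector chosen in \<open>bl_eval\<close> is a multiple of \<open>y\<close>; the same
  \<open>c\<close> serves all forms, so its powers cancel in quotients of equal degree.\<close>

lemma bl_eval_Off:
  assumes "q \<in> P3" "y \<in> q" "y \<noteq> 0"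
  obtains c where "c \<noteq> 0" "\<And>a m k. a \<in> forms m \<Longrightarrow> bl_eval C k a (Off q) = c ^ m * a y"
proof -
  define x where "x = (SOME x. x \<in> q - {0})"
  have "x \<in> q - {0}" unfolding x_def by (rule someI[of _ y]) (use assms in blast)
  then obtain c where "x = c *s y" "c \<noteq> 0" using P3_eq_range[OF assms] by auto
  then show ?thesis using that forms_homog unfolding bl_eval.simps x_def[symmetric] by metis
qed

text \<open>\<open>x\<close> is the very vector that \<open>bl_eval\<close> chooses, so that its
  values are computed without a change of representative.\<close>

locale exceptional_point =
  fixes C :: "psub set" and p :: psub and x :: vec4
  assumes CP: "C \<subseteq> P3" and pC: "p \<in> C" and x: "x = (SOME x. x \<in> p - {0})"
begin

lemma x_in: "x \<in> p" "x \<noteq> 0"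
proof -
  obtain z where "z \<in> p" "z \<noteq> 0" using P3_nonzero CP pC by blast
  then have "z \<in> p - {0}" by blast
  then have "x \<in> p - {0}" unfolding x by (rule someI)
  then show "x \<in> p" "x \<noteq> 0" by auto
qed

abbreviation "t \<equiv> tangent_space C p"

text \<open>The normal direction chosen by \<open>bl_eval\<close>.\<close>

definition nrm :: "psub \<Rightarrow> vec4" where "nrm H = (SOME v. v \<in> H - t)"

definition path :: "vec4 \<Rightarrow> vec4 \<Rightarrow> complex \<Rightarrow> vec4" where "path v w s = x + s *s v + s ^ 2 *s w"

lemma leading:
  assumes "a \<in> ideal_pow C k m"
  obtains A where "\<And>v w. ((\<lambda>s. a (path v w s) / s ^ k) \<longlongrightarrow> A v) (at 0)"
    "continuous_on UNIV A" "\<And>c v \<tau>. \<tau> \<in> t \<Longrightarrow> A (c *s v + \<tau>) = c ^ k * A v"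
    "\<And>H. bl_eval C k a (Exc p H) = A (nrm H)"
proof -
  obtain A where A: "\<And>v w. ((\<lambda>t. a (x + t *s v + t ^ 2 *s w) / t ^ k) \<longlongrightarrow> A v) (at 0)"
    "continuous_on UNIV A" "\<And>c v \<tau>. \<tau> \<in> t \<Longrightarrow> A (c *s v + \<tau>) = c ^ k * A v"
    by (rule ideal_pow_leading[OF CP pC x_in assms]) blast
  show ?thesis
    by (rule that[OF _ A(2,3)]) (use A(1) bl_eval_Exc[OF x A(1)] in \<open>auto simp: path_def nrm_def\<close>)
qed

text \<open>As \<open>v\<close> is not tangent, some equation of the curve has nonzero derivative
  along the arc at \<open>s = 0\<close>, so it is nonzero for small
  \<open>s \<noteq> 0\<close>.\<close>

lemma path_off_curve:
  assumes "v \<notin> t"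
  shows "\<forall>\<^sub>F s in at 0. path v w s \<noteq> 0 \<and> vec.span {path v w s} \<in> P3 - C"
proof -
  have pP: "p \<in> P3" using CP pC by blast
  obtain m F where F: "F \<in> ideal_of C m" "deriv (\<lambda>s. F (x + s *s v)) 0 \<noteq> 0"
    using assms unfolding tangent_space_iff[OF pP x_in] by blast
  obtain D where D: "\<And>v w. ((\<lambda>s. F (x + s *s v + s ^ 2 *s w)) has_field_derivative D v) (at 0)"
    "\<And>v. deriv (\<lambda>s. F (x + s *s v)) 0 = D v"
    by (rule ideal_gradient[OF F(1), of x]) blast
  have F0: "F x = 0" "F \<in> forms m" "\<And>z. z \<in> cone C \<Longrightarrow> F z = 0"
    using F(1) in_coneI[OF pC x_in] unfolding ideal_of_iff[OF CP] by auto
  have "((\<lambda>s. F (path v w s) / s) \<longlongrightarrow> D v) (at 0)"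
    using D(1)[of v w] unfolding has_field_derivative_iff path_def by (simp add: F0)
  then have "\<forall>\<^sub>F s in at 0. F (path v w s) / s \<noteq> 0"
    by (rule tendsto_imp_eventually_ne) (use F(2) D(2) in simp)
  moreover obtain i where i: "x $ i \<noteq> 0" using x_in(2) by (metis vec_eq_iff zero_index)
  have "(\<lambda>z. z $ i) \<in> forms 1" by (rule forms1I) auto
  from forms_path_eventually_nonzero[OF this, of x 0 v w] i
  have "\<forall>\<^sub>F s in at 0. path v w s $ i \<noteq> 0" unfolding path_def by simp
  ultimately show ?thesis
  proof eventually_elim
    case (elim s)
    then have nz: "path v w s \<noteq> 0" by auto
    moreover have "path v w s \<notin> cone C" using elim F0(3) by auto
    ultimately show ?case using cone_iff[OF CP] span_in_P3 by blast
  qed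
qed

text \<open>The value of \<open>b\<close> at \<open>Exc p H\<close> is the limit of
  \<open>b / s ^ k\<close> along the arc, so a nonzero value forces \<open>b\<close> to be nonzero
  on the arc near \<open>s = 0\<close>.\<close>

lemma open_along_path:
  assumes N: "bl_open C N" "Exc p H \<in> N" and v: "nrm H \<notin> t"
  shows "\<forall>\<^sub>F s in at 0. Off (vec.span {path (nrm H) w s}) \<in> N"
proof -
  obtain k m b where b: "b \<in> ideal_pow C k m" "bl_eval C k b (Exc p H) \<noteq> 0"
    "\<And>\<eta>. \<eta> \<in> blowup C \<Longrightarrow> bl_eval C k b \<eta> \<noteq> 0 \<Longrightarrow> \<eta> \<in> N"
    using N unfolding bl_open_def by blast
  obtain B where B: "\<And>v w. ((\<lambda>s. b (path v w s) / s ^ k) \<longlongrightarrow> B v) (at 0)"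
    "\<And>H. bl_eval C k b (Exc p H) = B (nrm H)"
    by (rule leading[OF b(1)]) blast
  have "\<forall>\<^sub>F s in at 0. b (path (nrm H) w s) / s ^ k \<noteq> 0"
    by (rule tendsto_imp_eventually_ne[OF B(1)]) (use b(2) B(2) in simp)
  with path_off_curve[OF v, of w] show ?thesis
  proof eventually_elim
    case (elim s)
    let ?y = "path (nrm H) w s"
    have q: "vec.span {?y} \<in> P3" using elim by blast
    obtain c where c: "c \<noteq> 0" "\<And>a m k. a \<in> forms m \<Longrightarrow> bl_eval C k a (Off (vec.span {?y})) = c ^ m * a ?y"
      by (rule bl_eval_Off[OF q vec.span_base, of ?y]) (use elim in auto)
    have "bl_eval C k b (Off (vec.span {?y})) \<noteq> 0"
      unfolding c(2)[OF ideal_pow_forms[OF b(1)]] using c(1) elim by auto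
    moreover have "Off (vec.span {?y}) \<in> blowup C" using elim unfolding blowup_def by blast
    ultimately show ?case using b(3) by blast
  qed
qed

text \<open>The factor \<open>s ^ k\<close> and the power coming from the choice of representative
  are common to numerator and denominator; the quotient of the limits is the value at the
  exceptional point.\<close>

lemma regular_along_path:
  assumes c: "bl_regular C N c" "Exc p H \<in> N" and v: "nrm H \<notin> t"
    and N: "\<forall>\<^sub>F s in at 0. Off (vec.span {path (nrm H) w s}) \<in> N"
  shows "((\<lambda>s. c (Off (vec.span {path (nrm H) w s}))) \<longlongrightarrow> c (Exc p H)) (at 0)"
proof -
  obtain k m a b where ab: "a \<in> ideal_pow C k m" "b \<in> ideal_pow C k m" "bl_eval C k b (Exc p H) \<noteq> 0"
    "\<And>\<eta>. \<eta> \<in> N \<Longrightarrow> bl_eval C k b \<eta> \<noteq> 0 \<Longrightarrow> c \<eta> = bl_eval C k a \<eta> / bl_eval C k b \<eta>"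
    using c unfolding bl_regular_def by blast
  obtain A where A: "\<And>v w. ((\<lambda>s. a (path v w s) / s ^ k) \<longlongrightarrow> A v) (at 0)"
    "\<And>H. bl_eval C k a (Exc p H) = A (nrm H)"
    by (rule leading[OF ab(1)]) blast
  obtain B where B: "\<And>v w. ((\<lambda>s. b (path v w s) / s ^ k) \<longlongrightarrow> B v) (at 0)"
    "\<And>H. bl_eval C k b (Exc p H) = B (nrm H)"
    by (rule leading[OF ab(2)]) blast
  have B0: "B (nrm H) \<noteq> 0" using ab(3) B(2) by simp
  have "((\<lambda>s. (a (path (nrm H) w s) / s ^ k) / (b (path (nrm H) w s) / s ^ k)) \<longlongrightarrow> A (nrm H) / B (nrm H)) (at 0)"
    by (intro tendsto_divide A(1) B(1) B0)
  moreover have "A (nrm H) / B (nrm H) = c (Exc p H)"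
    using ab(4)[OF c(2) ab(3)] A(2) B(2) by simp
  ultimately have lim: "((\<lambda>s. (a (path (nrm H) w s) / s ^ k) / (b (path (nrm H) w s) / s ^ k)) \<longlongrightarrow> c (Exc p H)) (at 0)"
    by simp
  have "\<forall>\<^sub>F s in at 0. b (path (nrm H) w s) / s ^ k \<noteq> 0"
    by (rule tendsto_imp_eventually_ne[OF B(1) B0])
  with path_off_curve[OF v, of w] N
  have "\<forall>\<^sub>F s in at 0. (a (path (nrm H) w s) / s ^ k) / (b (path (nrm H) w s) / s ^ k) = c (Off (vec.span {path (nrm H) w s}))"
  proof eventually_elim
    case (elim s)
    let ?y = "path (nrm H) w s"
    have q: "vec.span {?y} \<in> P3" using elim by blast
    obtain r where r: "r \<noteq> 0" "\<And>a m k. a \<in> forms m \<Longrightarrow> bl_eval C k a (Off (vec.span {?y})) = r ^ m * a ?y"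
      by (rule bl_eval_Off[OF q vec.span_base, of ?y]) (use elim in auto)
    note ra = r(2)[OF ideal_pow_forms[OF ab(1)], of k] and rb = r(2)[OF ideal_pow_forms[OF ab(2)], of k]
    have "bl_eval C k b (Off (vec.span {?y})) \<noteq> 0" unfolding rb using r(1) elim by auto
    from ab(4)[OF elim(2) this] show ?case unfolding ra rb using r(1) elim by (simp add: field_simps)
  qed
  from Lim_transform_eventually[OF lim this] show ?thesis .
qed

text \<open>Here the approach is inside the fibre over \<open>p\<close>. The normal direction of
  \<open>H s\<close> is known only up to a factor and a tangent vector: leading coefficients ignore
  \<open>\<tau>\<close>, and \<open>c ^ k\<close> cancels in quotients, so continuity of the leading
  coefficients suffices.\<close>

lemma along_fibre:
  assumes v: "\<And>s. P s \<Longrightarrow> \<exists>c \<tau>. c \<noteq> 0 \<and> \<tau> \<in> t \<and> nrm (H s) = c *s (nrm K + s *s e) + \<tau>"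
    and P: "eventually P (at 0)"
    and exc: "\<And>s. P s \<Longrightarrow> Exc p (H s) \<in> blowup C"
  shows "bl_open C N \<Longrightarrow> Exc p K \<in> N \<Longrightarrow> \<forall>\<^sub>F s in at 0. Exc p (H s) \<in> N"
    and "bl_regular C N c \<Longrightarrow> Exc p K \<in> N \<Longrightarrow> \<forall>\<^sub>F s in at 0. Exc p (H s) \<in> N \<Longrightarrow>
      ((\<lambda>s. c (Exc p (H s))) \<longlongrightarrow> c (Exc p K)) (at 0)"
proof -
  have ev: "\<exists>A. (\<forall>H. bl_eval C k a (Exc p H) = A (nrm H)) \<and> ((\<lambda>s. A (nrm K + s *s e)) \<longlongrightarrow> A (nrm K)) (at 0) \<and>
     (\<forall>c \<tau> v. \<tau> \<in> t \<longrightarrow> A (c *s v + \<tau>) = c ^ k * A v)"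
    if a: "a \<in> ideal_pow C k m" for a k m
  proof -
    obtain A where A: "continuous_on UNIV A" "\<And>c v \<tau>. \<tau> \<in> t \<Longrightarrow> A (c *s v + \<tau>) = c ^ k * A v"
      "\<And>H. bl_eval C k a (Exc p H) = A (nrm H)"
      by (rule leading[OF a]) blast
    have "((\<lambda>s. nrm K + s *s e) \<longlongrightarrow> nrm K) (at 0)"
    proof (rule vec_tendstoI)
      fix i
      have "((\<lambda>s. nrm K $ i + s * e $ i) \<longlongrightarrow> nrm K $ i + 0 * e $ i) (at 0)" by (intro tendsto_intros)
      then show "((\<lambda>s. (nrm K + s *s e) $ i) \<longlongrightarrow> nrm K $ i) (at 0)" by simp
    qed
    then have "((\<lambda>s. A (nrm K + s *s e)) \<longlongrightarrow> A (nrm K)) (at 0)"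
      by (rule continuous_on_tendsto_compose[OF A(1)]) auto
    with A show ?thesis by blast
  qed
  show "\<forall>\<^sub>F s in at 0. Exc p (H s) \<in> N" if N: "bl_open C N" "Exc p K \<in> N"
  proof -
    obtain k m b where b: "b \<in> ideal_pow C k m" "bl_eval C k b (Exc p K) \<noteq> 0"
      "\<And>\<eta>. \<eta> \<in> blowup C \<Longrightarrow> bl_eval C k b \<eta> \<noteq> 0 \<Longrightarrow> \<eta> \<in> N"
      using N unfolding bl_open_def by blast
    obtain B where B: "\<And>H. bl_eval C k b (Exc p H) = B (nrm H)" "((\<lambda>s. B (nrm K + s *s e)) \<longlongrightarrow> B (nrm K)) (at 0)"
      "\<And>c \<tau> v. \<tau> \<in> t \<Longrightarrow> B (c *s v + \<tau>) = c ^ k * B v" using ev[OF b(1)] by blast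
    have "\<forall>\<^sub>F s in at 0. B (nrm K + s *s e) \<noteq> 0"
      by (rule tendsto_imp_eventually_ne[OF B(2)]) (use b(2) B(1) in simp)
    with P show ?thesis
    proof eventually_elim
      case (elim s)
      obtain c \<tau> where c: "c \<noteq> 0" "\<tau> \<in> t" "nrm (H s) = c *s (nrm K + s *s e) + \<tau>" using v[OF elim(1)] by blast
      have "bl_eval C k b (Exc p (H s)) \<noteq> 0" unfolding B(1) c(3) B(3)[OF c(2)] using c(1) elim by simp
      then show ?case using b(3) exc[OF elim(1)] by blast
    qed
  qed
  show "((\<lambda>s. c (Exc p (H s))) \<longlongrightarrow> c (Exc p K)) (at 0)"
    if c: "bl_regular C N c" "Exc p K \<in> N" and N: "\<forall>\<^sub>F s in at 0. Exc p (H s) \<in> N"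
  proof -
    obtain k m a b where ab: "a \<in> ideal_pow C k m" "b \<in> ideal_pow C k m" "bl_eval C k b (Exc p K) \<noteq> 0"
      "\<And>\<eta>. \<eta> \<in> N \<Longrightarrow> bl_eval C k b \<eta> \<noteq> 0 \<Longrightarrow> c \<eta> = bl_eval C k a \<eta> / bl_eval C k b \<eta>"
      using c unfolding bl_regular_def by blast
    obtain A where A: "\<And>H. bl_eval C k a (Exc p H) = A (nrm H)" "((\<lambda>s. A (nrm K + s *s e)) \<longlongrightarrow> A (nrm K)) (at 0)"
      "\<And>c \<tau> v. \<tau> \<in> t \<Longrightarrow> A (c *s v + \<tau>) = c ^ k * A v" using ev[OF ab(1)] by blast
    obtain B where B: "\<And>H. bl_eval C k b (Exc p H) = B (nrm H)" "((\<lambda>s. B (nrm K + s *s e)) \<longlongrightarrow> B (nrm K)) (at 0)"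
      "\<And>c \<tau> v. \<tau> \<in> t \<Longrightarrow> B (c *s v + \<tau>) = c ^ k * B v" using ev[OF ab(2)] by blast
    have B0: "B (nrm K) \<noteq> 0" using ab(3) B(1) by simp
    have lim: "((\<lambda>s. A (nrm K + s *s e) / B (nrm K + s *s e)) \<longlongrightarrow> c (Exc p K)) (at 0)"
      using tendsto_divide[OF A(2) B(2) B0] ab(4)[OF c(2) ab(3)] unfolding A(1) B(1) by simp
    have "\<forall>\<^sub>F s in at 0. B (nrm K + s *s e) \<noteq> 0" by (rule tendsto_imp_eventually_ne[OF B(2) B0])
    with P N have "\<forall>\<^sub>F s in at 0. A (nrm K + s *s e) / B (nrm K + s *s e) = c (Exc p (H s))"
    proof eventually_elim
      case (elim s)
      obtain r \<tau> where r: "r \<noteq> 0" "\<tau> \<in> t" "nrm (H s) = r *s (nrm K + s *s e) + \<tau>" using v[OF elim(1)] by blast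
      have eB: "bl_eval C k b (Exc p (H s)) = r ^ k * B (nrm K + s *s e)" unfolding B(1) r(3) B(3)[OF r(2)] ..
      have eA: "bl_eval C k a (Exc p (H s)) = r ^ k * A (nrm K + s *s e)" unfolding A(1) r(3) A(3)[OF r(2)] ..
      have "bl_eval C k b (Exc p (H s)) \<noteq> 0" unfolding eB using r(1) elim by simp
      from ab(4)[OF elim(2) this] show ?case unfolding eA eB using r(1) by simp
    qed
    from Lim_transform_eventually[OF lim this] show ?thesis .
  qed
qed

end

lemma regular_vec_limit:
  assumes "bl_regular_vec C N V s" "\<And>n. \<eta> n \<in> N" "\<xi> \<in> N"
    and "\<And>c. bl_regular C N c \<Longrightarrow> (\<lambda>n. c (\<eta> n)) \<longlonglongrightarrow> c \<xi>"
  shows "(\<lambda>n. s (\<eta> n) z) \<longlonglongrightarrow> s \<xi> z"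
proof -
  obtain B c where B: "finite B" "\<And>e. e \<in> B \<Longrightarrow> bl_regular C N (c e)"
    "\<And>\<zeta>. \<zeta> \<in> N \<Longrightarrow> s \<zeta> = (\<lambda>x. \<Sum>e\<in>B. c e \<zeta> * e x)"
    using assms(1) unfolding bl_regular_vec_def by blast
  have "(\<lambda>n. \<Sum>e\<in>B. c e (\<eta> n) * e z) \<longlonglongrightarrow> (\<Sum>e\<in>B. c e \<xi> * e z)"
    by (intro tendsto_sum tendsto_mult tendsto_const assms(4) B(2))
  then show ?thesis using B(3)[OF assms(2)] B(3)[OF assms(3)] by simp
qed

section \<open>Limits of the cone map at an exceptional point\<close>

text \<open>A linear form vanishing at \<open>y\<close> depends on \<open>z\<close> modulo
  \<open>y\<close>. Up to the factor \<open>x0 y\<close> that class is represented by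
  \<open>x0 y *s z - x0 z *s y\<close>, which lies in the plane \<open>x0 = 0\<close>, where the
  form is a combination of \<open>y1, y2, y3\<close>.\<close>

lemma (in adapted_frame) cone_form_centered:
  assumes "pol (W (vec.span {y})) k F" "x0 y \<noteq> 0"
  shows "\<exists>f. pol {y1, y2, y3} k f \<and> (\<forall>z. F z = f (x0 y *s z - x0 z *s y))"
  using assms(1)
proof (induction rule: pol.induct)
  case (pol_const c)
  show ?case by (intro exI[of _ "\<lambda>_. c"]) (auto intro: pol.pol_const)
next
  case (pol_zero k)
  show ?case by (intro exI[of _ "\<lambda>_. 0"]) (auto intro: pol.pol_zero)
next
  case (pol_times l k F)
  then obtain f where f: "pol {y1, y2, y3} k f" "\<And>z. F z = f (x0 y *s z - x0 z *s y)" by blast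
  have l: "l \<in> forms 1" "l y = 0" using pol_times(1) vec.span_base[of y "{y}"] unfolding W_iff by auto
  define l' where "l' z = inverse (x0 y) * (l e1 * y1 z + l e2 * y2 z + l e3 * y3 z)" for z
  have l'p: "pol {y1, y2, y3} 1 l'" unfolding l'_def by (intro pol_scale pol_plus pol_var) auto
  have "l z = l' (x0 y *s z - x0 z *s y)" for z
  proof -
    let ?z = "x0 y *s z - x0 z *s y"
    have "x0 ?z = 0" by (simp add: forms1_diff[OF lin(1)] forms1_smult[OF lin(1)])
    then have "l ?z = l e1 * y1 ?z + l e2 * y2 ?z + l e3 * y3 ?z" using lin_expand[OF l(1), of ?z] by simp
    moreover have "l ?z = x0 y * l z" by (simp add: forms1_diff[OF l(1)] forms1_smult[OF l(1)] l(2))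
    ultimately have "l' ?z = inverse (x0 y) * (x0 y * l z)" unfolding l'_def by (simp only:)
    then show ?thesis using assms(2) by simp
  qed
  moreover have "pol {y1, y2, y3} (Suc k) (\<lambda>z. l' z * f z)" by (rule pol_mult'[OF l'p f(1)]) simp
  ultimately show ?case using f(2) by (intro exI[of _ "\<lambda>z. l' z * f z"]) simp
next
  case (pol_plus k F F')
  then obtain f f' where "pol {y1, y2, y3} k f" "\<And>z. F z = f (x0 y *s z - x0 z *s y)"
    "pol {y1, y2, y3} k f'" "\<And>z. F' z = f' (x0 y *s z - x0 z *s y)" by blast
  then show ?case by (intro exI[of _ "\<lambda>z. f z + f' z"]) (auto intro: pol.pol_plus)
qed

locale exceptional_frame =
  projected_curve x e1 e2 e3 x0 y1 y2 y3 "cone C" g G E2 E3 d \<alpha> pts m Q P + exceptional_point C p x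
  for C :: "psub set" and p :: psub and x e1 e2 e3 :: vec4 and x0 y1 y2 y3 :: cfun
    and g :: nat and G E2 E3 :: cfun and d :: nat and \<alpha> :: cfun and pts :: "nat \<Rightarrow> vec4"
    and m :: nat and Q P :: cfun +
  assumes tangent_iff: "\<And>z. z \<in> tangent_space C p \<longleftrightarrow> y2 z = 0 \<and> y3 z = 0"
    and d3: "d \<ge> 3"
begin

text \<open>The products that variations in the vertex produce: \<open>h\<close> vanishes to order
  \<open>d - 2\<close> at \<open>p\<close>, and the remaining linear factor is arbitrary.\<close>

definition Y :: "cfun set" where
  "Y = {\<lambda>z. l z * h z |l h. l \<in> forms 1 \<and> pol {y1, y2, y3} (d - 2) h}"

lemma Y_forms: "Y \<subseteq> forms (d - 1)"
proof
  fix F assume "F \<in> Y"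
  then obtain l h where F: "F = (\<lambda>z. l z * h z)" "l \<in> forms 1" "pol {y1, y2, y3} (d - 2) h"
    unfolding Y_def by blast
  have "h \<in> forms (d - 2)" by (rule pol_forms[OF F(3)]) blast
  then show "F \<in> forms (d - 1)" unfolding F(1) by (rule forms_mult'[OF F(2)]) (use d3 in simp)
qed

text \<open>The cofactor \<open>h\<close> is a sum of products of \<open>d - 2\<close> linear forms
  vanishing at \<open>p\<close>, so the products lie in that power of the ideal of \<open>p\<close>;
  the denominator 1 is the witness.\<close>

lemma Y_order:
  assumes F: "F \<in> cfun.span Y" and u: "\<And>z. z \<in> cone C \<Longrightarrow> u z = F z"
  shows "ord_at C (d - 1) p u \<ge> enat (d - 2)"
proof -
  have pP: "p \<in> P3" using CP pC by blast
  have pe: "p = range (\<lambda>c. c *s x)" by (rule P3_eq_range[OF pP x_in])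
  have yW: "l \<in> W p" if "l \<in> {y1, y2, y3}" for l
  proof -
    have "l \<in> forms 1" "l x = 0" using that lin dual by auto
    then show ?thesis unfolding W_iff pe by (auto simp: forms1_smult)
  qed
  have "F \<in> ideal_pow {p} (d - 2) (d - 1)"
    using F
  proof (induction rule: cfun_span_induct)
    case (base F)
    then obtain l h where F: "F = (\<lambda>z. l z * h z)" "l \<in> forms 1" "pol {y1, y2, y3} (d - 2) h"
      unfolding Y_def by blast
    have "h \<in> Wk p (d - 2)" unfolding Wk_iff using F(3) by (rule pol_mono) (use yW in blast)
    then have "(\<lambda>z. h z * l z) \<in> ideal_pow {p} (d - 2) (d - 1)"
      unfolding Wk_def
    proof (induction rule: cfun_span_induct)
      case (base h)
      then obtain f where h: "h = (\<lambda>z. \<Prod>i<d - 2. f i z)" "\<And>i. i < d - 2 \<Longrightarrow> f i \<in> W p" by blast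
      show ?case unfolding h(1)
        by (rule ideal_powI[where e = "\<lambda>_. 1" and j = 1])
          (use h(2) F(2) d3 in \<open>auto simp: W_def ideal_of_def\<close>)
    next
      case zero
      show ?case unfolding ideal_pow_def using cfun_span_zero by simp
    next
      case (add f h)
      from cfun_span_add[OF add[unfolded ideal_pow_def]] show ?case
        unfolding ideal_pow_def by (simp add: distrib_right)
    next
      case (scale c f)
      from cfun_span_scale[OF scale[unfolded ideal_pow_def], of c] show ?case
        unfolding ideal_pow_def by (simp add: mult.assoc)
    qed
    then show ?case unfolding F(1) by (simp add: mult.commute)
  next
    case zero
    show ?case unfolding ideal_pow_def by (rule cfun_span_zero)
  next
    case (add f h)
    then show ?case unfolding ideal_pow_def by (rule cfun_span_add)
  next
    case (scale c f)
    then show ?case unfolding ideal_pow_def by (rule cfun_span_scale)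
  qed
  then have FI: "F \<in> ideal_pow {p} (d - 2) (0 + (d - 1))" by simp
  have "vanishes_to_order C (d - 1) p (d - 2) u"
    unfolding vanishes_to_order_def
  proof (intro exI[of _ 0] bexI[OF _ FI] bexI[of _ "\<lambda>_. 1"] conjI ballI impI)
    show "\<not> vanishes_at (\<lambda>_. 1) p" using x_in unfolding vanishes_at_def by auto
    show "(\<lambda>_. 1) \<in> forms 0" by (rule forms_const)
  qed (simp add: u)
  then show ?thesis by (rule ord_at_ge)
qed

text \<open>
  The quadratic term lets a path with given tangent direction \<open>v\<close> pass through a given point of
  \<open>M0\<close>, hence through \<open>M0\<close> at all but finitely many parameters.
\<close>

lemma path_into_open:
  assumes M: "bl_open C M0" "M0 \<noteq> {}" "M0 \<subseteq> Off ` U C" and v: "v \<notin> t"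
  obtains w where "\<forall>\<^sub>F s in at 0. Off (vec.span {path v w s}) \<in> M0"
proof -
  obtain \<zeta> where z: "\<zeta> \<in> M0" using M(2) by blast
  obtain q where q: "\<zeta> = Off q" "q \<in> U C" using M(3) z by blast
  have qP: "q \<in> P3" using q(2) unfolding U_def by blast
  obtain y where y: "y \<in> q" "y \<noteq> 0" by (rule P3_nonzero[OF qP])
  obtain k m b where b: "b \<in> ideal_pow C k m" "bl_eval C k b \<zeta> \<noteq> 0"
    "\<And>\<eta>. \<eta> \<in> blowup C \<Longrightarrow> bl_eval C k b \<eta> \<noteq> 0 \<Longrightarrow> \<eta> \<in> M0"
    using M(1) z unfolding bl_open_def by blast
  have bf: "b \<in> forms m" by (rule ideal_pow_forms[OF b(1)])
  obtain c where c: "c \<noteq> 0" "\<And>a m k. a \<in> forms m \<Longrightarrow> bl_eval C k a (Off q) = c ^ m * a y"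
    by (rule bl_eval_Off[OF qP y]) blast
  have by0: "b y \<noteq> 0" using b(2) unfolding q(1) c(2)[OF bf] by simp
  define w where "w = y - x - v"
  have "x + 1 *s v + 1 ^ 2 *s w = y" by (simp add: w_def)
  then have "\<forall>\<^sub>F s in at 0. b (x + s *s v + s ^ 2 *s w) \<noteq> 0"
    using forms_path_eventually_nonzero[OF bf, of x 1 v w] by0 by metis
  with path_off_curve[OF v, of w]
  have "\<forall>\<^sub>F s in at 0. Off (vec.span {path v w s}) \<in> M0"
  proof eventually_elim
    case (elim s)
    let ?y = "path v w s"
    have qs: "vec.span {?y} \<in> P3" using elim by blast
    obtain c where c: "c \<noteq> 0" "\<And>a m k. a \<in> forms m \<Longrightarrow> bl_eval C k a (Off (vec.span {?y})) = c ^ m * a ?y"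
      by (rule bl_eval_Off[OF qs vec.span_base, of ?y]) (use elim in auto)
    have "b ?y \<noteq> 0" using elim unfolding path_def by blast
    then have "bl_eval C k b (Off (vec.span {?y})) \<noteq> 0" unfolding c(2)[OF bf] using c(1) by simp
    moreover have "Off (vec.span {?y}) \<in> blowup C" using elim unfolding blowup_def by blast
    ultimately show ?case using b(3) by blast
  qed
  then show ?thesis using that by blast
qed

text \<open>\<open>y3 (nrm H) \<noteq> 0\<close> means that \<open>H\<close> is not the osculating
  plane. A sequence on an arc with tangent direction \<open>nrm H\<close> lies in \<open>M0\<close>,
  where every combination of the frame is a cone form with vertex on the arc, and in
  \<open>M\<close>, where the frame is regular; \<open>cone_limit\<close> then applies with the
  coefficients \<open>a\<close> kept fixed.\<close>

lemma value_general_direction: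
  assumes M: "bl_open C M" "Exc p H \<in> M" and v: "y3 (nrm H) \<noteq> 0"
    and M0: "bl_open C M0" "M0 \<noteq> {}" "M0 \<subseteq> Off ` U C"
    and gR: "\<And>q. Off q \<in> M0 \<Longrightarrow> gr (Off q) = R C (d - 1) q"
    and s: "\<And>i. i < (n::nat) \<Longrightarrow> bl_regular_vec C M V (s i)"
    and gs: "\<And>\<eta>. \<eta> \<in> M \<Longrightarrow> gr \<eta> = cfun.span ((\<lambda>i. s i \<eta>) ` {..<n})"
  shows "\<exists>F\<in>cfun.span Y. \<forall>z\<in>cone C. (\<Sum>i<n. a i * s i (Exc p H) z) = F z"
proof -
  let ?v = "nrm H"
  have vt: "?v \<notin> t" using v tangent_iff by blast
  obtain w where w: "\<forall>\<^sub>F s in at 0. Off (vec.span {path ?v w s}) \<in> M0"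
    by (rule path_into_open[OF M0 vt])
  have pv: "path ?v w s = vtx ?v w s" for s by (simp add: path_def vtx_def)
  have "x0 (x + 0 *s ?v + 0 ^ 2 *s w) \<noteq> 0" by (simp add: dual)
  from forms_path_eventually_nonzero[OF lin(1) this]
  have x0w: "\<forall>\<^sub>F s in at 0. x0 (path ?v w s) \<noteq> 0" unfolding path_def .
  have oM: "\<forall>\<^sub>F s in at 0. Off (vec.span {path ?v w s}) \<in> M" by (rule open_along_path[OF M vt])
  obtain r where r: "r \<longlonglongrightarrow> 0" "\<And>j. r j \<noteq> 0"
    "\<And>j. Off (vec.span {path ?v w (r j)}) \<in> M0 \<and> x0 (path ?v w (r j)) \<noteq> 0 \<and> Off (vec.span {path ?v w (r j)}) \<in> M"
    by (rule sequence_at_zero[OF eventually_conj[OF w eventually_conj[OF x0w oM]]]) blast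
  define \<eta> where "\<eta> j = Off (vec.span {path ?v w (r j)})" for j
  define u where "u j z = (\<Sum>i<n. a i * s i (\<eta> j) z)" for j z
  have uR: "\<exists>f. pol {y1, y2, y3} (d - 1) f \<and> (\<forall>z\<in>cone C. u j z = f (mv ?v w (r j) z))" for j
  proof -
    let ?y = "path ?v w (r j)"
    have "u j \<in> cfun.span ((\<lambda>i. s i (\<eta> j)) ` {..<n})"
      unfolding u_def by (intro cfun_span_sum cfun_span_scale cfun.span_base) simp
    also have "\<dots> = gr (\<eta> j)" using gs r(3) unfolding \<eta>_def by simp
    also have "\<dots> = R C (d - 1) (vec.span {?y})" using gR r(3) unfolding \<eta>_def by simp
    finally obtain F where F: "u j = restr C F" "F \<in> Wk (vec.span {?y}) (d - 1)" unfolding R_def by blast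
    obtain f where f: "pol {y1, y2, y3} (d - 1) f" "\<And>z. F z = f (x0 ?y *s z - x0 z *s ?y)"
      using cone_form_centered[OF F(2)[unfolded Wk_iff]] r(3) by blast
    have "u j z = f (mv ?v w (r j) z)" if "z \<in> cone C" for z
      unfolding F(1) restr_cone[OF that] f(2) mv_def pv ..
    with f(1) show ?thesis by blast
  qed
  then have "\<forall>j. \<exists>f. pol {y1, y2, y3} (d - 1) f \<and> (\<forall>z\<in>cone C. u j z = f (mv ?v w (r j) z))" by blast
  from choice[OF this] obtain f where f: "\<forall>j. pol {y1, y2, y3} (d - 1) (f j) \<and>
    (\<forall>z\<in>cone C. u j z = f j (mv ?v w (r j) z))" ..
  have sl: "(\<lambda>j. s i (\<eta> j) z) \<longlonglongrightarrow> s i (Exc p H) z" if "i < n" for i z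
  proof (rule regular_vec_limit[OF s[OF that]])
    show "\<eta> j \<in> M" for j using r(3) unfolding \<eta>_def by blast
    show "Exc p H \<in> M" by (rule M(2))
    fix c assume c: "bl_regular C M c"
    from filterlim_compose[OF regular_along_path[OF c M(2) vt oM] sequence_filterlim[OF r(1,2)]]
    show "(\<lambda>j. c (\<eta> j)) \<longlonglongrightarrow> c (Exc p H)" unfolding \<eta>_def .
  qed
  have ul: "(\<lambda>j. u j z) \<longlonglongrightarrow> (\<Sum>i<n. a i * s i (Exc p H) z)" for z
    unfolding u_def by (intro tendsto_sum tendsto_mult tendsto_const sl) simp
  show ?thesis
    unfolding Y_def
    by (rule cone_limit[where u = u and f = f and t = r, OF d3 v r(1,2) _ _ ul]) (use f in auto)
qed

text \<open>Tilting the normal direction by \<open>r *s e3\<close> moves the plane off the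
  osculating one for small \<open>r \<noteq> 0\<close>. The values at the tilted planes lie on the
  curve in one finite-dimensional space, which is closed under limits.\<close>

lemma value_all_directions:
  assumes M: "bl_open C M" "Exc p H \<in> M" and H: "vec.subspace H" "vec.dim H = 3" "t \<subseteq> H"
    and M0: "bl_open C M0" "M0 \<noteq> {}" "M0 \<subseteq> Off ` U C"
    and gR: "\<And>q. Off q \<in> M0 \<Longrightarrow> gr (Off q) = R C (d - 1) q"
    and s: "\<And>i. i < (n::nat) \<Longrightarrow> bl_regular_vec C M V (s i)"
    and gs: "\<And>\<eta>. \<eta> \<in> M \<Longrightarrow> gr \<eta> = cfun.span ((\<lambda>i. s i \<eta>) ` {..<n})"
    and dimt: "vec.dim t = 2"
    and u: "u \<in> gr (Exc p H)"
  shows "\<exists>F\<in>cfun.span Y. \<forall>z\<in>cone C. u z = F z"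
proof -
  obtain a where a: "u = (\<lambda>z. \<Sum>i<n. a i * s i (Exc p H) z)"
    using cfun_span_family[where s = "\<lambda>i. s i (Exc p H)", OF finite_lessThan u[unfolded gs[OF M(2)]]] by blast
  have spt: "vec.span t = t" using tangent_subspace CP pC vec.span_eq_iff by blast
  define P where "P r \<longleftrightarrow> y3 (nrm H + r *s e3) \<noteq> 0" for r
  define K where "K r = vec.span (insert (nrm H + r *s e3) t)" for r
  have nt: "nrm H + r *s e3 \<notin> t" if "P r" for r using that tangent_iff unfolding P_def by blast
  have Kt: "t \<subseteq> K r" for r unfolding K_def using vec.span_superset by blast
  have Kp: "K r \<in> planes" if "P r" for r
  proof -
    have "nrm H + r *s e3 \<notin> vec.span t" using nt[OF that] unfolding spt .
    then have "vec.dim (insert (nrm H + r *s e3) t) = 3" by (simp add: vec.dim_insert dimt)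
    then show ?thesis by (simp add: planes_def K_def)
  qed
  have dir: "\<exists>c \<tau>. c \<noteq> 0 \<and> \<tau> \<in> t \<and> nrm (K r) = c *s (nrm H + r *s e3) + \<tau>" if "P r" for r
  proof -
    have "nrm H + r *s e3 \<in> K r - t" using nt[OF that] vec.span_base unfolding K_def by blast
    then have n: "nrm (K r) \<in> K r - t" unfolding nrm_def by (rule someI)
    moreover have "nrm (K r) \<in> vec.span (insert (nrm H + r *s e3) t)" using n unfolding K_def by blast
    then obtain c where c: "nrm (K r) - c *s (nrm H + r *s e3) \<in> t"
      using vec.span_breakdown_eq[of "nrm (K r)" "nrm H + r *s e3" t] unfolding spt by blast
    ultimately have "c \<noteq> 0" using c by auto
    then show ?thesis using c by (intro exI[of _ c] exI[of _ "nrm (K r) - c *s (nrm H + r *s e3)"]) simp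
  qed
  have evP: "eventually P (at 0)"
  proof -
    have "{r. y3 (nrm H) + r = 0} \<subseteq> {- y3 (nrm H)}" by (auto simp: eq_neg_iff_add_eq_0 add.commute)
    then have "finite {r. y3 (nrm H) + r = 0}" by (rule finite_subset) simp
    then have "finite ({r. y3 (nrm H) + r = 0} - {0})" by simp
    then have "open (- ({r. y3 (nrm H) + r = 0} - {0}))" by (intro open_Compl finite_imp_closed)
    moreover have "P r \<longleftrightarrow> y3 (nrm H) + r \<noteq> 0" for r
      by (simp add: P_def forms1_add[OF lin(4)] forms1_smult[OF lin(4)] dual)
    ultimately show ?thesis unfolding eventually_at_topological by blast
  qed
  have exc: "Exc p (K r) \<in> blowup C" if "P r" for r
    unfolding blowup_def exceptional_def using Kp[OF that] Kt pC by blast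
  have oM: "\<forall>\<^sub>F r in at 0. Exc p (K r) \<in> M"
    by (rule along_fibre(1)[where P = P and e = e3, OF dir evP exc M])
  obtain r where r: "r \<longlonglongrightarrow> 0" "\<And>j. r j \<noteq> 0" "\<And>j. P (r j) \<and> Exc p (K (r j)) \<in> M"
    by (rule sequence_at_zero[OF eventually_conj[OF evP oM]]) blast
  have "y3 (nrm (K (r j))) \<noteq> 0" for j
  proof -
    obtain c \<tau> where c: "c \<noteq> 0" "\<tau> \<in> t" "nrm (K (r j)) = c *s (nrm H + r j *s e3) + \<tau>" using dir r(3) by blast
    have "y3 (nrm (K (r j))) = c * y3 (nrm H + r j *s e3) + y3 \<tau>"
      unfolding c(3) forms1_add[OF lin(4), of "c *s _"] forms1_smult[OF lin(4)] ..
    then show ?thesis using c(1,2) r(3)[of j] tangent_iff unfolding P_def by simp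
  qed
  then have "\<forall>j. \<exists>F. F \<in> cfun.span Y \<and> (\<forall>z\<in>cone C. (\<Sum>i<n. a i * s i (Exc p (K (r j))) z) = F z)"
    using value_general_direction[OF M(1) _ _ M0 gR s gs, of "K _" a] r(3) by blast
  from choice[OF this] obtain F where F: "\<forall>j. F j \<in> cfun.span Y \<and>
    (\<forall>z\<in>cone C. (\<Sum>i<n. a i * s i (Exc p (K (r j))) z) = F j z)" ..
  have sl: "(\<lambda>j. s i (Exc p (K (r j))) z) \<longlonglongrightarrow> s i (Exc p H) z" if "i < n" for i z
  proof (rule regular_vec_limit[OF s[OF that]])
    show "Exc p (K (r j)) \<in> M" for j using r(3) by blast
    show "Exc p H \<in> M" by (rule M(2))
    fix c assume c: "bl_regular C M c"
    from filterlim_compose[OF along_fibre(2)[where P = P and e = e3, OF dir evP exc c M(2) oM] sequence_filterlim[OF r(1,2)]]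
    show "(\<lambda>j. c (Exc p (K (r j)))) \<longlonglongrightarrow> c (Exc p H)" .
  qed
  have ul: "(\<lambda>j. \<Sum>i<n. a i * s i (Exc p (K (r j))) z) \<longlonglongrightarrow> u z" for z
    unfolding a by (intro tendsto_sum tendsto_mult tendsto_const sl) simp
  show ?thesis
  proof (rule span_limit_closed[where u = "\<lambda>j z. \<Sum>i<n. a i * s i (Exc p (K (r j))) z" and H = F, OF Y_forms])
    show "(\<Sum>i<n. a i * s i (Exc p (K (r j))) z) = F j z" if "z \<in> cone C" for j z using F that by blast
    show "F j \<in> cfun.span Y" for j using F by blast
  qed (rule ul)
qed

end

theorem corollary5p9:
  fixes C :: "psub set" and d :: nat and p H :: psub
  assumes "smooth_irreducible_curve C" and "nondegenerate C" and "has_degree C d"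
    and "p \<in> C - \<Gamma> C"
    and "Exc p H \<in> exceptional C"
    and "Exc p H \<in> regularity_domain C d"
  shows "\<forall>u \<in> R_ext C d (Exc p H). ord_at C (d - 1) p u \<ge> enat (d - 2)"
proof (cases "d \<ge> 3")
  case False
  \<comment> \<open>For \<open>d \<le> 2\<close> the truncated difference is 0.\<close>
  then have "enat (d - 2) = 0" by (simp add: zero_enat_def)
  then show ?thesis by simp
next
  case True
  have zc: "zclosed C"
    using assms(1) unfolding smooth_irreducible_curve_def irreducible_closed_def by blast
  have CP: "C \<subseteq> P3" by (rule zclosed_P3[OF zc])
  have pC: "p \<in> C" using assms(4) by blast
  define x where "x = (SOME x. x \<in> p - {0})"
  interpret ep: exceptional_point C p x by unfold_locales (rule CP, rule pC, rule x_def)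
  obtain e1 e2 e3 x0 y1 y2 y3 g G E2 E3 \<alpha> pts m Q P where
    pc: "projected_curve x e1 e2 e3 x0 y1 y2 y3 (cone C) g G E2 E3 d \<alpha> pts m Q P"
    and tt: "\<And>z. z \<in> tangent_space C p \<longleftrightarrow> y2 z = 0 \<and> y3 z = 0"
    by (rule projected_frame_exists[OF assms(1-4) ep.x_in]) blast
  interpret pc: projected_curve x e1 e2 e3 x0 y1 y2 y3 "cone C" g G E2 E3 d \<alpha> pts m Q P by (rule pc)
  interpret ef: exceptional_frame C p x e1 e2 e3 x0 y1 y2 y3 g G E2 E3 d \<alpha> pts m Q P
    by unfold_locales (rule tt, rule True)
  have H: "vec.subspace H" "vec.dim H = 3" "tangent_space C p \<subseteq> H"
    using assms(5) unfolding exceptional_def planes_def by auto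
  have dimt: "vec.dim (tangent_space C p) = 2"
  proof -
    have "enat (vec.dim (tangent_space C p)) = 1 + 1"
      using assms(1) pC unfolding smooth_irreducible_curve_def by auto
    then show ?thesis by (simp add: one_enat_def)
  qed
  \<comment> \<open>\<open>R_ext\<close> picks the value of some representative; the argument below
    holds for any of them.\<close>
  have "\<exists>T N g. represents_cone_map C d N g \<and> Exc p H \<in> N \<and> T = g (Exc p H)"
    using assms(6) unfolding regularity_domain_def by blast
  from someI_ex[OF this] obtain N gr where gr: "represents_cone_map C d N gr" "Exc p H \<in> N"
    "R_ext C d (Exc p H) = gr (Exc p H)"
    unfolding R_ext_def by blast
  obtain M0 where M0: "bl_open C M0" "M0 \<noteq> {}" "M0 \<subseteq> N \<inter> Off ` U C"
    "\<And>q. Off q \<in> M0 \<Longrightarrow> gr (Off q) = R C (d - 1) q"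
    using gr(1) unfolding represents_cone_map_def by blast
  have "\<exists>M s. bl_open C M \<and> Exc p H \<in> M \<and> M \<subseteq> N \<and>
      (\<forall>i<(d + 1) choose 2. bl_regular_vec C M (sections C (d - 1)) (s i)) \<and>
      (\<forall>\<eta>\<in>M. gr \<eta> = cfun.span ((\<lambda>i. s i \<eta>) ` {..<(d + 1) choose 2}))"
    using gr(1,2) unfolding represents_cone_map_def grass_morphism_def by blast
  then obtain M s where Ms: "bl_open C M \<and> Exc p H \<in> M \<and> M \<subseteq> N \<and>
      (\<forall>i<(d + 1) choose 2. bl_regular_vec C M (sections C (d - 1)) (s i)) \<and>
      (\<forall>\<eta>\<in>M. gr \<eta> = cfun.span ((\<lambda>i. s i \<eta>) ` {..<(d + 1) choose 2}))"
    by (elim exE)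
  then have M: "bl_open C M" "Exc p H \<in> M" "M \<subseteq> N"
    "\<And>i. i < (d + 1) choose 2 \<Longrightarrow> bl_regular_vec C M (sections C (d - 1)) (s i)"
    "\<And>\<eta>. \<eta> \<in> M \<Longrightarrow> gr \<eta> = cfun.span ((\<lambda>i. s i \<eta>) ` {..<(d + 1) choose 2})"
    by blast+
  show ?thesis
  proof
    fix u assume "u \<in> R_ext C d (Exc p H)"
    then have u: "u \<in> gr (Exc p H)" using gr(3) by simp
    have M0': "M0 \<subseteq> Off ` U C" using M0(3) by blast
    obtain F where "F \<in> cfun.span ef.Y" "\<forall>z\<in>cone C. u z = F z"
      using ef.value_all_directions[OF M(1,2) H M0(1,2) M0' M0(4) M(4,5) dimt u] by blast
    then show "ord_at C (d - 1) p u \<ge> enat (d - 2)" using ef.Y_order by blast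
  qed
qed

end
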